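(* Source-equally-spaced circular instances of FLaMECaST with one intermediate layer and one sink can be approximated within a factor of $1+\varepsilon$ (i.e., a valid layout of cost at most $(1+\varepsilon)$ times the minimum can be computed) in $O\!\left(n^2\log^3\!\left(\frac{1}{\varepsilon}\right)\right)$ time, where $n$ is the number of sources.
   Context: FLaMECaST: an instance $I=(S,T,C,\alpha)$ consists of a finite set $S$ of sources and a finite set $T$ of sinks, each with a fixed position in $\mathbb{R}^2$, capacities $C=(c_0,\dots,c_{\lambda+1})$ with integers $c_0\ge\dots\ge c_{\lambda+1}\ge 1$ ($\lambda$ = number of intermediate layers; here $\lambda=1$), and $\alpha\in[0,1]$. A topology is a rooted forest (edges directed from child to parent) of height at most $\lambda+1$ whose leaves are exactly $S$ and whose roots lie in $T$ (other vertices are Steiner vertices); the layer of a vertex is its distance to its root; the load $\ell(v)$ is the number of sources in the subtree of $v$ and the load of edge $uv$ ($u$ child) is $\ell(u)$; it is valid if $\ell(v)\le c_i$ for every vertex $v$ in layer $i$. An embedding maps sources and sinks to their positions and Steiner vertices to arbitrary points; edge cost is $\|\mathrm{pos}(u)-\mathrm{pos}(v)\|\cdot\ell(uv)^\alpha$; a layout is a topology with an embedding, its cost the sum of edge costs; the goal is a valid layout of minimum cost. A circular instance has all sources on a circle and all sinks at its center; it is source-equally-spaced if the $n$ sources are evenly distributed on the circle (consecutive sources separated by angle $2\pi/n$). *)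

theory Defs
  imports "HOL-Analysis.Analysis"
begin

section \<open>Instances, topologies and layouts\<close>

type_synonym point = "real \<times> real"

text \<open>The capacity list is \<open>[c\<^sub>0, \<dots>, c\<^sub>\<lambda>\<^sub>+\<^sub>1]\<close>, so it has length \<open>\<lambda> + 2\<close>.\<close>

record flamecast =
  sources :: "nat set"
  sinks :: "nat set"
  source_pos :: "nat \<Rightarrow> point"
  sink_pos :: "nat \<Rightarrow> point"
  caps :: "nat list"
  alpha :: real

definition is_instance :: "flamecast \<Rightarrow> bool" where
  "is_instance I \<longleftrightarrow>
     finite (sources I) \<and> finite (sinks I) \<and>
     2 \<le> length (caps I) \<and> sorted_wrt (\<ge>) (caps I) \<and> (\<forall>c\<in>set (caps I). 1 \<le> c) \<and>
     0 \<le> alpha I \<and> alpha I \<le> 1"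

definition intermediate_layers :: "flamecast \<Rightarrow> nat" where
  "intermediate_layers I = length (caps I) - 2"

datatype vertex = Source nat | Sink nat | Steiner nat

text \<open>An edge \<open>(u, v)\<close> is directed from the child \<open>u\<close> to the parent \<open>v\<close>.\<close>

record topology =
  verts :: "vertex set"
  edges :: "(vertex \<times> vertex) set"

definition rooted_forest :: "topology \<Rightarrow> bool" where
  "rooted_forest F \<longleftrightarrow>
     finite (verts F) \<and> edges F \<subseteq> verts F \<times> verts F \<and>
     single_valued (edges F) \<and> acyclic (edges F)"

definition roots :: "topology \<Rightarrow> vertex set" where
  "roots F = {v \<in> verts F. \<nexists>w. (v, w) \<in> edges F}"

definition leaves :: "topology \<Rightarrow> vertex set" where
  "leaves F = {v \<in> verts F. \<nexists>u. (u, v) \<in> edges F}"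

definition layer :: "topology \<Rightarrow> vertex \<Rightarrow> nat" where
  "layer F v = (THE k. \<exists>r\<in>roots F. (v, r) \<in> edges F ^^ k)"

definition load :: "flamecast \<Rightarrow> topology \<Rightarrow> vertex \<Rightarrow> nat" where
  "load I F v = card {s \<in> sources I. (Source s, v) \<in> (edges F)\<^sup>*}"

definition is_topology :: "flamecast \<Rightarrow> topology \<Rightarrow> bool" where
  "is_topology I F \<longleftrightarrow>
     rooted_forest F \<and>
     leaves F = Source ` sources I \<and>
     roots F \<subseteq> Sink ` sinks I \<and>
     verts F - leaves F - roots F \<subseteq> range Steiner \<and>
     (\<forall>v\<in>verts F. layer F v \<le> intermediate_layers I + 1)"

definition valid_topology :: "flamecast \<Rightarrow> topology \<Rightarrow> bool" where
  "valid_topology I F \<longleftrightarrow>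
     is_topology I F \<and> (\<forall>v\<in>verts F. load I F v \<le> caps I ! layer F v)"

text \<open>As sources and sinks are fixed, an embedding is determined by the positions \<open>q\<close> of the
  Steiner vertices.\<close>

fun embedding :: "flamecast \<Rightarrow> (nat \<Rightarrow> point) \<Rightarrow> vertex \<Rightarrow> point" where
  "embedding I q (Source s) = source_pos I s"
| "embedding I q (Sink t) = sink_pos I t"
| "embedding I q (Steiner j) = q j"

definition layout_cost :: "flamecast \<Rightarrow> topology \<Rightarrow> (nat \<Rightarrow> point) \<Rightarrow> real" where
  "layout_cost I F q =
     (\<Sum>(u, v)\<in>edges F. norm (embedding I q u - embedding I q v) * real (load I F u) powr alpha I)"

definition feasible :: "flamecast \<Rightarrow> bool" where
  "feasible I \<longleftrightarrow> (\<exists>F. valid_topology I F)"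

definition opt_cost :: "flamecast \<Rightarrow> real" where
  "opt_cost I = Inf {layout_cost I F q | F q. valid_topology I F}"

definition circular :: "flamecast \<Rightarrow> point \<Rightarrow> real \<Rightarrow> bool" where
  "circular I z r \<longleftrightarrow>
     0 < r \<and> (\<forall>s\<in>sources I. source_pos I s \<in> sphere z r) \<and> (\<forall>t\<in>sinks I. sink_pos I t = z)"

definition source_equally_spaced_circular :: "flamecast \<Rightarrow> bool" where
  "source_equally_spaced_circular I \<longleftrightarrow>
     (\<exists>z r \<theta> f. circular I z r \<and>
        bij_betw f {..<card (sources I)} (sources I) \<and>
        (\<forall>k<card (sources I).
           let \<phi> = \<theta> + 2 * pi * real k / real (card (sources I))
           in source_pos I (f k) = z + r *\<^sub>R (cos \<phi>, sin \<phi>)))"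


section \<open>A real random access machine\<close>

text \<open>
  Programs work on named banks of cells, each bank indexed by the natural numbers and holding
  either natural numbers or exact real numbers; a scalar variable is cell 0 of a bank.
  Every arithmetic operation, comparison, connective, memory access and assignment takes unit time.
  Besides field operations and square roots (for Euclidean distances), reals can be
  obtained as powers of a natural number, which is the form of the load-dependent factor of the
  edge cost. There is no rounding from reals to naturals, and naturals can only be added, subtracted
  (truncated at 0) and compared. Programs contain no real constants; rational ones arise by
  division.
\<close>

datatype nexp =
    NConst nat
  | NGet string nexp
  | NAdd nexp nexp
  | NSub nexp nexp

datatype rexp =
    RNat nexp
  | RGet string nexp
  | RAdd rexp rexp
  | RSub rexp rexp
  | RMul rexp rexp
  | RDiv rexp rexp
  | RSqrt rexp
  | RPowr nexp rexp

datatype bexp =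
    NLess nexp nexp
  | RLess rexp rexp
  | BNot bexp
  | BAnd bexp bexp

datatype com =
    Skip
  | NSet string nexp nexp
  | RSet string nexp rexp
  | Seq com com
  | Cond bexp com com
  | While bexp com

record state =
  nmem :: "string \<Rightarrow> nat \<Rightarrow> nat"
  rmem :: "string \<Rightarrow> nat \<Rightarrow> real"

fun nval :: "nexp \<Rightarrow> state \<Rightarrow> nat" where
  "nval (NConst k) s = k"
| "nval (NGet a i) s = nmem s a (nval i s)"
| "nval (NAdd x y) s = nval x s + nval y s"
| "nval (NSub x y) s = nval x s - nval y s"

fun rval :: "rexp \<Rightarrow> state \<Rightarrow> real" where
  "rval (RNat e) s = real (nval e s)"
| "rval (RGet a i) s = rmem s a (nval i s)"
| "rval (RAdd x y) s = rval x s + rval y s"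
| "rval (RSub x y) s = rval x s - rval y s"
| "rval (RMul x y) s = rval x s * rval y s"
| "rval (RDiv x y) s = rval x s / rval y s"
| "rval (RSqrt x) s = sqrt (rval x s)"
| "rval (RPowr e x) s = real (nval e s) powr rval x s"

fun bval :: "bexp \<Rightarrow> state \<Rightarrow> bool" where
  "bval (NLess x y) s \<longleftrightarrow> nval x s < nval y s"
| "bval (RLess x y) s \<longleftrightarrow> rval x s < rval y s"
| "bval (BNot b) s \<longleftrightarrow> \<not> bval b s"
| "bval (BAnd b b') s \<longleftrightarrow> bval b s \<and> bval b' s"

fun ntime :: "nexp \<Rightarrow> nat" where
  "ntime (NConst k) = 1"
| "ntime (NGet a i) = 1 + ntime i"
| "ntime (NAdd x y) = 1 + ntime x + ntime y"
| "ntime (NSub x y) = 1 + ntime x + ntime y"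

fun rtime :: "rexp \<Rightarrow> nat" where
  "rtime (RNat e) = 1 + ntime e"
| "rtime (RGet a i) = 1 + ntime i"
| "rtime (RAdd x y) = 1 + rtime x + rtime y"
| "rtime (RSub x y) = 1 + rtime x + rtime y"
| "rtime (RMul x y) = 1 + rtime x + rtime y"
| "rtime (RDiv x y) = 1 + rtime x + rtime y"
| "rtime (RSqrt x) = 1 + rtime x"
| "rtime (RPowr e x) = 1 + ntime e + rtime x"

fun btime :: "bexp \<Rightarrow> nat" where
  "btime (NLess x y) = 1 + ntime x + ntime y"
| "btime (RLess x y) = 1 + rtime x + rtime y"
| "btime (BNot b) = 1 + btime b"
| "btime (BAnd b b') = 1 + btime b + btime b'"

text \<open>\<open>exec c s t s'\<close>: started in \<open>s\<close>, the program \<open>c\<close> terminates in \<open>s'\<close> after \<open>t\<close> time units.\<close>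

inductive exec :: "com \<Rightarrow> state \<Rightarrow> nat \<Rightarrow> state \<Rightarrow> bool" where
  Skip: "exec Skip s 1 s"
| NSet: "exec (NSet a i e) s (1 + ntime i + ntime e)
     (s\<lparr>nmem := (nmem s)(a := (nmem s a)(nval i s := nval e s))\<rparr>)"
| RSet: "exec (RSet a i e) s (1 + ntime i + rtime e)
     (s\<lparr>rmem := (rmem s)(a := (rmem s a)(nval i s := rval e s))\<rparr>)"
| Seq: "exec c s t s' \<Longrightarrow> exec c' s' t' s'' \<Longrightarrow> exec (Seq c c') s (t + t') s''"
| CondTrue: "bval b s \<Longrightarrow> exec c s t s' \<Longrightarrow> exec (Cond b c c') s (1 + btime b + t) s'"
| CondFalse: "\<not> bval b s \<Longrightarrow> exec c' s t s' \<Longrightarrow> exec (Cond b c c') s (1 + btime b + t) s'"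
| WhileFalse: "\<not> bval b s \<Longrightarrow> exec (While b c) s (1 + btime b) s"
| WhileTrue: "bval b s \<Longrightarrow> exec c s t s' \<Longrightarrow> exec (While b c) s' t' s'' \<Longrightarrow>
     exec (While b c) s (1 + btime b + t + t') s''"

inductive_cases SkipE: "exec Skip s t s'"
inductive_cases NSetE: "exec (NSet a i e) s t s'"
inductive_cases RSetE: "exec (RSet a i e) s t s'"
inductive_cases SeqE: "exec (Seq c c') s t s'"
inductive_cases CondE: "exec (Cond b c c') s t s'"
inductive_cases WhileE: "exec (While b c) s t s'"

lemma exec_deterministic:
  "exec c s t s' \<Longrightarrow> exec c s u s'' \<Longrightarrow> u = t \<and> s'' = s'"
proof (induction arbitrary: u s'' rule: exec.induct)
  case (Skip s)
  then show ?case by (rule SkipE) simp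
next
  case (NSet a i e s)
  then show ?case by (rule NSetE) simp
next
  case (RSet a i e s)
  then show ?case by (rule RSetE) simp
next
  case (Seq c s t s' c' t' s1)
  from Seq.prems obtain v w z where "u = v + w" "exec c s v z" "exec c' z w s''"
    by (rule SeqE)
  then show ?case using Seq.IH by metis
next
  case (CondTrue b s c t s' c')
  from CondTrue.prems CondTrue.hyps(1) obtain v where "u = 1 + btime b + v" "exec c s v s''"
    by - (erule CondE; simp)
  then show ?case using CondTrue.IH by simp
next
  case (CondFalse b s c' t s' c)
  from CondFalse.prems CondFalse.hyps(1) obtain v where "u = 1 + btime b + v" "exec c' s v s''"
    by - (erule CondE; simp)
  then show ?case using CondFalse.IH by simp
next
  case (WhileFalse b s c)
  from WhileFalse.prems WhileFalse.hyps show ?case by - (erule WhileE; simp)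
next
  case (WhileTrue b s c t s' t' s1)
  from WhileTrue.prems WhileTrue.hyps(1) obtain v w z
    where "u = 1 + btime b + v + w" "exec c s v z" "exec (While b c) z w s''"
    by - (erule WhileE; simp)
  then show ?case using WhileTrue.IH by metis
qed


section \<open>Input and output conventions for instances with a single sink\<close>

text \<open>
  The list \<open>xs\<close> enumerates the sources in the (arbitrary) order in which they are presented to the
  program, and \<open>t\<close> is the sink.
\<close>

definition input_state :: "flamecast \<Rightarrow> nat list \<Rightarrow> nat \<Rightarrow> real \<Rightarrow> state" where
  "input_state I xs t \<epsilon> =
     \<lparr>nmem = (\<lambda>a i.
        if a = ''n'' \<and> i = 0 then length xs
        else if a = ''cap'' \<and> i < length (caps I) then caps I ! i
        else 0),
      rmem = (\<lambda>a i.
        if a = ''source_x'' \<and> i < length xs then fst (source_pos I (xs ! i))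
        else if a = ''source_y'' \<and> i < length xs then snd (source_pos I (xs ! i))
        else if a = ''sink_x'' \<and> i = 0 then fst (sink_pos I t)
        else if a = ''sink_y'' \<and> i = 0 then snd (sink_pos I t)
        else if a = ''alpha'' \<and> i = 0 then alpha I
        else if a = ''eps'' \<and> i = 0 then \<epsilon>
        else 0)\<rparr>"

text \<open>
  The output consists of the number of Steiner vertices, the parent of every source and of every
  Steiner vertex (0 stands for the sink, \<open>j + 1\<close> for Steiner vertex \<open>j\<close>), and the coordinates of
  the Steiner vertices.
\<close>

definition output_node :: "nat \<Rightarrow> nat \<Rightarrow> vertex" where
  "output_node t p = (if p = 0 then Sink t else Steiner (p - 1))"

definition output_topology :: "nat list \<Rightarrow> nat \<Rightarrow> state \<Rightarrow> topology" where
  "output_topology xs t s =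
     \<lparr>verts = Source ` set xs \<union> {Sink t} \<union> Steiner ` {..<nmem s ''steiner'' 0},
      edges = {(Source (xs ! i), output_node t (nmem s ''source_parent'' i)) | i. i < length xs} \<union>
              {(Steiner j, output_node t (nmem s ''steiner_parent'' j)) | j. j < nmem s ''steiner'' 0}\<rparr>"

definition output_steiner_pos :: "state \<Rightarrow> nat \<Rightarrow> point" where
  "output_steiner_pos s j = (rmem s ''steiner_x'' j, rmem s ''steiner_y'' j)"

end

theory Submission
  imports Defs
begin

text \<open>
  With one intermediate layer a layout splits the sources into groups of at most \<open>c\<^sub>1\<close> sources that
  share a Steiner vertex. For any position of that vertex the \<open>k\<close> nearest sources are consecutive
  on the circle, and by convexity and symmetry the vertex may be moved to the axis of symmetry of
  their arc, between the center and the midpoint of the two middle sources. Hence a group of size \<open>k\<close>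
  costs at least \<open>f(k)\<close>, the minimum of a convex function of one variable, and conversely every
  partition of \<open>n\<close> into parts of size at most \<open>c\<^sub>1\<close> is realised by consecutive arcs; so the optimum
  is found by dynamic programming over the group sizes, in quadratic time.

  The values \<open>f(k)\<close> are approximated by ternary search, each evaluation taking time \<open>O(k)\<close>. Pairing
  sources at distance \<open>k/2\<close> gives \<open>f(k) \<ge> r k\<^sup>2 / (4 n)\<close>, whereas the cost function has Lipschitz
  constant \<open>2 k r\<close>, so \<open>O(log (n / k) + log (1 / \<epsilon>))\<close> steps suffice. Because of
  \<open>k log (n / k) \<le> n\<close> all searches together take time \<open>O(n\<^sup>2 log (1 / \<epsilon>))\<close>.
\<close>

section \<open>The cost of a group of sources\<close>

text \<open>The groups of an arbitrary layout may interleave on the circle; the lower bound forgets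
  everything about a group except its size, which is why a table indexed by sizes suffices. The
  factor 1 + \<epsilon> is lost group by group, so it passes unchanged through sums and through the
  dynamic program. An absolute error of the search becomes a relative one only through the lower
  bound on f(k), which is smaller than k r by a factor of order n / k. Hence the stopping width is
  proportional to k / n: 2 k r times \<epsilon> k / (8 n) is \<epsilon> times r k^2 / (4 n). The
  machine shapes the rest: it has no trigonometry and cannot halve naturals, and the sources arrive
  in arbitrary order. Distances from the center are therefore fractions of the vector to the
  midpoint of the two middle sources, the circular order is regenerated by rotating one source, and
  sources are recognised by exact comparison of coordinates. With one sink, feasibility amounts to
  the capacity of that sink, so the program does not branch on it.\<close>

text \<open>Law of cosines: the distance between a point at radius \<open>r\<close> and a point at
  signed radius \<open>d\<close> whose directions differ by the angle \<open>x\<close>. A negative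
  \<open>d\<close> means the opposite ray.\<close>

definition ring_dist :: "real \<Rightarrow> real \<Rightarrow> real \<Rightarrow> real" where
  "ring_dist r d x = sqrt (r\<^sup>2 + d\<^sup>2 - 2 * r * d * cos x)"

lemma norm_polar_diff:
  "norm (r *\<^sub>R (cos a, sin a) - d *\<^sub>R (cos b, sin b)) = ring_dist r d (a - b)"
proof -
  have "(r * cos a - d * cos b)\<^sup>2 + (r * sin a - d * sin b)\<^sup>2
      = r\<^sup>2 * ((cos a)\<^sup>2 + (sin a)\<^sup>2) + d\<^sup>2 * ((cos b)\<^sup>2 + (sin b)\<^sup>2) - 2 * r * d * cos (a - b)"
    by (simp add: cos_diff power2_eq_square algebra_simps del: sin_cos_squared_add3)
  then show ?thesis
    by (simp add: ring_dist_def norm_Pair)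
qed

lemma norm_polar: fixes d b :: real shows "norm (d *\<^sub>R (cos b, sin b)) = \<bar>d\<bar>"
  using norm_polar_diff[of d b 0 b] by (simp add: ring_dist_def)

lemma polar_point_exists:
  obtains \<rho> \<psi> where "(p :: point) = \<rho> *\<^sub>R (cos \<psi>, sin \<psi>)" "0 \<le> \<rho>"
proof -
  obtain a b where p: "p = (a, b)" by (cases p)
  define z where "z = Complex a b"
  have "z = cmod z *\<^sub>R cis (Arg z)"
    using rcis_cmod_Arg[of z] by (simp add: rcis_def scaleR_conv_of_real)
  then have "a = cmod z * cos (Arg z)" "b = cmod z * sin (Arg z)"
    by (metis Re_rcis Im_rcis complex.sel rcis_cmod_Arg z_def)+
  then show ?thesis using that[of "cmod z" "Arg z"] p by simp
qed

lemma ring_dist_minus: "ring_dist r d (- x) = ring_dist r d x"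
  by (simp add: ring_dist_def)

text \<open>Splits the difference along and across the axis carrying \<open>d\<close>. Only the
  first square depends on \<open>d\<close>, so the distance grows with the gap between
  \<open>d\<close> and the projection \<open>r * cos x\<close>.\<close>

lemma ring_dist_alt: "ring_dist r d x = sqrt ((d - r * cos x)\<^sup>2 + (r * sin x)\<^sup>2)"
proof -
  have "(d - r * cos x)\<^sup>2 + (r * sin x)\<^sup>2 = d\<^sup>2 - 2 * r * d * cos x + r\<^sup>2 * ((cos x)\<^sup>2 + (sin x)\<^sup>2)"
    by (simp add: power2_eq_square algebra_simps del: sin_cos_squared_add3)
  then show ?thesis by (simp add: ring_dist_def algebra_simps)
qed

lemma ring_dist_nonneg: "0 \<le> ring_dist r d x"
  by (simp add: ring_dist_alt)

text \<open>A vector is at least as long as its component in the direction of the source.\<close>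

lemma ring_dist_ge: "r - d * cos x \<le> ring_dist r d x"
proof -
  have "(r - d * cos x)\<^sup>2 + (d * sin x)\<^sup>2 = r\<^sup>2 - 2 * r * d * cos x + d\<^sup>2 * ((cos x)\<^sup>2 + (sin x)\<^sup>2)"
    by (simp add: power2_eq_square algebra_simps del: sin_cos_squared_add3)
  then have "ring_dist r d x = sqrt ((r - d * cos x)\<^sup>2 + (d * sin x)\<^sup>2)"
    by (simp add: ring_dist_def algebra_simps)
  also have "\<dots> \<ge> sqrt ((r - d * cos x)\<^sup>2)"
    by (intro real_sqrt_le_mono) simp
  finally show ?thesis by simp
qed

text \<open>The axis point at signed radius \<open>\<rho> * cos x\<close> is the midpoint of the two
  mirror points at radius \<rho> and angles \<open>x\<close> and \<open>- x\<close>, so this is the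
  triangle inequality.\<close>

lemma ring_dist_reflect:
  "2 * ring_dist r (\<rho> * cos x) y \<le> ring_dist r \<rho> (x + y) + ring_dist r \<rho> (y - x)"
proof -
  define c where "c = (\<lambda>a::real. (cos a, sin a))"
  have "(\<rho> * cos x) *\<^sub>R c 0 = (1 / 2) *\<^sub>R (\<rho> *\<^sub>R c x + \<rho> *\<^sub>R c (- x))"
    by (simp add: c_def)
  then have "2 *\<^sub>R (r *\<^sub>R c y - (\<rho> * cos x) *\<^sub>R c 0)
      = (r *\<^sub>R c y - \<rho> *\<^sub>R c (- x)) + (r *\<^sub>R c y - \<rho> *\<^sub>R c x)"
    by (simp add: scaleR_2 scaleR_right_diff_distrib flip: scaleR_add_left)
  then have "norm (2 *\<^sub>R (r *\<^sub>R c y - (\<rho> * cos x) *\<^sub>R c 0))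
      \<le> norm (r *\<^sub>R c y - \<rho> *\<^sub>R c (- x)) + norm (r *\<^sub>R c y - \<rho> *\<^sub>R c x)"
    by (metis norm_triangle_ineq)
  then have "2 * norm (r *\<^sub>R c y - (\<rho> * cos x) *\<^sub>R c 0)
      \<le> norm (r *\<^sub>R c y - \<rho> *\<^sub>R c (- x)) + norm (r *\<^sub>R c y - \<rho> *\<^sub>R c x)"
    by (simp only: norm_scaleR abs_numeral)
  then show ?thesis
    by (simp only: c_def norm_polar_diff) (simp add: add.commute)
qed

section \<open>Smallest values of a quasiconvex sequence\<close>

text \<open>The window grows by one index on the side with the smaller neighbour. Quasiconvexity,
  applied with an element of the window as one end, makes each neighbour the smallest value on its
  side. This needs a nonempty window, so the induction starts at 1.\<close>

lemma interval_of_smallest: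
  fixes a :: "int \<Rightarrow> real" and n k :: nat
  assumes quasi: "\<And>i j l. lo \<le> i \<Longrightarrow> i \<le> j \<Longrightarrow> j \<le> l \<Longrightarrow> l < lo + int n \<Longrightarrow> a j \<le> max (a i) (a l)"
    and "1 \<le> k" "k \<le> n"
  shows "\<exists>l. lo \<le> l \<and> l + int k \<le> lo + int n \<and>
    (\<forall>i\<in>{l..<l + int k}. \<forall>x\<in>{lo..<lo + int n} - {l..<l + int k}. a i \<le> a x)"
  using assms(2,3)
proof (induction k rule: dec_induct)
  case base
  have "finite {lo..<lo + int n}" "{lo..<lo + int n} \<noteq> {}" using base by auto
  then obtain l where "l \<in> {lo..<lo + int n}" "\<forall>x\<in>{lo..<lo + int n}. a l \<le> a x"
    by (meson arg_min_if_finite(1) arg_min_least)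
  then show ?case by (intro exI[of _ l]) auto
next
  case (step k)
  then obtain l where l: "lo \<le> l" "l + int k \<le> lo + int n"
    and small: "\<And>i x. i \<in> {l..<l + int k} \<Longrightarrow> x \<in> {lo..<lo + int n} - {l..<l + int k} \<Longrightarrow> a i \<le> a x"
    by auto
  have right: "a (l + int k) \<le> a x" if "l + int k \<le> x" "x < lo + int n" for x
    using quasi[of l "l + int k" x] small[of l x] that l step.hyps by auto
  have left: "a (l - 1) \<le> a x" if "x \<le> l - 1" "lo \<le> x" for x
    using quasi[of x "l - 1" l] small[of l x] that l step.hyps by auto
  show ?case
  proof (cases "l + int k < lo + int n \<and> (l = lo \<or> a (l + int k) \<le> a (l - 1))")
    case True
    have "a i \<le> a x" if "i \<in> {l..<l + int (Suc k)}" "x \<in> {lo..<lo + int n} - {l..<l + int (Suc k)}" for i x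
    proof (cases "i = l + int k")
      case i: True
      show ?thesis
      proof (cases "x \<le> l - 1")
        case True
        then have "a (l - 1) \<le> a x" "l \<noteq> lo" using left that by auto
        then show ?thesis using i \<open>l + int k < lo + int n \<and> _\<close> by auto
      next
        case False
        then show ?thesis using i right that by auto
      qed
    next
      case False
      then show ?thesis using small[of i x] that by auto
    qed
    then show ?thesis using l True by (intro exI[of _ l]) auto
  next
    case False
    then have lo: "lo < l" using l step.prems by auto
    have "a i \<le> a x" if "i \<in> {l - 1..<l - 1 + int (Suc k)}"
      "x \<in> {lo..<lo + int n} - {l - 1..<l - 1 + int (Suc k)}" for i x
    proof (cases "i = l - 1")
      case i: True
      show ?thesis
      proof (cases "x \<le> l - 1")
        case True
        then show ?thesis using i left that by auto
      next
        case x: False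
        then have "a (l + int k) \<le> a x" "l + int k < lo + int n" using right that by auto
        then show ?thesis using i False lo by auto
      qed
    next
      case False
      then show ?thesis using small[of i x] that by auto
    qed
    then show ?thesis using l lo by (intro exI[of _ "l - 1"]) auto
  qed
qed

text \<open>Exchange argument: outside the intersection both sets have equally many elements, and
  any bijection between the two differences compares them termwise.\<close>

lemma sum_smallest_le:
  fixes a :: "'a \<Rightarrow> real"
  assumes "finite W" "finite G" "card W = card G"
    and small: "\<And>i x. i \<in> W \<Longrightarrow> x \<in> G - W \<Longrightarrow> a i \<le> a x"
  shows "sum a W \<le> sum a G"
proof -
  have "card (W - G) = card (G - W)"
    using assms(1-3) by (simp add: card_Diff_subset_Int inf_commute)
  then obtain h where h: "bij_betw h (W - G) (G - W)"
    using assms(1,2) by (meson finite_Diff finite_same_card_bij)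
  have "sum a (W - G) \<le> sum (a \<circ> h) (W - G)"
    using small bij_betwE[OF h] by (intro sum_mono) auto
  also have "\<dots> = sum a (G - W)"
    using sum.reindex_bij_betw[OF h, of a] by simp
  finally show ?thesis
    using sum.Int_Diff[OF assms(1), of a G] sum.Int_Diff[OF assms(2), of a W]
    by (simp add: inf_commute)
qed

text \<open>Angles of \<open>k\<close> consecutive sources, measured from the axis of symmetry of their arc.\<close>

definition arc_angle :: "nat \<Rightarrow> nat \<Rightarrow> nat \<Rightarrow> real" where
  "arc_angle n k j = (real j - (real k - 1) / 2) * (2 * pi / real n)"

text \<open>The radius \<open>d\<close> is signed: averaging a point with its mirror image may land
  on the ray opposite to the arc, and only \<open>arc_cost_clamp\<close> brings it back.\<close>

definition arc_cost :: "nat \<Rightarrow> real \<Rightarrow> real \<Rightarrow> nat \<Rightarrow> real \<Rightarrow> real" where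
  "arc_cost n r \<alpha> k d = (\<Sum>j<k. ring_dist r d (arc_angle n k j)) + real k powr \<alpha> * \<bar>d\<bar>"

section \<open>Reduction of an arbitrary group to a symmetric arc\<close>

lemma ring_dist_antimono_cos:
  assumes "0 \<le> r" "0 \<le> \<rho>" "cos y \<le> cos x"
  shows "ring_dist r \<rho> x \<le> ring_dist r \<rho> y"
proof -
  have "2 * r * \<rho> * cos y \<le> 2 * r * \<rho> * cos x"
    using assms by (intro mult_left_mono) auto
  then show ?thesis by (simp add: ring_dist_def)
qed

text \<open>Angles are measured from the direction of the point. On [-pi, pi] the distance increases
  with the absolute angle, so the distances along a circle cut open opposite to the point form a
  quasiconvex sequence, whose \<open>k\<close> smallest values sit in a window. The center of that
  window is absorbed into \<open>x\<close>.\<close>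

lemma nearest_sources_consecutive:
  fixes n k :: nat and r \<rho> \<beta> :: real
  assumes "0 < r" "0 \<le> \<rho>" "G \<subseteq> {..<n}" "card G = k" "1 \<le> k"
  shows "\<exists>x. (\<Sum>j<k. ring_dist r \<rho> (x + arc_angle n k j)) \<le> (\<Sum>j\<in>G. ring_dist r \<rho> (\<beta> + real j * (2 * pi / real n)))"
proof -
  have kn: "k \<le> n" using assms card_mono[of "{..<n}" G] by simp
  define st where "st = 2 * pi / real n"
  have st: "0 < st" "real n * st = 2 * pi" using kn assms(5) by (auto simp: st_def)
  define a where "a = (\<lambda>i::int. ring_dist r \<rho> (\<beta> + of_int i * st))"
  \<comment> \<open>The first index whose angle is at least -pi; the \<open>n\<close> indices from
    \<open>lo\<close> on stay within [-pi, pi]. Integers are used because \<open>lo\<close> may be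
    negative.\<close>
  define lo where "lo = \<lceil>(- pi - \<beta>) / st\<rceil>"
  have lo1: "- pi \<le> \<beta> + of_int i * st" if "lo \<le> i" for i
  proof -
    have "(- pi - \<beta>) / st \<le> of_int i" using that by (simp add: lo_def ceiling_le_iff)
    then show ?thesis using st by (simp add: field_simps)
  qed
  have lo2: "\<beta> + of_int i * st \<le> pi" if "i < lo + int n" for i
  proof -
    have "of_int lo - 1 < (- pi - \<beta>) / st" unfolding lo_def by linarith
    then have "(of_int lo - 1) * st < - pi - \<beta>" using st by (simp add: field_simps)
    moreover have "of_int i * st \<le> (of_int lo - 1 + real n) * st"
    proof (intro mult_right_mono)
      have "i \<le> lo - 1 + int n" using that by simp
      then show "real_of_int i \<le> of_int lo - 1 + real n" by linarith
    qed (use st in simp)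
    ultimately show ?thesis using st by (simp add: algebra_simps)
  qed
  have quasi: "a j \<le> max (a i) (a l)" if "lo \<le> i" "i \<le> j" "j \<le> l" "l < lo + int n" for i j l
  proof -
    let ?t = "\<lambda>i. \<beta> + real_of_int i * st"
    have t: "- pi \<le> ?t i" "?t i \<le> ?t j" "?t j \<le> ?t l" "?t l \<le> pi"
      using lo1 lo2 that st by (auto intro!: mult_right_mono)
    show ?thesis
    proof (cases "0 \<le> ?t j")
      case True
      then have "cos (?t l) \<le> cos (?t j)" using t by (intro cos_monotone_0_pi_le) auto
      then have "a j \<le> a l" using assms unfolding a_def by (intro ring_dist_antimono_cos) auto
      then show ?thesis by simp
    next
      case False
      then have "cos (- ?t i) \<le> cos (- ?t j)" using t by (intro cos_monotone_0_pi_le) linarith+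
      then have "cos (?t i) \<le> cos (?t j)" by (simp only: cos_minus)
      then have "a j \<le> a i" using assms unfolding a_def by (intro ring_dist_antimono_cos) auto
      then show ?thesis by simp
    qed
  qed
  obtain l where l: "lo \<le> l" "l + int k \<le> lo + int n"
    and small: "\<And>i x. i \<in> {l..<l + int k} \<Longrightarrow> x \<in> {lo..<lo + int n} - {l..<l + int k} \<Longrightarrow> a i \<le> a x"
    using interval_of_smallest[of lo n a k] quasi assms(5) kn by blast
  \<comment> \<open>Moves an index into \<open>{lo..<lo + int n}\<close> by a multiple of
    \<open>n\<close>, which changes the angle by full turns only.\<close>
  define m where "m = (\<lambda>j::nat. lo + (int j - lo) mod int n)"
  have n0: "0 < int n" using kn assms(5) by simp
  have inj: "inj_on m G"
  proof (rule inj_onI)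
    fix i j assume "i \<in> G" "j \<in> G" "m i = m j"
    then have "i < n" "j < n" "(int i - lo) mod int n = (int j - lo) mod int n"
      using assms by (auto simp: m_def)
    then have "int n dvd (int i - int j)" by (simp add: mod_eq_dvd_iff)
    then have "int i - int j = 0"
      using dvd_imp_le_int[of "int i - int j" "int n"] \<open>i < n\<close> \<open>j < n\<close> by linarith
    then show "i = j" by simp
  qed
  have am: "a (m j) = ring_dist r \<rho> (\<beta> + real j * st)" for j
  proof -
    define q where "q = (int j - lo) div int n"
    have "m j = int j - q * int n"
      unfolding m_def q_def by (simp add: minus_div_mult_eq_mod [symmetric])
    then have "\<beta> + of_int (m j) * st = \<beta> + real j * st - of_int q * (real n * st)"
      by (simp add: left_diff_distrib)
    then have "\<beta> + of_int (m j) * st = \<beta> + real j * st + (2 * pi) * of_int (- q)"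
      using st by simp
    then have "cos (\<beta> + of_int (m j) * st) = cos (\<beta> + real j * st)"
      using cos.plus_of_int[of "\<beta> + real j * st" "- q"] by (simp add: mult.commute add_diff_eq)
    then show ?thesis by (simp add: a_def ring_dist_def)
  qed
  have finG: "finite G" using assms finite_subset by blast
  have "sum a {l..<l + int k} \<le> sum a (m ` G)"
  proof (intro sum_smallest_le)
    show "card {l..<l + int k} = card (m ` G)" using inj assms by (simp add: card_image)
    have "m j \<in> {lo..<lo + int n}" for j using n0 by (simp add: m_def)
    then show "\<And>i x. i \<in> {l..<l + int k} \<Longrightarrow> x \<in> m ` G - {l..<l + int k} \<Longrightarrow> a i \<le> a x"
      using small by auto
  qed (use finG in auto)
  also have "\<dots> = (\<Sum>j\<in>G. ring_dist r \<rho> (\<beta> + real j * st))"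
    using inj by (simp add: sum.reindex am)
  also have "sum a {l..<l + int k} = (\<Sum>j<k. a (l + int j))"
    by (rule sum.reindex_bij_witness[of _ "\<lambda>j. l + int j" "\<lambda>i. nat (i - l)"]) auto
  also have "\<dots> = (\<Sum>j<k. ring_dist r \<rho> ((\<beta> + (of_int l + (real k - 1) / 2) * st) + arc_angle n k j))"
  proof (intro sum.cong refl)
    fix j
    have "arc_angle n k j = (real j - (real k - 1) / 2) * st" by (simp add: arc_angle_def st_def)
    then have "\<beta> + of_int (l + int j) * st = \<beta> + (of_int l + (real k - 1) / 2) * st + arc_angle n k j"
      by (simp add: algebra_simps)
    then show "a (l + int j) = ring_dist r \<rho> (\<beta> + (of_int l + (real k - 1) / 2) * st + arc_angle n k j)"
      by (simp only: a_def)
  qed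
  finally show ?thesis unfolding st_def by blast
qed

lemma arc_angle_reflect: "j < k \<Longrightarrow> arc_angle n k (k - Suc j) = - arc_angle n k j"
proof -
  assume "j < k"
  then have "real (k - Suc j) - (real k - 1) / 2 = - (real j - (real k - 1) / 2)"
    by (simp add: of_nat_diff field_simps)
  then show ?thesis unfolding arc_angle_def by (simp only: mult_minus_left)
qed

text \<open>Moving a point to its average with its mirror image does not increase the cost, as the norm
  is convex.\<close>

lemma sum_ring_dist_on_axis:
  "(\<Sum>j<k. ring_dist r (\<rho> * cos x) (arc_angle n k j)) \<le> (\<Sum>j<k. ring_dist r \<rho> (x + arc_angle n k j))"
proof -
  have "(\<Sum>j<k. ring_dist r \<rho> (x + arc_angle n k j)) = (\<Sum>j<k. ring_dist r \<rho> (x + arc_angle n k (k - Suc j)))"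
    by (rule sum.nat_diff_reindex[symmetric])
  also have "\<dots> = (\<Sum>j<k. ring_dist r \<rho> (arc_angle n k j - x))"
  proof (intro sum.cong refl)
    fix j assume "j \<in> {..<k}"
    then have "x + arc_angle n k (k - Suc j) = - (arc_angle n k j - x)"
      by (simp add: arc_angle_reflect)
    then show "ring_dist r \<rho> (x + arc_angle n k (k - Suc j)) = ring_dist r \<rho> (arc_angle n k j - x)"
      by (simp only: ring_dist_minus)
  qed
  finally have "2 * (\<Sum>j<k. ring_dist r \<rho> (x + arc_angle n k j))
      = (\<Sum>j<k. ring_dist r \<rho> (x + arc_angle n k j) + ring_dist r \<rho> (arc_angle n k j - x))"
    by (simp add: sum.distrib)
  also have "\<dots> \<ge> (\<Sum>j<k. 2 * ring_dist r (\<rho> * cos x) (arc_angle n k j))"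
    by (intro sum_mono ring_dist_reflect)
  finally show ?thesis by (simp flip: sum_distrib_left)
qed

text \<open>Multiplication by \<open>2 * sin (pi / n)\<close> turns each cosine into a difference of
  sines, and the sum telescopes to \<open>2 * sin (k * pi / n)\<close>. For \<open>n = 1\<close> the
  multiplier vanishes, hence the separate case.\<close>

lemma sum_cos_arc_nonneg:
  assumes "1 \<le> k" "k \<le> n"
  shows "0 \<le> (\<Sum>j<k. cos (arc_angle n k j))"
proof (cases "n = 1")
  case True
  then show ?thesis using assms by (simp add: arc_angle_def)
next
  case False
  then have n: "2 \<le> n" using assms by simp
  define F where "F = (\<lambda>j. sin ((2 * real j - real k) * pi / real n))"
  have "F (Suc j) - F j = 2 * sin (pi / n) * cos (arc_angle n k j)" for j
  proof -
    have "(2 * real (Suc j) - real k) * pi / real n = arc_angle n k j + pi / n"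
      "(2 * real j - real k) * pi / real n = arc_angle n k j - pi / n"
      using n by (simp_all add: arc_angle_def field_simps)
    then show ?thesis unfolding F_def by (simp only: sin_add sin_diff) simp
  qed
  then have "2 * sin (pi / n) * (\<Sum>j<k. cos (arc_angle n k j)) = (\<Sum>j<k. F (Suc j) - F j)"
    by (simp add: sum_distrib_left)
  also have "\<dots> = F k - F 0" by (rule sum_lessThan_telescope)
  also have "\<dots> = 2 * sin (real k * pi / n)" by (simp add: F_def)
  also have "\<dots> \<ge> 0"
    using assms by (simp add: sin_ge_zero field_simps)
  finally have "0 \<le> sin (pi / n) * (\<Sum>j<k. cos (arc_angle n k j))" by simp
  moreover have "0 < sin (pi / n)" using n by (intro sin_gt_zero) (auto simp: field_simps)
  ultimately show ?thesis by (simp add: zero_le_mult_iff)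
qed

text \<open>The distance from the center to the midpoint of the two middle sources of an arc of \<open>k\<close>
  consecutive sources; the two coincide if \<open>k\<close> is odd.\<close>

definition arc_mid_radius :: "nat \<Rightarrow> real \<Rightarrow> nat \<Rightarrow> real" where
  "arc_mid_radius n r k = (if odd k then r else r * cos (pi / real n))"

lemma arc_mid_radius_bounds:
  assumes "0 < r" "1 \<le> k" "k \<le> n"
  shows "0 \<le> arc_mid_radius n r k" "arc_mid_radius n r k \<le> r"
proof -
  have "0 \<le> cos (pi / n)" if "even k"
  proof -
    have "2 \<le> n" using that assms by (cases "k = 1") auto
    then have "pi / n \<le> pi / 2" by (intro divide_left_mono) auto
    moreover have "- (pi / 2) \<le> pi / n" by (rule order_trans[of _ 0]) auto
    ultimately show ?thesis by (intro cos_ge_zero)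
  qed
  then show "0 \<le> arc_mid_radius n r k" "arc_mid_radius n r k \<le> r"
    using assms by (auto simp: arc_mid_radius_def)
qed

text \<open>The angles of the arc are multiples \<open>m\<close> of pi / n with
  \<open>m = 2 * j - k + 1\<close>. For even \<open>k\<close> the integer \<open>m\<close> is odd,
  so no source is closer to the axis than pi / n.\<close>

lemma cos_arc_le_mid_radius:
  assumes "0 < r" "k \<le> n" "j < k"
  shows "r * cos (arc_angle n k j) \<le> arc_mid_radius n r k"
proof (cases "odd k")
  case True
  then show ?thesis using assms by (simp add: arc_mid_radius_def)
next
  case False
  define m where "m = 2 * int j - int k + 1"
  have "odd m" using False by (simp add: m_def)
  then have "m \<noteq> 0" by auto
  then have m: "1 \<le> \<bar>m\<bar>" "\<bar>m\<bar> \<le> int n" using assms by (auto simp: m_def)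
  have "arc_angle n k j = of_int m * (pi / n)"
  proof -
    have "of_int m = 2 * (real j - (real k - 1) / 2)" by (simp add: m_def field_simps)
    then show ?thesis by (simp add: arc_angle_def)
  qed
  then have eq: "cos (arc_angle n k j) = cos (of_int \<bar>m\<bar> * (pi / n))"
    by (cases "0 \<le> m") (auto simp: abs_if)
  have "1 * (pi / n) \<le> of_int \<bar>m\<bar> * (pi / n)" "of_int \<bar>m\<bar> * (pi / n) \<le> real n * (pi / n)"
    using m by (intro mult_right_mono; linarith?; simp)+
  then have "cos (of_int \<bar>m\<bar> * (pi / n)) \<le> cos (pi / n)"
    using assms by (intro cos_monotone_0_pi_le) auto
  then show ?thesis using eq False assms by (simp add: arc_mid_radius_def)
qed

text \<open>For negative \<open>d\<close> the center is at least as good: summing the projections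
  onto the source directions leaves \<open>d\<close> times a nonnegative sum of cosines. Beyond the
  midpoint every source projects onto the axis at or before the midpoint, so retreating to it
  shortens all distances.\<close>

lemma arc_cost_clamp:
  assumes "0 < r" "1 \<le> k" "k \<le> n"
  shows "\<exists>d'\<in>{0..arc_mid_radius n r k}. arc_cost n r \<alpha> k d' \<le> arc_cost n r \<alpha> k d"
proof -
  let ?w = "arc_mid_radius n r k"
  consider "d < 0" | "0 \<le> d" "d \<le> ?w" | "?w < d" by linarith
  then show ?thesis
  proof cases
    case 1
    have "(\<Sum>j<k. ring_dist r 0 (arc_angle n k j)) = (\<Sum>j<k. r)"
      using assms by (simp add: ring_dist_def)
    also have "\<dots> \<le> (\<Sum>j<k. r) - d * (\<Sum>j<k. cos (arc_angle n k j))"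
      using 1 sum_cos_arc_nonneg[OF assms(2,3)] by (simp add: mult_nonpos_nonneg)
    also have "\<dots> = (\<Sum>j<k. r - d * cos (arc_angle n k j))"
      by (simp add: sum_subtractf sum_distrib_left)
    also have "\<dots> \<le> (\<Sum>j<k. ring_dist r d (arc_angle n k j))"
      by (intro sum_mono ring_dist_ge)
    also have "\<dots> \<le> arc_cost n r \<alpha> k d" by (simp add: arc_cost_def)
    finally have "arc_cost n r \<alpha> k 0 \<le> arc_cost n r \<alpha> k d" by (simp add: arc_cost_def)
    then show ?thesis using arc_mid_radius_bounds[OF assms] by (intro bexI[of _ 0]) auto
  next
    case 2
    then show ?thesis by (intro bexI[of _ d]) auto
  next
    case 3
    have w0: "0 \<le> ?w" using arc_mid_radius_bounds[OF assms] by simp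
    have "ring_dist r ?w (arc_angle n k j) \<le> ring_dist r d (arc_angle n k j)" if "j < k" for j
    proof -
      have "(?w - r * cos (arc_angle n k j))\<^sup>2 \<le> (d - r * cos (arc_angle n k j))\<^sup>2"
        using cos_arc_le_mid_radius[OF assms(1,3) that] 3 by (intro power_mono) auto
      then show ?thesis by (simp add: ring_dist_alt)
    qed
    then have "arc_cost n r \<alpha> k ?w \<le> arc_cost n r \<alpha> k d"
      unfolding arc_cost_def using 3 w0 by (intro add_mono sum_mono mult_left_mono) auto
    then show ?thesis using w0 by (intro bexI[of _ ?w]) auto
  qed
qed

text \<open>Here \<open>p\<close> is relative to the center, so \<open>norm p\<close> is the length
  of the edge to the sink. Replacing \<open>G\<close> by a window leaves that length alone, and
  passing to the axis does not increase it since the absolute value of \<open>\<rho> * cos x\<close>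
  is at most \<rho>.\<close>

lemma group_cost_ge_arc_cost:
  assumes "0 < r" "G \<subseteq> {..<n}" "card G = k" "1 \<le> k"
  shows "\<exists>d\<in>{0..arc_mid_radius n r k}. arc_cost n r \<alpha> k d \<le>
    (\<Sum>j\<in>G. norm (r *\<^sub>R (cos (\<theta> + 2 * pi * real j / real n), sin (\<theta> + 2 * pi * real j / real n)) - p))
      + real k powr \<alpha> * norm p"
proof -
  have kn: "k \<le> n" using assms card_mono[of "{..<n}" G] by simp
  obtain \<rho> \<psi> where p: "p = \<rho> *\<^sub>R (cos \<psi>, sin \<psi>)" "0 \<le> \<rho>" by (rule polar_point_exists)
  obtain x where x: "(\<Sum>j<k. ring_dist r \<rho> (x + arc_angle n k j))
      \<le> (\<Sum>j\<in>G. ring_dist r \<rho> ((\<theta> - \<psi>) + real j * (2 * pi / real n)))"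
    using nearest_sources_consecutive[OF assms(1) p(2) assms(2-4)] by blast
  obtain d where d: "d \<in> {0..arc_mid_radius n r k}"
    and le: "arc_cost n r \<alpha> k d \<le> arc_cost n r \<alpha> k (\<rho> * cos x)"
    using arc_cost_clamp[OF assms(1,4) kn] by blast
  note le
  also have "arc_cost n r \<alpha> k (\<rho> * cos x)
      \<le> (\<Sum>j<k. ring_dist r \<rho> (x + arc_angle n k j)) + real k powr \<alpha> * \<rho>"
    unfolding arc_cost_def
    using p(2) by (intro add_mono sum_ring_dist_on_axis mult_left_mono) (auto simp: abs_mult mult_left_le)
  also have "\<dots> \<le> (\<Sum>j\<in>G. ring_dist r \<rho> ((\<theta> - \<psi>) + real j * (2 * pi / real n))) + real k powr \<alpha> * \<rho>"
    using x by simp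
  also have "\<dots> = (\<Sum>j\<in>G. norm (r *\<^sub>R (cos (\<theta> + 2 * pi * real j / real n), sin (\<theta> + 2 * pi * real j / real n)) - p))
      + real k powr \<alpha> * norm p"
    unfolding p(1) norm_polar_diff norm_polar using p(2) by (simp add: algebra_simps)
  finally show ?thesis using d by blast
qed

section \<open>Quadratic lower bound on the cost of an arc\<close>

text \<open>The left side is the chord between two points of the circle; any detour through a third
  point is at least as long.\<close>

lemma ring_dist_pair_ge:
  assumes "0 < r"
  shows "2 * r * \<bar>sin ((x - y) / 2)\<bar> \<le> ring_dist r d x + ring_dist r d y"
proof -
  let ?c = "\<lambda>a::real. (cos a, sin a)"
  have "cos (x - y) = 1 - 2 * (sin ((x - y) / 2))\<^sup>2"
    by (metis cos_double_sin field_sum_of_halves mult_2)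
  then have "r\<^sup>2 + r\<^sup>2 - 2 * r * r * cos (x - y) = (2 * r * sin ((x - y) / 2))\<^sup>2"
    by (simp only: power2_eq_square) (simp add: algebra_simps)
  then have "2 * r * \<bar>sin ((x - y) / 2)\<bar> = ring_dist r r (x - y)"
    using assms by (simp add: ring_dist_def abs_mult)
  also have "\<dots> = norm (r *\<^sub>R ?c x - r *\<^sub>R ?c y)" by (simp only: norm_polar_diff)
  also have "\<dots> \<le> norm (r *\<^sub>R ?c x - d *\<^sub>R ?c 0) + norm (r *\<^sub>R ?c y - d *\<^sub>R ?c 0)"
    using norm_triangle_ineq4[of "r *\<^sub>R ?c x - d *\<^sub>R ?c 0" "r *\<^sub>R ?c y - d *\<^sub>R ?c 0"]
    by (simp only: diff_diff_eq2 diff_add_cancel)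
  also have "\<dots> = ring_dist r d x + ring_dist r d y" by (simp only: norm_polar_diff diff_zero)
  finally show ?thesis .
qed

text \<open>Jordan's inequality: a concave function lies above its chord.\<close>

lemma sin_ge_two_div_pi:
  assumes "0 \<le> x" "x \<le> pi / 2"
  shows "2 / pi * x \<le> sin x"
proof -
  have "convex_on {0..pi / 2} (\<lambda>x. - sin x)"
    by (rule f''_ge0_imp_convex[where f' = "\<lambda>x. - cos x" and f'' = sin])
       (auto intro!: derivative_eq_intros sin_ge_zero)
  then have "- sin ((1 - 2 / pi * x) *\<^sub>R 0 + (2 / pi * x) *\<^sub>R (pi / 2))
      \<le> (1 - 2 / pi * x) * - sin 0 + (2 / pi * x) * - sin (pi / 2)"
    using assms by (intro convex_onD) (auto simp: field_simps)
  then show ?thesis by simp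
qed

lemma arc_cost_ge:
  assumes "0 < r" "1 \<le> k" "k \<le> n"
  shows "r * (real k)\<^sup>2 / (4 * real n) \<le> arc_cost n r \<alpha> k d"
proof (cases "k = 1")
  case True
  have "r / (4 * real n) \<le> r" using assms by (simp add: field_simps)
  also have "\<dots> \<le> ring_dist r d 0 + \<bar>d\<bar>" using ring_dist_ge[of r d 0] by simp
  finally show ?thesis using True by (simp add: arc_cost_def arc_angle_def)
next
  case False
  \<comment> \<open>The \<open>h\<close> disjoint pairs contribute 4 r h / n each, together 4 r h^2
    / n; \<open>k \<le> 4 * h\<close> turns this into r k^2 / (4 n). A single source has no partner
    and was treated separately.\<close>
  define h where "h = k div 2"
  have h: "real k \<le> 4 * real h" "2 * h \<le> k" "1 \<le> h" using False assms by (auto simp: h_def)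
  \<comment> \<open>Sources \<open>j\<close> and \<open>j + h\<close> span a chord of length at least \<open>4 r h / n\<close>.\<close>
  have pair: "r * 4 * real h / real n \<le> ring_dist r d (arc_angle n k j) + ring_dist r d (arc_angle n k (h + j))" for j
  proof -
    define y where "y = real h * (pi / real n)"
    have "2 * (real h * pi) \<le> real n * pi" 
      using h assms by (simp flip: mult.assoc)
    then have y: "0 \<le> y" "y \<le> pi / 2" using assms by (auto simp: y_def field_simps)
    have "(arc_angle n k (h + j) - arc_angle n k j) / 2 = y"
      unfolding arc_angle_def left_diff_distrib[symmetric] y_def by simp
    then have "2 * r * \<bar>sin y\<bar> \<le> ring_dist r d (arc_angle n k (h + j)) + ring_dist r d (arc_angle n k j)"
      using ring_dist_pair_ge[OF assms(1), of "arc_angle n k (h + j)" "arc_angle n k j" d] by simp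
    moreover have "2 * r * (2 / pi * y) \<le> 2 * r * \<bar>sin y\<bar>"
      using sin_ge_two_div_pi[OF y] assms by (intro mult_left_mono) auto
    moreover have "2 * r * (2 / pi * y) = r * 4 * real h / real n" by (simp add: y_def)
    ultimately show ?thesis by linarith
  qed
  have "(real k)\<^sup>2 \<le> (4 * real h)\<^sup>2" using h by (intro power_mono) auto
  then have "r * (real k)\<^sup>2 / (4 * real n) \<le> r * (4 * real h)\<^sup>2 / (4 * real n)"
    using assms by (intro divide_right_mono mult_left_mono) auto
  also have "\<dots> = (\<Sum>j<h. r * 4 * real h / real n)" by (simp add: power2_eq_square)
  also have "\<dots> \<le> (\<Sum>j<h. ring_dist r d (arc_angle n k j) + ring_dist r d (arc_angle n k (h + j)))"
    by (intro sum_mono pair)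
  also have "\<dots> = (\<Sum>j<2*h. ring_dist r d (arc_angle n k j))"
  proof -
    have "sum f {..<2*h} = sum f {..<h} + (\<Sum>j<h. f (h + j))" for f :: "nat \<Rightarrow> real"
      using sum.atLeastLessThan_concat[of 0 h "2 * h" f] sum.shift_bounds_nat_ivl[of f 0 h h]
      by (simp add: lessThan_atLeast0 mult_2 add.commute)
    then show ?thesis by (simp add: sum.distrib)
  qed
  also have "\<dots> \<le> (\<Sum>j<k. ring_dist r d (arc_angle n k j))"
    using h by (intro sum_mono2) (auto intro: ring_dist_nonneg)
  also have "\<dots> \<le> arc_cost n r \<alpha> k d" by (simp add: arc_cost_def)
  finally show ?thesis .
qed

section \<open>The group cost in coordinates\<close>

definition star_cost :: "nat \<Rightarrow> (nat \<Rightarrow> point) \<Rightarrow> real \<Rightarrow> point \<Rightarrow> real" where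
  "star_cost k u \<alpha> p = (\<Sum>j<k. norm (u j - p)) + real k powr \<alpha> * norm p"

definition circle_point :: "nat \<Rightarrow> real \<Rightarrow> real \<Rightarrow> nat \<Rightarrow> point" where
  "circle_point n r \<theta> j = r *\<^sub>R (cos (\<theta> + 2 * pi * real j / real n), sin (\<theta> + 2 * pi * real j / real n))"

text \<open>For the sources \<open>i\<close> to \<open>i + k - 1\<close>; for odd \<open>k\<close>
  both summands are the same source. The point lies on the axis of the arc and is computable without
  trigonometry, so its multiples by factors in [0, 1] form the segment to be searched.\<close>

definition arc_mid :: "(nat \<Rightarrow> point) \<Rightarrow> nat \<Rightarrow> nat \<Rightarrow> point" where
  "arc_mid v i k = (1 / 2) *\<^sub>R (v (i + (k - 1) div 2) + v (i + k div 2))"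

lemma arc_mid_cong:
  fixes n :: nat
  assumes "\<And>j. j < n \<Longrightarrow> v j = v' j" "i + k \<le> n" "1 \<le> k"
  shows "arc_mid v i k = arc_mid v' i k"
  using assms by (auto simp: arc_mid_def)

lemma arc_mid_circle_point:
  assumes "1 \<le> k" "1 \<le> n" and \<mu>_def: "\<mu> = \<theta> + (real i + (real k - 1) / 2) * (2 * pi / real n)"
  shows "arc_mid (circle_point n r \<theta>) i k = arc_mid_radius n r k *\<^sub>R (cos \<mu>, sin \<mu>)"
proof (cases "odd k")
  case True
  then obtain m where "k = 2 * m + 1" by (elim oddE)
  then show ?thesis
    by (simp add: arc_mid_def arc_mid_radius_def circle_point_def \<mu>_def mult.commute)
next
  case False
  then have "even k" by simp
  then obtain m where m: "k = 2 * m" by (elim evenE)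
  then have "1 \<le> m" using assms by simp
  define h where "h = pi / real n"
  have "real (i + (m - 1)) = real i + (real k - 1) / 2 - 1 / 2" "real (i + m) = real i + (real k - 1) / 2 + 1 / 2"
    using \<open>1 \<le> m\<close> m by (simp_all add: of_nat_diff diff_divide_distrib)
  then have "\<theta> + 2 * pi * real (i + (m - 1)) / real n = \<mu> - h" "\<theta> + 2 * pi * real (i + m) / real n = \<mu> + h"
    unfolding \<mu>_def h_def by (simp_all only:) (use assms(2) in \<open>simp_all add: field_simps\<close>)
  moreover have "(k - 1) div 2 = m - 1" "k div 2 = m" using m \<open>1 \<le> m\<close> by auto
  ultimately have "arc_mid (circle_point n r \<theta>) i k
      = (1 / 2) *\<^sub>R (r *\<^sub>R (cos (\<mu> - h), sin (\<mu> - h)) + r *\<^sub>R (cos (\<mu> + h), sin (\<mu> + h)))"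
    unfolding arc_mid_def circle_point_def by simp
  also have "\<dots> = (r * cos h) *\<^sub>R (cos \<mu>, sin \<mu>)"
    by (simp add: cos_add cos_diff sin_add sin_diff algebra_simps)
  finally show ?thesis using False by (simp add: arc_mid_radius_def h_def)
qed

text \<open>The right side mentions neither \<open>i\<close> nor \<theta>: all arcs of one size cost
  the same, so one search per size, at \<open>i = 0\<close>, serves every arc.\<close>

lemma star_cost_arc:
  assumes "1 \<le> k" "1 \<le> n" "0 \<le> \<tau>"
  shows "star_cost k (\<lambda>j. circle_point n r \<theta> (i + j)) \<alpha> (\<tau> *\<^sub>R arc_mid (circle_point n r \<theta>) i k)
     = arc_cost n r \<alpha> k (\<tau> * arc_mid_radius n r k)"
proof -
  define \<mu> where "\<mu> = \<theta> + (real i + (real k - 1) / 2) * (2 * pi / real n)"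
  have "\<theta> + 2 * pi * real (i + j) / real n - \<mu> = arc_angle n k j" for j
    using assms(2) by (simp add: \<mu>_def arc_angle_def field_simps)
  then show ?thesis
    unfolding star_cost_def arc_cost_def arc_mid_circle_point[OF assms(1,2) \<mu>_def]
    by (simp only: circle_point_def scaleR_scaleR norm_polar_diff norm_polar)
qed

section \<open>Convexity and ternary search\<close>

lemma convex_on_norm_line: "convex_on UNIV (\<lambda>t::real. norm (a - t *\<^sub>R w :: 'a::real_normed_vector))"
proof (rule convex_onI)
  fix t x y :: real assume t: "0 < t" "t < 1"
  have "a - ((1 - t) *\<^sub>R x + t *\<^sub>R y) *\<^sub>R w = (1 - t) *\<^sub>R (a - x *\<^sub>R w) + t *\<^sub>R (a - y *\<^sub>R w)"
    by (simp add: algebra_simps)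
  then have "norm (a - ((1 - t) *\<^sub>R x + t *\<^sub>R y) *\<^sub>R w) \<le> norm ((1 - t) *\<^sub>R (a - x *\<^sub>R w)) + norm (t *\<^sub>R (a - y *\<^sub>R w))"
    by (simp only: norm_triangle_ineq)
  then show "norm (a - ((1 - t) *\<^sub>R x + t *\<^sub>R y) *\<^sub>R w) \<le> (1 - t) * norm (a - x *\<^sub>R w) + t * norm (a - y *\<^sub>R w)"
    using t by simp
qed simp

lemma convex_on_star_cost: "convex_on UNIV (\<lambda>t. star_cost k u \<alpha> (t *\<^sub>R w))"
proof -
  have "convex_on UNIV (\<lambda>t. \<Sum>j<m. norm (u j - t *\<^sub>R w))" for m
    by (induction m) (simp_all add: convex_on_add convex_on_norm_line convex_on_const)
  moreover have "convex_on UNIV (\<lambda>t. real k powr \<alpha> * norm (t *\<^sub>R w))"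
    using convex_on_cmul[OF _ convex_on_norm_line[of 0 w], of "real k powr \<alpha>"] by simp
  ultimately show ?thesis unfolding star_cost_def by (rule convex_on_add)
qed

text \<open>Slopes of a convex function do not decrease: if \<open>f\<close> does not drop from
  \<open>p\<close> to \<open>q\<close>, it does not drop from \<open>q\<close> to \<open>x\<close>.
  Writing \<open>q\<close> as a convex combination covers both orders of \<open>p\<close> and
  \<open>x\<close>.\<close>

lemma convex_beyond:
  fixes f :: "real \<Rightarrow> real"
  assumes "convex_on UNIV f" "q = (1 - s) * p + s * x" "0 < s" "s \<le> 1" "f p \<le> f q"
  shows "f q \<le> f x"
proof -
  have "f ((1 - s) *\<^sub>R p + s *\<^sub>R x) \<le> (1 - s) * f p + s * f x"
    using assms by (intro convex_onD) auto
  then have "f q \<le> (1 - s) * f p + s * f x" using assms(2) by simp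
  moreover have "(1 - s) * f p \<le> (1 - s) * f q" using assms by (intro mult_left_mono) auto
  ultimately have "f q \<le> (1 - s) * f q + s * f x" by linarith
  then have "s * f q \<le> s * f x" by (simp add: algebra_simps)
  then show ?thesis using assms by simp
qed

text \<open>No minimiser is named: every competitor in [0, 1] is matched by some point of the
  bracket. This form survives ties and plateaus.\<close>

definition brackets_min :: "(real \<Rightarrow> real) \<Rightarrow> real \<Rightarrow> real \<Rightarrow> bool" where
  "brackets_min f a b \<longleftrightarrow> a \<le> b \<and> (\<forall>x\<in>{0..1}. \<exists>y\<in>{a..b}. f y \<le> f x)"

text \<open>If a witness falls into the discarded third, the new end point of the bracket is at
  least as good by \<open>convex_beyond\<close> and replaces it.\<close>

lemma brackets_min_ternary:
  assumes f: "convex_on UNIV f" and b: "brackets_min f a b"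
  defines "m1 \<equiv> (2 * a + b) / 3" and "m2 \<equiv> (a + 2 * b) / 3"
  shows "f m2 < f m1 \<Longrightarrow> brackets_min f m1 b" "\<not> f m2 < f m1 \<Longrightarrow> brackets_min f a m2"
proof -
  have ab: "a \<le> b" using b by (simp add: brackets_min_def)
  have m: "a \<le> m1" "m1 \<le> m2" "m2 \<le> b" using ab by (auto simp: m1_def m2_def)
  have "\<exists>y\<in>{m1..b}. f y \<le> f x" if less: "f m2 < f m1" and x: "x \<in> {0..1}" for x
  proof -
    obtain y where y: "y \<in> {a..b}" "f y \<le> f x" using b x unfolding brackets_min_def by blast
    show ?thesis
    proof (cases "m1 \<le> y")
      case True
      then show ?thesis using y by auto
    next
      case False
      have lt: "m1 < m2" using less m by (cases "m1 = m2") auto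
      define s where "s = (m2 - m1) / (m2 - y)"
      have "s * (m2 - y) = m2 - m1" "0 < s" "s \<le> 1"
        using False lt by (auto simp: s_def)
      then have "m1 = (1 - s) * m2 + s * y" "0 < s" "s \<le> 1"
        by (simp_all only: left_diff_distrib right_diff_distrib mult_1)
      then have "f m1 \<le> f y" using less convex_beyond[OF f, of m1 s m2 y] by simp
      then show ?thesis using y m by (intro bexI[of _ m1]) auto
    qed
  qed
  then show "f m2 < f m1 \<Longrightarrow> brackets_min f m1 b" using m by (auto simp: brackets_min_def)
  have "\<exists>y\<in>{a..m2}. f y \<le> f x" if less: "\<not> f m2 < f m1" and x: "x \<in> {0..1}" for x
  proof -
    obtain y where y: "y \<in> {a..b}" "f y \<le> f x" using b x unfolding brackets_min_def by blast
    show ?thesis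
    proof (cases "y \<le> m2")
      case True
      then show ?thesis using y by auto
    next
      case False
      then have lt: "m1 < m2" using y ab by (auto simp: m1_def m2_def)
      define s where "s = (m2 - m1) / (y - m1)"
      have "s * (y - m1) = m2 - m1" "0 < s" "s \<le> 1"
        using False lt by (auto simp: s_def)
      then have "m2 = (1 - s) * m1 + s * y" "0 < s" "s \<le> 1"
        by (simp_all only: left_diff_distrib right_diff_distrib mult_1)
      then have "f m2 \<le> f y" using less convex_beyond[OF f, of m2 s m1 y] by simp
      then show ?thesis using y m by (intro bexI[of _ m2]) auto
    qed
  qed
  then show "\<not> f m2 < f m1 \<Longrightarrow> brackets_min f a m2" using m by (auto simp: brackets_min_def)
qed

text \<open>Each of the \<open>k\<close> distances changes by at most
  \<open>r * \<bar>s - t\<bar>\<close>, and the last edge by \<open>k powr \<alpha>\<close> times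
  that, which is at most \<open>k\<close> times since \<open>\<alpha> \<le> 1\<close>.\<close>

lemma star_cost_lipschitz:
  assumes "norm w \<le> r" "1 \<le> k" "\<alpha> \<le> 1"
  shows "star_cost k u \<alpha> (s *\<^sub>R w) \<le> star_cost k u \<alpha> (t *\<^sub>R w) + 2 * real k * r * \<bar>s - t\<bar>"
proof -
  define \<delta> where "\<delta> = r * \<bar>s - t\<bar>"
  have "norm ((s - t) *\<^sub>R w) \<le> \<delta>"
    using assms mult_right_mono[of "norm w" r "\<bar>s - t\<bar>"] by (simp add: \<delta>_def mult.commute)
  then have d: "norm (s *\<^sub>R w - t *\<^sub>R w) \<le> \<delta>" by (simp add: scaleR_left_diff_distrib)
  have "norm (u j - s *\<^sub>R w) \<le> norm (u j - t *\<^sub>R w) + \<delta>" for j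
    using norm_triangle_ineq4[of "u j - t *\<^sub>R w" "s *\<^sub>R w - t *\<^sub>R w"] d by simp
  then have 1: "(\<Sum>j<k. norm (u j - s *\<^sub>R w)) \<le> (\<Sum>j<k. norm (u j - t *\<^sub>R w) + \<delta>)"
    by (intro sum_mono)
  have "norm (s *\<^sub>R w) \<le> norm (t *\<^sub>R w) + \<delta>"
    using norm_triangle_ineq[of "t *\<^sub>R w" "s *\<^sub>R w - t *\<^sub>R w"] d by simp
  then have 2: "real k powr \<alpha> * norm (s *\<^sub>R w) \<le> real k powr \<alpha> * (norm (t *\<^sub>R w) + \<delta>)"
    by (intro mult_left_mono) auto
  have "real k powr \<alpha> \<le> real k powr 1" using assms by (intro powr_mono) auto
  then have "real k powr \<alpha> * \<delta> \<le> real k * \<delta>"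
    using assms d by (intro mult_right_mono) (auto intro: order_trans[OF norm_ge_zero])
  then show ?thesis
    using 1 2 unfolding star_cost_def \<delta>_def
    by (simp add: sum.distrib distrib_left)
qed

lemma bracket_approximates_arc_cost:
  assumes "0 < r" "1 \<le> k" "k \<le> n" "\<alpha> \<le> 1" "0 < \<epsilon>"
    and f: "f = (\<lambda>\<tau>. star_cost k (circle_point n r \<theta>) \<alpha> (\<tau> *\<^sub>R arc_mid (circle_point n r \<theta>) 0 k))"
    and b: "brackets_min f a b" "0 \<le> a" "8 * real n * (b - a) \<le> \<epsilon> * real k"
    and d: "d \<in> {0..arc_mid_radius n r k}"
  shows "f a \<le> (1 + \<epsilon>) * arc_cost n r \<alpha> k d"
proof -
  have n: "1 \<le> n" using assms by simp
  let ?w = "arc_mid_radius n r k"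
  have w: "0 \<le> ?w" "?w \<le> r" using arc_mid_radius_bounds assms by auto
  have fa: "f \<tau> = arc_cost n r \<alpha> k (\<tau> * ?w)" if "0 \<le> \<tau>" for \<tau>
    using star_cost_arc[OF assms(2) n that, of r \<theta> 0 \<alpha>] by (simp add: f)
  \<comment> \<open>If the radius is 0, which happens for \<open>k = n = 2\<close>, then
    \<open>d = 0\<close> as well and division by zero yields the right value 0.\<close>
  define x where "x = d / ?w"
  have x: "x \<in> {0..1}" "d = x * ?w" using d w by (auto simp: x_def divide_le_eq_1)
  obtain y where y: "y \<in> {a..b}" "f y \<le> f x" using b x unfolding brackets_min_def by blast
  have "norm (arc_mid (circle_point n r \<theta>) 0 k) \<le> r"
    using w unfolding arc_mid_circle_point[OF assms(2) n refl] norm_polar by simp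
  then have "f a \<le> f y + 2 * real k * r * \<bar>a - y\<bar>"
    unfolding f using assms by (intro star_cost_lipschitz)
  also have "2 * real k * r * \<bar>a - y\<bar> \<le> 2 * real k * r * (\<epsilon> * real k / (8 * real n))"
  proof (intro mult_left_mono)
    have "\<bar>a - y\<bar> \<le> b - a" using y by auto
    also have "\<dots> \<le> \<epsilon> * real k / (8 * real n)" using b n by (simp add: field_simps)
    finally show "\<bar>a - y\<bar> \<le> \<epsilon> * real k / (8 * real n)" .
  qed (use assms in auto)
  also have "\<dots> = \<epsilon> * (r * (real k)\<^sup>2 / (4 * real n))" by (simp add: power2_eq_square)
  also have "\<dots> \<le> \<epsilon> * arc_cost n r \<alpha> k d"
    using arc_cost_ge[OF assms(1-3)] assms by (intro mult_left_mono) auto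
  also have "f y \<le> arc_cost n r \<alpha> k d" using y(2) fa[of x] x by simp
  finally show ?thesis by (simp add: algebra_simps)
qed

section \<open>Vertices of a regular polygon\<close>

lemma circle_point_inj:
  assumes "0 < r" "a < n" "b < n" "circle_point n r \<theta> a = circle_point n r \<theta> b"
  shows "a = b"
proof (rule ccontr)
  assume "a \<noteq> b"
  have ne: False if "x < y" "y < n" "circle_point n r \<theta> x = circle_point n r \<theta> y" for x y
  proof -
    let ?d = "2 * pi * real y / real n - 2 * pi * real x / real n"
    have "norm (circle_point n r \<theta> y - circle_point n r \<theta> x) = 0" using that(3) by simp
    then have "ring_dist r r ((\<theta> + 2 * pi * real y / real n) - (\<theta> + 2 * pi * real x / real n)) = 0"
      unfolding circle_point_def norm_polar_diff .
    then have z: "ring_dist r r ?d = 0" by (simp add: algebra_simps)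
    have e: "r\<^sup>2 + r\<^sup>2 - 2 * r * r * C = 2 * r\<^sup>2 * (1 - C)" for C
      by (simp add: power2_eq_square algebra_simps)
    have "sqrt (2 * r\<^sup>2 * (1 - cos ?d)) = 0" using z unfolding ring_dist_def e .
    then have "cos ?d = 1" using assms(1) by simp
    moreover have "?d = 2 * pi * (real (y - x) / real n)" using that by (simp add: of_nat_diff field_simps)
    ultimately have "cos (2 * pi * (real (y - x) / real n)) = 1" by simp
    then obtain m :: int where "2 * pi * (real (y - x) / real n) = of_int m * 2 * pi"
      by (auto simp: cos_one_2pi_int)
    then have "2 * pi * (real (y - x) / real n) = 2 * pi * of_int m" by (simp only: mult_ac)
    then have "real (y - x) / real n = of_int m" by (simp only: mult_cancel_left) simp
    then have "real (y - x) = of_int m * real n" using that(2) by (metis nonzero_eq_divide_eq of_nat_0_eq_iff not_less0)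
    then have "int (y - x) = m * int n" by (metis of_int_eq_iff of_int_mult of_int_of_nat_eq)
    then have "int n dvd int (y - x)" by simp
    then have "n \<le> y - x" using that by (auto dest: zdvd_imp_le)
    then show ?thesis using that by simp
  qed
  show False using ne[of a b] ne[of b a] assms \<open>a \<noteq> b\<close> by (cases a b rule: linorder_cases) auto
qed

lemma circle_point_add_period:
  assumes "1 \<le> n"
  shows "circle_point n r \<theta> (j + n) = circle_point n r \<theta> j"
proof -
  have "\<theta> + 2 * pi * real (j + n) / real n = (\<theta> + 2 * pi * real j / real n) + 2 * pi"
    using assms by (simp add: field_simps)
  then show ?thesis unfolding circle_point_def by (simp only: cos_periodic sin_periodic)
qed

lemma circle_point_mod:
  assumes "1 \<le> n"
  shows "circle_point n r \<theta> (j mod n) = circle_point n r \<theta> j"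
proof -
  have "circle_point n r \<theta> (i + q * n) = circle_point n r \<theta> i" for i q
  proof (induction q)
    case (Suc q)
    have "i + Suc q * n = (i + q * n) + n" by simp
    then show ?case using Suc circle_point_add_period[OF assms] by metis
  qed simp
  from this[of "j mod n" "j div n"] show ?thesis by simp
qed

lemma circle_point_shift:
  "circle_point n r (\<theta> + 2 * pi * real i / real n) j = circle_point n r \<theta> (i + j)"
  by (simp add: circle_point_def algebra_simps add_divide_distrib)

text \<open>Two distinct vertices are at least one step apart. More than half a turn is replaced by
  the complementary number of steps \<open>n - d\<close>, so that the cosine is monotone on the
  range considered.\<close>

lemma cos_step_max:
  fixes a b n :: nat
  assumes "a < n" "b < n" "a \<noteq> b"
  shows "cos (2 * pi * real a / real n - 2 * pi * real b / real n) \<le> cos (2 * pi / real n)"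
proof -
  have le: "cos (2 * pi * real d / real n) \<le> cos (2 * pi / real n)" if "1 \<le> d" "2 * d \<le> n" for d
  proof (intro cos_monotone_0_pi_le)
    show "2 * pi / real n \<le> 2 * pi * real d / real n" using that by (intro divide_right_mono) auto
    have "pi * real (2 * d) \<le> pi * real n" using that by (intro mult_left_mono) (simp_all only: of_nat_le_iff, auto)
    then show "2 * pi * real d / real n \<le> pi" using that by (simp add: divide_le_eq mult.commute mult.left_commute)
  qed simp
  have *: "cos (2 * pi * real d / real n) \<le> cos (2 * pi / real n)" if "1 \<le> d" "d < n" for d
  proof (cases "2 * d \<le> n")
    case True
    then show ?thesis using le that by simp
  next
    case False
    have "2 * pi * real d / real n = 2 * pi - 2 * pi * real (n - d) / real n"
      using that by (simp add: of_nat_diff field_simps)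
    then have "cos (2 * pi * real d / real n) = cos (2 * pi * real (n - d) / real n)"
      by (simp only: cos_2pi_minus)
    then show ?thesis using le[of "n - d"] that False by simp
  qed
  show ?thesis
  proof (cases "b < a")
    case True
    then have "2 * pi * real a / real n - 2 * pi * real b / real n = 2 * pi * real (a - b) / real n"
      by (simp add: of_nat_diff right_diff_distrib diff_divide_distrib)
    then show ?thesis using *[of "a - b"] True assms by simp
  next
    case False
    then have "2 * pi * real a / real n - 2 * pi * real b / real n = - (2 * pi * real (b - a) / real n)"
      by (simp add: of_nat_diff right_diff_distrib diff_divide_distrib)
    then show ?thesis using *[of "b - a"] False assms by simp
  qed
qed

text \<open>The left side consists of field operations, so it lets the program compare and obtain
  cosines of angles between sources.\<close>

lemma circle_point_dot:
  "fst (circle_point n r \<theta> a) * fst (circle_point n r \<theta> b) + snd (circle_point n r \<theta> a) * snd (circle_point n r \<theta> b)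
    = r\<^sup>2 * cos (2 * pi * real a / real n - 2 * pi * real b / real n)"
proof -
  have "cos (2 * pi * real a / real n - 2 * pi * real b / real n)
      = cos ((\<theta> + 2 * pi * real a / real n) - (\<theta> + 2 * pi * real b / real n))" by simp
  also have "r\<^sup>2 * \<dots> = fst (circle_point n r \<theta> a) * fst (circle_point n r \<theta> b) + snd (circle_point n r \<theta> a) * snd (circle_point n r \<theta> b)"
    unfolding cos_diff circle_point_def by (simp add: power2_eq_square algebra_simps)
  finally show ?thesis by simp
qed

section \<open>Topologies with one intermediate layer\<close>

text \<open>Resolves the definite description in \<open>layer\<close>: parents are unique and roots
  have none, so only one path length leads from \<open>v\<close> to a root.\<close>

lemma layer_eqI:
  assumes sv: "single_valued (edges F)" and "(v, r) \<in> edges F ^^ k" "r \<in> roots F"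
  shows "layer F v = k"
proof -
  have no_out: "(x, y) \<notin> edges F" if "x \<in> roots F" for x y
    using that by (auto simp: roots_def)
  have "k' = k" if "(v, r) \<in> edges F ^^ k" "(v, r') \<in> edges F ^^ k'" "r' \<in> roots F" for k' r'
    using that
  proof (induction k arbitrary: v k')
    case 0
    then have "v \<in> roots F" using assms(3) by simp
    then show ?case using 0 no_out by (cases k') (auto simp del: relpow.simps(2) dest: relpow_Suc_D2)
  next
    case (Suc k)
    then obtain y where y: "(v, y) \<in> edges F" "(y, r) \<in> edges F ^^ k" by (meson relpow_Suc_D2)
    then have "k' \<noteq> 0" using Suc.prems no_out by (cases k') auto
    then obtain m where m: "k' = Suc m" by (cases k') auto
    then obtain y' where "(v, y') \<in> edges F" "(y', r') \<in> edges F ^^ m" using Suc.prems by (meson relpow_Suc_D2)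
    then have "(y, r') \<in> edges F ^^ m" using sv y by (metis single_valuedD)
    then show ?case using Suc.IH[OF y(2)] Suc.prems(3) m by simp
  qed
  then show ?thesis unfolding layer_def using assms(2,3) by (intro the_equality) blast+
qed

lemma rooted_forest_path_to_root:
  assumes "rooted_forest F" "v \<in> verts F"
  shows "\<exists>k. \<exists>r\<in>roots F. (v, r) \<in> edges F ^^ k"
proof -
  have "finite (edges F)" using assms(1) by (auto simp: rooted_forest_def intro: finite_subset)
  then have "wf ((edges F)\<inverse>)"
    using assms(1) by (intro finite_acyclic_wf_converse) (auto simp: rooted_forest_def)
  then show ?thesis using assms(2)
  proof (induction v rule: wf_induct_rule)
    case (less v)
    show ?case
    proof (cases "v \<in> roots F")
      case True
      then show ?thesis by (intro exI[of _ 0]) auto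
    next
      case False
      then obtain w where w: "(v, w) \<in> edges F" using less.prems by (auto simp: roots_def)
      then have "w \<in> verts F" using assms(1) by (auto simp: rooted_forest_def)
      then obtain k r where "r \<in> roots F" "(w, r) \<in> edges F ^^ k" using less.IH w by blast
      then show ?thesis by (intro exI[of _ "Suc k"] bexI[of _ r] relpow_Suc_I2[OF w])
    qed
  qed
qed

text \<open>A source attached directly to the sink forms a group of its own, whose Steiner vertex is
  placed at the sink.\<close>

lemma valid_layout_groups:
  assumes inst: "is_instance I" "intermediate_layers I = 1" "sinks I = {t}"
    and valid: "valid_topology I F"
  shows "\<exists>(h :: nat \<Rightarrow> vertex) P.
    (\<forall>v\<in>h ` sources I. card {s\<in>sources I. h s = v} \<le> caps I ! 1) \<and>
    (\<Sum>v\<in>h ` sources I. (\<Sum>s | s \<in> sources I \<and> h s = v. norm (source_pos I s - P v))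
        + real (card {s\<in>sources I. h s = v}) powr alpha I * norm (P v - sink_pos I t))
      \<le> layout_cost I F q"
proof -
  have top: "is_topology I F" and loads: "\<And>v. v \<in> verts F \<Longrightarrow> load I F v \<le> caps I ! layer F v"
    using valid by (auto simp: valid_topology_def)
  have forest: "rooted_forest F" and lv: "leaves F = Source ` sources I" and rt: "roots F \<subseteq> {Sink t}"
    and st: "verts F - leaves F - roots F \<subseteq> range Steiner"
    and lay: "\<And>v. v \<in> verts F \<Longrightarrow> layer F v \<le> 2"
    using top inst by (auto simp: is_topology_def)
  have sv: "single_valued (edges F)" and EV: "edges F \<subseteq> verts F \<times> verts F" and finV: "finite (verts F)"
    using forest by (auto simp: rooted_forest_def)
  have finE: "finite (edges F)" using EV finV by (auto intro: finite_subset)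
  have finS: "finite (sources I)" and \<alpha>: "0 \<le> alpha I" using inst by (auto simp: is_instance_def)
  \<comment> \<open>The vertex \<open>v\<close> is the last one before the sink on the path from
    \<open>s\<close>. As the height is at most two, it is the parent of \<open>s\<close> or, for a
    source attached directly, \<open>s\<close> itself.\<close>
  have "\<exists>v. (v, Sink t) \<in> edges F \<and> (v = Source s \<or> (\<exists>j. v = Steiner j \<and> (Source s, v) \<in> edges F))"
    if s: "s \<in> sources I" for s
  proof -
    have sV: "Source s \<in> verts F" using s lv by (auto simp: leaves_def)
    have "Source s \<notin> roots F" using rt by auto
    then obtain v where v: "(Source s, v) \<in> edges F" using sV by (auto simp: roots_def)
    show ?thesis
    proof (cases "v \<in> roots F")
      case True
      then show ?thesis using v rt by auto
    next
      case False
      moreover have vV: "v \<in> verts F" using v EV by auto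
      moreover have "v \<notin> leaves F" using v by (auto simp: leaves_def)
      ultimately obtain j where j: "v = Steiner j" using st by blast
      obtain w where w: "(v, w) \<in> edges F" using False vV by (auto simp: roots_def)
      obtain k r where r: "r \<in> roots F" "(Source s, r) \<in> edges F ^^ k"
        using rooted_forest_path_to_root[OF forest sV] by blast
      have "layer F (Source s) = k" using layer_eqI[OF sv r(2,1)] .
      then have "k \<le> 2" using lay[OF sV] by simp
      moreover have "k \<noteq> 0" using r \<open>Source s \<notin> roots F\<close> by (cases k) auto
      moreover have "k \<noteq> 1" using r v sv False by (auto dest: single_valuedD)
      ultimately have "k = 2" by simp
      then obtain v' where "(Source s, v') \<in> edges F" "(v', r) \<in> edges F"
        using r by (auto simp: numeral_2_eq_2)
      then have "(v, r) \<in> edges F" using v sv by (auto dest: single_valuedD)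
      then show ?thesis using j v r rt by auto
    qed
  qed
  then obtain h where h: "\<And>s. s \<in> sources I \<Longrightarrow> (h s, Sink t) \<in> edges F"
    "\<And>s. s \<in> sources I \<Longrightarrow> h s = Source s \<or> (\<exists>j. h s = Steiner j \<and> (Source s, h s) \<in> edges F)"
    by metis
  let ?A = "h ` sources I"
  let ?S = "\<lambda>v. {s \<in> sources I. h s = v}"
  define P where "P = (\<lambda>v. if v \<in> range Source then sink_pos I t else embedding I q v)"
  define c where "c = (\<lambda>(u, v). norm (embedding I q u - embedding I q v) * real (load I F u) powr alpha I)"
  have cost: "layout_cost I F q = sum c (edges F)" by (simp add: layout_cost_def c_def)
  have cnn: "0 \<le> c e" for e by (cases e) (simp add: c_def)
  have card_le: "card (?S v) \<le> load I F v" for v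
    unfolding load_def using finS h(2) by (intro card_mono) fastforce+
  have small: "card (?S v) \<le> caps I ! 1" if v: "v \<in> ?A" for v
  proof -
    have e: "(v, Sink t) \<in> edges F" using v h by auto
    then have "v \<in> verts F" "Sink t \<in> verts F" using EV by auto
    then obtain k r where "r \<in> roots F" "(Sink t, r) \<in> edges F ^^ k"
      using rooted_forest_path_to_root[OF forest] by blast
    then have "Sink t \<in> roots F" using rt by auto
    then have "layer F v = 1" using e by (intro layer_eqI[OF sv, where r = "Sink t"]) auto
    then show ?thesis using loads[OF \<open>v \<in> verts F\<close>] card_le[of v] by simp
  qed
  \<comment> \<open>Sources with a proper Steiner hub. The others are their own hub, and their edge
    to the sink is already among the edges leaving hubs; so the two families of edges below are
    disjoint.\<close>
  let ?T = "{s \<in> sources I. h s \<noteq> Source s}"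
  have "(\<Sum>v\<in>?A. c (v, Sink t)) + (\<Sum>s\<in>?T. c (Source s, h s))
      = sum c ((\<lambda>v. (v, Sink t)) ` ?A) + sum c ((\<lambda>s. (Source s, h s)) ` ?T)"
    by (simp add: sum.reindex inj_on_def)
  also have "\<dots> = sum c ((\<lambda>v. (v, Sink t)) ` ?A \<union> (\<lambda>s. (Source s, h s)) ` ?T)"
    using finS h(2) by (intro sum.union_disjoint[symmetric]) fastforce+
  also have "\<dots> \<le> sum c (edges F)"
    using h cnn finE by (intro sum_mono2) fastforce+
  finally have le: "(\<Sum>v\<in>?A. c (v, Sink t)) + (\<Sum>s\<in>?T. c (Source s, h s)) \<le> layout_cost I F q"
    using cost by simp
  have src: "norm (source_pos I s - P v) \<le> c (Source s, v)" if "s \<in> sources I" "v \<notin> range Source" for s v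
  proof -
    have "1 \<le> load I F (Source s)"
      unfolding load_def using that finS card_mono[of "{s' \<in> sources I. (Source s', Source s) \<in> (edges F)\<^sup>*}" "{s}"] by auto
    then have "1 \<le> real (load I F (Source s)) powr alpha I"
      using \<alpha> by (intro ge_one_powr_ge_zero) auto
    then show ?thesis using that mult_left_mono[of 1 "real (load I F (Source s)) powr alpha I" "norm (source_pos I s - P v)"]
      by (simp add: c_def P_def)
  qed
  have hub: "real (card (?S v)) powr alpha I * norm (P v - sink_pos I t) \<le> c (v, Sink t)" if "v \<notin> range Source" for v
  proof -
    have "real (card (?S v)) powr alpha I \<le> real (load I F v) powr alpha I"
      using card_le[of v] \<alpha> by (intro powr_mono2) auto
    then have "real (card (?S v)) powr alpha I * norm (P v - sink_pos I t)
        \<le> real (load I F v) powr alpha I * norm (P v - sink_pos I t)"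
      by (rule mult_right_mono) simp
    then show ?thesis using that by (simp add: c_def P_def mult.commute)
  qed
  have group: "(\<Sum>s\<in>?S v. norm (source_pos I s - P v)) + real (card (?S v)) powr alpha I * norm (P v - sink_pos I t)
     \<le> c (v, Sink t) + (\<Sum>s\<in>{s\<in>?T. h s = v}. c (Source s, h s))" if v: "v \<in> ?A" for v
  proof (cases "v \<in> range Source")
    case True
    then obtain s where s: "v = Source s" by auto
    have S: "?S v \<subseteq> {s}" using h(2) s by fastforce
    have "s \<in> ?S v" using v h(2) s by fastforce
    then have S: "?S v = {s}" "s \<in> sources I" using S by auto
    have "1 \<le> load I F v" using card_le[of v] S by simp
    then have "1 \<le> real (load I F v) powr alpha I"
      using \<alpha> by (intro ge_one_powr_ge_zero) auto
    then have "norm (source_pos I s - sink_pos I t) \<le> c (v, Sink t)"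
      using mult_left_mono[of 1 "real (load I F v) powr alpha I" "norm (source_pos I s - sink_pos I t)"]
      by (simp add: c_def s)
    moreover have "0 \<le> (\<Sum>s\<in>{s\<in>?T. h s = v}. c (Source s, h s))" by (intro sum_nonneg cnn)
    ultimately show ?thesis unfolding S using True by (simp add: P_def)
  next
    case False
    then have "{s\<in>?T. h s = v} = ?S v" by auto
    moreover have "(\<Sum>s\<in>?S v. norm (source_pos I s - P v)) \<le> (\<Sum>s\<in>?S v. c (Source s, h s))"
      using src False by (intro sum_mono) auto
    ultimately show ?thesis using hub[OF False] by simp
  qed
  have "(\<Sum>v\<in>?A. (\<Sum>s\<in>?S v. norm (source_pos I s - P v)) + real (card (?S v)) powr alpha I * norm (P v - sink_pos I t))
     \<le> (\<Sum>v\<in>?A. c (v, Sink t)) + (\<Sum>v\<in>?A. \<Sum>s\<in>{s\<in>?T. h s = v}. c (Source s, h s))"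
    using group by (simp add: sum_mono flip: sum.distrib)
  also have "(\<Sum>v\<in>?A. \<Sum>s\<in>{s\<in>?T. h s = v}. c (Source s, h s)) = (\<Sum>s\<in>?T. c (Source s, h s))"
    using finS by (intro sum.group) auto
  also note le
  finally show ?thesis using small by (intro exI[of _ h] exI[of _ P]) blast
qed

text \<open>All paths end in the only sink, whose load is therefore the number of sources. This
  yields the capacity condition needed at the root of the output.\<close>

lemma feasible_imp_card_le:
  assumes "sinks I = {t}" "sources I \<noteq> {}" "feasible I"
  shows "card (sources I) \<le> caps I ! 0"
proof -
  obtain F where F: "valid_topology I F" using assms by (auto simp: feasible_def)
  then have forest: "rooted_forest F" and lv: "leaves F = Source ` sources I" and rt: "roots F \<subseteq> {Sink t}"
    using assms by (auto simp: valid_topology_def is_topology_def)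
  have path: "Sink t \<in> roots F \<and> (Source s, Sink t) \<in> (edges F)\<^sup>*" if "s \<in> sources I" for s
  proof -
    have "Source s \<in> verts F" using that lv by (auto simp: leaves_def)
    then obtain k r where "r \<in> roots F" "(Source s, r) \<in> edges F ^^ k"
      using rooted_forest_path_to_root[OF forest] by blast
    then show ?thesis using rt by (auto dest: relpow_imp_rtrancl)
  qed
  then have root: "Sink t \<in> roots F" using assms by auto
  then have "layer F (Sink t) = 0"
    using forest by (intro layer_eqI[where r = "Sink t"]) (auto simp: rooted_forest_def)
  moreover have "load I F (Sink t) = card (sources I)"
    unfolding load_def using path by (intro arg_cong[of _ _ card]) auto
  moreover have "Sink t \<in> verts F" using root by (auto simp: roots_def)
  ultimately show ?thesis using F by (auto simp: valid_topology_def)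
qed

text \<open>Surjectivity of \<open>g\<close> gives every Steiner vertex a child, and nonemptiness of
  \<open>xs\<close> gives one to the sink, so that the leaves are exactly the sources.\<close>

lemma two_level_topology:
  fixes I :: flamecast and xs :: "nat list" and t m :: nat and g :: "nat \<Rightarrow> nat"
  defines "F \<equiv> \<lparr>verts = Source ` set xs \<union> {Sink t} \<union> Steiner ` {..<m},
    edges = {(Source (xs ! i), Steiner (g i)) | i. i < length xs} \<union> {(Steiner j, Sink t) | j. j < m}\<rparr>"
  assumes inst: "is_instance I" "intermediate_layers I = 1" "sinks I = {t}"
    and xs: "distinct xs" "set xs = sources I" "xs \<noteq> []"
    and g: "g ` {..<length xs} = {..<m}"
    and caps: "length xs \<le> caps I ! 0" "\<And>j. j < m \<Longrightarrow> card {i. i < length xs \<and> g i = j} \<le> caps I ! 1"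
  shows "valid_topology I F"
    and "layout_cost I F q = (\<Sum>j<m. (\<Sum>i | i < length xs \<and> g i = j. norm (source_pos I (xs ! i) - q j))
      + real (card {i. i < length xs \<and> g i = j}) powr alpha I * norm (q j - sink_pos I t))"
proof -
  let ?n = "length xs"
  have E: "edges F = {(Source (xs ! i), Steiner (g i)) | i. i < ?n} \<union> {(Steiner j, Sink t) | j. j < m}"
    and V: "verts F = Source ` set xs \<union> {Sink t} \<union> Steiner ` {..<m}" by (simp_all add: F_def)
  have gm: "g i < m" if "i < ?n" for i using g that by blast
  have sv: "single_valued (edges F)"
    using xs(1) by (auto simp: E single_valued_def nth_eq_iff_index_eq)
  define rank where "rank = (\<lambda>v. case v of Source _ \<Rightarrow> 2 | Steiner _ \<Rightarrow> 1 | Sink _ \<Rightarrow> (0::nat))"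
  have "(edges F)\<inverse> \<subseteq> Wellfounded.measure rank" by (auto simp: E rank_def)
  then have "wf ((edges F)\<inverse>)" by (rule wf_subset[OF wf_measure])
  then have "acyclic (edges F)" using wf_acyclic acyclic_converse by blast
  then have forest: "rooted_forest F"
    using sv gm by (auto simp: rooted_forest_def E V)
  have m0: "0 < m" using gm[of 0] xs by auto
  have roots: "roots F = {Sink t}"
    by (auto simp: roots_def E V in_set_conv_nth)
  have leaves: "leaves F = Source ` set xs"
  proof -
    have "\<exists>u. (u, Steiner j) \<in> edges F" if "j < m" for j
      using that g unfolding E by (auto simp: image_iff set_eq_iff) 
    moreover have "\<exists>u. (u, Sink t) \<in> edges F" using m0 by (auto simp: E)
    moreover have "\<nexists>u. (u, Source s) \<in> edges F" for s by (auto simp: E)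
    ultimately show ?thesis unfolding leaves_def V by blast
  qed
  have lay0: "layer F (Sink t) = 0" by (intro layer_eqI[OF sv, where r = "Sink t"]) (auto simp: roots)
  have lay1: "layer F (Steiner j) = 1" if "j < m" for j
    using that by (intro layer_eqI[OF sv, where r = "Sink t"]) (auto simp: roots E)
  have lay2: "layer F (Source s) = 2" if s: "s \<in> set xs" for s
  proof (intro layer_eqI[OF sv, where r = "Sink t"])
    obtain i where "i < ?n" "s = xs ! i" using s by (auto simp: in_set_conv_nth)
    then have "(Source s, Steiner (g i)) \<in> edges F" "(Steiner (g i), Sink t) \<in> edges F"
      using gm by (auto simp: E)
    then show "(Source s, Sink t) \<in> edges F ^^ 2" by (auto simp: numeral_2_eq_2)
  qed (auto simp: roots)
  have topo: "is_topology I F"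
    unfolding is_topology_def using forest leaves roots xs inst lay0 lay1 lay2 by (auto simp: V)
  have E': "(u, v) \<in> edges F \<longleftrightarrow> (\<exists>i<?n. u = Source (xs ! i) \<and> v = Steiner (g i)) \<or> (\<exists>j<m. u = Steiner j \<and> v = Sink t)"
    for u v by (auto simp: E)
  have sink_out: "v = Sink t" if "(Sink t, v) \<in> (edges F)\<^sup>*" for v
    using that by (cases rule: converse_rtranclE) (auto simp: E')
  have steiner_out: "v = Sink t \<or> v = Steiner j" if "(Steiner j, v) \<in> (edges F)\<^sup>*" for v j
    using that by (cases rule: converse_rtranclE) (auto simp: E' dest: sink_out)
  have load2: "load I F (Source s) = 1" if "s \<in> sources I" for s
  proof -
    have "s' = s" if "(Source s', Source s) \<in> (edges F)\<^sup>*" for s'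
      using that by (cases rule: rtranclE) (auto simp: E')
    then have "{s' \<in> sources I. (Source s', Source s) \<in> (edges F)\<^sup>*} = {s}" using that by auto
    then show ?thesis by (simp add: load_def)
  qed
  have load1: "load I F (Steiner j) = card {i. i < ?n \<and> g i = j}" for j
  proof -
    have "(Source s, Steiner j) \<in> (edges F)\<^sup>* \<longleftrightarrow> (\<exists>i<?n. s = xs ! i \<and> g i = j)" for s
    proof
      assume "(Source s, Steiner j) \<in> (edges F)\<^sup>*"
      then show "\<exists>i<?n. s = xs ! i \<and> g i = j"
        by (cases rule: converse_rtranclE) (auto simp: E' dest: steiner_out)
    next
      assume "\<exists>i<?n. s = xs ! i \<and> g i = j"
      then show "(Source s, Steiner j) \<in> (edges F)\<^sup>*" by (intro r_into_rtrancl) (auto simp: E')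
    qed
    then have "{s \<in> sources I. (Source s, Steiner j) \<in> (edges F)\<^sup>*} = (!) xs ` {i. i < ?n \<and> g i = j}"
      using xs(2) by auto
    moreover have "inj_on ((!) xs) {i. i < ?n \<and> g i = j}"
      using xs(1) by (auto simp: inj_on_def nth_eq_iff_index_eq)
    ultimately show ?thesis by (simp add: load_def card_image)
  qed
  have load0: "load I F (Sink t) \<le> ?n"
    unfolding load_def using xs distinct_card[OF xs(1)] 
    by (metis (no_types, lifting) List.finite_set card_mono mem_Collect_eq subsetI)
  have "length (caps I) = 3" using inst by (auto simp: is_instance_def intermediate_layers_def)
  \<comment> \<open>The sources are in layer 2 and have load 1.\<close>
  then have "1 \<le> caps I ! 2" using inst by (auto simp: is_instance_def)
  then show "valid_topology I F"
    unfolding valid_topology_def using topo lay0 lay1 lay2 load0 load1 load2 caps xs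
    by (auto simp: V)
  have "layout_cost I F q = (\<Sum>(u, v)\<in>(\<lambda>i. (Source (xs ! i), Steiner (g i))) ` {..<?n} \<union> (\<lambda>j. (Steiner j, Sink t)) ` {..<m}.
      norm (embedding I q u - embedding I q v) * real (load I F u) powr alpha I)"
    unfolding layout_cost_def by (intro sum.cong) (auto simp: E)
  also have "\<dots> = (\<Sum>(u, v)\<in>(\<lambda>i. (Source (xs ! i), Steiner (g i))) ` {..<?n}.
      norm (embedding I q u - embedding I q v) * real (load I F u) powr alpha I)
    + (\<Sum>(u, v)\<in>(\<lambda>j. (Steiner j, Sink t)) ` {..<m}.
      norm (embedding I q u - embedding I q v) * real (load I F u) powr alpha I)"
    by (intro sum.union_disjoint) auto
  also have "(\<Sum>(u, v)\<in>(\<lambda>i. (Source (xs ! i), Steiner (g i))) ` {..<?n}.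
      norm (embedding I q u - embedding I q v) * real (load I F u) powr alpha I)
      = (\<Sum>i<?n. norm (source_pos I (xs ! i) - q (g i)))"
  proof -
    have "inj_on (\<lambda>i. (Source (xs ! i), Steiner (g i))) {..<?n}"
      using xs(1) by (auto simp: inj_on_def nth_eq_iff_index_eq)
    moreover have "load I F (Source (xs ! i)) = 1" if "i < ?n" for i using load2 that xs(2) nth_mem by blast
    ultimately show ?thesis by (simp add: sum.reindex)
  qed
  also have "\<dots> = (\<Sum>j<m. \<Sum>i\<in>{i\<in>{..<?n}. g i = j}. norm (source_pos I (xs ! i) - q (g i)))"
    using g by (intro sum.group[symmetric]) auto
  also have "(\<Sum>(u, v)\<in>(\<lambda>j. (Steiner j, Sink t)) ` {..<m}.
      norm (embedding I q u - embedding I q v) * real (load I F u) powr alpha I)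
     = (\<Sum>j<m. real (card {i. i < ?n \<and> g i = j}) powr alpha I * norm (q j - sink_pos I t))"
    by (simp add: sum.reindex inj_on_def load1 mult.commute)
  finally show "layout_cost I F q = (\<Sum>j<m. (\<Sum>i | i < length xs \<and> g i = j. norm (source_pos I (xs ! i) - q j))
      + real (card {i. i < length xs \<and> g i = j}) powr alpha I * norm (q j - sink_pos I t))"
    by (simp add: sum.distrib)
qed

section \<open>Reasoning about programs\<close>

text \<open>Total correctness with the running time passed to the postcondition. Runs are
  deterministic, so the rules for loop-free commands are equivalences and can be used for
  rewriting.\<close>

definition wp :: "com \<Rightarrow> state \<Rightarrow> (nat \<Rightarrow> state \<Rightarrow> bool) \<Rightarrow> bool" where
  "wp c s Q \<longleftrightarrow> (\<exists>t s'. exec c s t s' \<and> Q t s')"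

fun nwrites :: "com \<Rightarrow> string set" where
  "nwrites (NSet a i e) = {a}"
| "nwrites (Seq c d) = nwrites c \<union> nwrites d"
| "nwrites (Cond b c d) = nwrites c \<union> nwrites d"
| "nwrites (While b c) = nwrites c"
| "nwrites _ = {}"

fun rwrites :: "com \<Rightarrow> string set" where
  "rwrites (RSet a i e) = {a}"
| "rwrites (Seq c d) = rwrites c \<union> rwrites d"
| "rwrites (Cond b c d) = rwrites c \<union> rwrites d"
| "rwrites (While b c) = rwrites c"
| "rwrites _ = {}"

definition frame :: "string set \<Rightarrow> string set \<Rightarrow> state \<Rightarrow> state \<Rightarrow> bool" where
  "frame A B s s' \<longleftrightarrow> (\<forall>a. a \<notin> A \<longrightarrow> nmem s' a = nmem s a) \<and> (\<forall>a. a \<notin> B \<longrightarrow> rmem s' a = rmem s a)"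

lemma frame_refl: "frame A B s s"
  by (simp add: frame_def)

lemma frame_trans: "frame A B s s' \<Longrightarrow> frame A B s' s'' \<Longrightarrow> frame A B s s''"
  by (simp add: frame_def)

lemma exec_frame: "exec c s t s' \<Longrightarrow> frame (nwrites c) (rwrites c) s s'"
  by (induction rule: exec.induct) (auto simp: frame_def)

text \<open>The consequence rule also supplies the frame condition read off the syntax, so
  specifications of subprograms mention only the banks they change.\<close>

lemma wp_mono: "wp c s Q \<Longrightarrow> (\<And>t s'. Q t s' \<Longrightarrow> frame (nwrites c) (rwrites c) s s' \<Longrightarrow> Q' t s') \<Longrightarrow> wp c s Q'"
  using exec_frame by (fastforce simp: wp_def)

lemma wp_exec: "exec c s t s' \<Longrightarrow> wp c s Q \<longleftrightarrow> Q t s'"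
  unfolding wp_def using exec_deterministic by blast

lemma wp_NSet: "wp (NSet a i e) s Q \<longleftrightarrow> Q (1 + ntime i + ntime e)
     (s\<lparr>nmem := (nmem s)(a := (nmem s a)(nval i s := nval e s))\<rparr>)"
  by (rule wp_exec) (rule exec.NSet)

lemma wp_RSet: "wp (RSet a i e) s Q \<longleftrightarrow> Q (1 + ntime i + rtime e)
     (s\<lparr>rmem := (rmem s)(a := (rmem s a)(nval i s := rval e s))\<rparr>)"
  by (rule wp_exec) (rule exec.RSet)

lemma wp_Skip: "wp Skip s Q \<longleftrightarrow> Q 1 s"
  by (rule wp_exec) (rule exec.Skip)

lemma wp_Seq: "wp (Seq c d) s Q \<longleftrightarrow> wp c s (\<lambda>t s'. wp d s' (\<lambda>t'. Q (t + t')))"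
  unfolding wp_def by (blast intro: exec.Seq elim: SeqE)

lemma wp_Cond: "wp (Cond b c d) s Q \<longleftrightarrow>
    (if bval b s then wp c s (\<lambda>t. Q (1 + btime b + t)) else wp d s (\<lambda>t. Q (1 + btime b + t)))"
proof (cases "bval b s")
  case True
  have "exec (Cond b c d) s u s' \<longleftrightarrow> (\<exists>t. u = 1 + btime b + t \<and> exec c s t s')" for u s'
  proof
    assume "exec (Cond b c d) s u s'"
    then show "\<exists>t. u = 1 + btime b + t \<and> exec c s t s'" using True by (elim CondE) auto
  next
    assume "\<exists>t. u = 1 + btime b + t \<and> exec c s t s'"
    then show "exec (Cond b c d) s u s'" using exec.CondTrue True by blast
  qed
  then show ?thesis using True unfolding wp_def by auto
next
  case False
  have "exec (Cond b c d) s u s' \<longleftrightarrow> (\<exists>t. u = 1 + btime b + t \<and> exec d s t s')" for u s'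
  proof
    assume "exec (Cond b c d) s u s'"
    then show "\<exists>t. u = 1 + btime b + t \<and> exec d s t s'" using False by (elim CondE) auto
  next
    assume "\<exists>t. u = 1 + btime b + t \<and> exec d s t s'"
    then show "exec (Cond b c d) s u s'" using exec.CondFalse False by blast
  qed
  then show ?thesis using False unfolding wp_def by auto
qed

lemmas wp_simps = wp_NSet wp_RSet wp_Skip wp_Seq wp_Cond

text \<open>The index of \<open>Inv\<close> bounds the remaining rounds, each of which takes at most
  \<open>B\<close> steps plus the test. The frame is kept relative to a fixed state
  \<open>s0\<close>, so values from before the loop remain accessible.\<close>

lemma wp_While_measure:
  fixes m :: nat
  assumes "Inv m s" "frame (nwrites c) (rwrites c) s0 s"
    and step: "\<And>k s. Inv k s \<Longrightarrow> frame (nwrites c) (rwrites c) s0 s \<Longrightarrow> bval b s \<Longrightarrow>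
        0 < k \<and> wp c s (\<lambda>t s'. t \<le> B \<and> (\<exists>k'<k. Inv k' s'))"
  shows "wp (While b c) s (\<lambda>t s'. t \<le> m * (B + btime b + 1) + btime b + 1 \<and> (\<exists>k. Inv k s') \<and> \<not> bval b s' \<and>
      frame (nwrites c) (rwrites c) s0 s')"
  using assms(1,2)
proof (induction m arbitrary: s rule: less_induct)
  case (less m)
  show ?case
  proof (cases "bval b s")
    case False
    then have "exec (While b c) s (1 + btime b) s" by (rule exec.WhileFalse)
    then show ?thesis unfolding wp_def using less.prems False by (intro exI[of _ "1 + btime b"] exI[of _ s]) auto
  next
    case True
    then obtain t s' k where 1: "exec c s t s'" "t \<le> B" "k < m" "Inv k s'"
      using step[OF less.prems] by (auto simp: wp_def)
    have "frame (nwrites c) (rwrites c) s0 s'"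
      using less.prems(2) exec_frame[OF 1(1)] by (rule frame_trans)
    from less.IH[OF 1(3,4) this] obtain t' s'' where
      2: "exec (While b c) s' t' s''" "t' \<le> k * (B + btime b + 1) + btime b + 1"
        "\<exists>k. Inv k s''" "\<not> bval b s''" "frame (nwrites c) (rwrites c) s0 s''"
      by (auto simp: wp_def)
    have "Suc k * (B + btime b + 1) \<le> m * (B + btime b + 1)" using 1(3) by (intro mult_le_mono1) simp
    then have "1 + btime b + t + t' \<le> m * (B + btime b + 1) + btime b + 1" using 1(2) 2(2) by simp
    moreover have "exec (While b c) s (1 + btime b + t + t') s''"
      using True 1 2 by (blast intro: exec.WhileTrue)
    ultimately show ?thesis unfolding wp_def using 2 by blast
  qed
qed

abbreviation NV :: "string \<Rightarrow> nexp" where "NV x \<equiv> NGet x (NConst 0)"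
abbreviation RV :: "string \<Rightarrow> rexp" where "RV x \<equiv> RGet x (NConst 0)"
abbreviation N0 :: nexp where "N0 \<equiv> NConst 0"
abbreviation N1 :: nexp where "N1 \<equiv> NConst 1"

definition For :: "string \<Rightarrow> nexp \<Rightarrow> com \<Rightarrow> com" where
  "For i e c = While (NLess (NV i) e) (Seq c (NSet i N0 (NAdd (NV i) N1)))"

lemma writes_For [simp]: "nwrites (For i e c) = insert i (nwrites c)" "rwrites (For i e c) = rwrites c"
  by (auto simp: For_def)

definition nupd :: "string \<Rightarrow> nat \<Rightarrow> state \<Rightarrow> state" where
  "nupd i v s = s\<lparr>nmem := (nmem s)(i := (nmem s i)(0 := v))\<rparr>"

text \<open>The bound \<open>e\<close> is evaluated anew in each round, hence the demand that it
  have the value \<open>h\<close> throughout the frame. Beyond the body and \<open>e\<close>, a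
  round takes 10 steps: 6 to increment, 3 for the rest of the test, 1 for the loop.\<close>

lemma wp_For:
  assumes init: "Inv lo s" "nmem s i 0 = lo" "lo \<le> h"
    and h: "\<And>s'. frame (insert i (nwrites c)) (rwrites c) s s' \<Longrightarrow> nval e s' = h"
    and step: "\<And>j s'. lo \<le> j \<Longrightarrow> j < h \<Longrightarrow> Inv j s' \<Longrightarrow> nmem s' i 0 = j \<Longrightarrow>
        frame (insert i (nwrites c)) (rwrites c) s s' \<Longrightarrow>
        wp c s' (\<lambda>t s''. t \<le> B \<and> nmem s'' i 0 = j \<and> Inv (Suc j) (nupd i (Suc j) s''))"
    and post: "\<And>t s'. t \<le> (h - lo) * (B + ntime e + 10) + ntime e + 5 \<Longrightarrow> Inv h s' \<Longrightarrow> nmem s' i 0 = h \<Longrightarrow>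
        frame (insert i (nwrites c)) (rwrites c) s s' \<Longrightarrow> Q t s'"
  shows "wp (For i e c) s Q"
proof -
  let ?c = "Seq c (NSet i N0 (NAdd (NV i) N1))"
  define J where "J = (\<lambda>k s'. \<exists>j. lo \<le> j \<and> j \<le> h \<and> k = h - j \<and> Inv j s' \<and> nmem s' i 0 = j)"
  have w: "nwrites ?c = insert i (nwrites c)" "rwrites ?c = rwrites c" by auto
  have "wp (While (NLess (NV i) e) ?c) s (\<lambda>t s'. t \<le> (h - lo) * (B + 6 + btime (NLess (NV i) e) + 1) + btime (NLess (NV i) e) + 1
      \<and> (\<exists>k. J k s') \<and> \<not> bval (NLess (NV i) e) s' \<and> frame (nwrites ?c) (rwrites ?c) s s')"
  proof (rule wp_While_measure)
    show "J (h - lo) s" using init by (auto simp: J_def)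
    show "frame (nwrites ?c) (rwrites ?c) s s" by (rule frame_refl)
  next
    fix k s' assume k: "J k s'" and fr: "frame (nwrites ?c) (rwrites ?c) s s'" and b: "bval (NLess (NV i) e) s'"
    from k obtain j where j: "lo \<le> j" "k = h - j" "Inv j s'" "nmem s' i 0 = j" by (auto simp: J_def)
    have "j < h" using b h fr j w by simp
    then have "wp c s' (\<lambda>t s''. t \<le> B \<and> nmem s'' i 0 = j \<and> Inv (Suc j) (nupd i (Suc j) s''))"
      using step[of j s'] j fr w by simp
    then have "wp ?c s' (\<lambda>t s''. t \<le> B + 6 \<and> (\<exists>k'<k. J k' s''))"
      unfolding wp_Seq wp_NSet
    proof (rule wp_mono)
      fix t s'' assume a: "t \<le> B \<and> nmem s'' i 0 = j \<and> Inv (Suc j) (nupd i (Suc j) s'')"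
      then have "J (h - Suc j) (nupd i (Suc j) s'')" using j \<open>j < h\<close> by (auto simp: J_def nupd_def)
      moreover have "h - Suc j < k" using j \<open>j < h\<close> by simp
      ultimately show "t + (1 + ntime N0 + ntime (NAdd (NV i) N1)) \<le> B + 6 \<and>
          (\<exists>k'<k. J k' (s''\<lparr>nmem := (nmem s'')(i := (nmem s'' i)(nval N0 s'' := nval (NAdd (NV i) N1) s''))\<rparr>))"
        using a by (auto simp: nupd_def)
    qed
    then show "0 < k \<and> wp ?c s' (\<lambda>t s'. t \<le> B + 6 \<and> (\<exists>k'<k. J k' s'))" using j \<open>j < h\<close> by simp
  qed
  then show ?thesis unfolding For_def
  proof (rule wp_mono)
    fix t s'
    assume a: "t \<le> (h - lo) * (B + 6 + btime (NLess (NV i) e) + 1) + btime (NLess (NV i) e) + 1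
      \<and> (\<exists>k. J k s') \<and> \<not> bval (NLess (NV i) e) s' \<and> frame (nwrites ?c) (rwrites ?c) s s'"
    then obtain j where j: "j \<le> h" "Inv j s'" "nmem s' i 0 = j" by (auto simp: J_def)
    then have "j = h" using a h w by auto
    then show "Q t s'" using j a w by (intro post) (auto simp: algebra_simps)
  qed
qed

section \<open>The program\<close>

abbreviation Seq_infix (infixr ";;" 60) where "c ;; d \<equiv> Seq c d"

abbreviation RSq :: "rexp \<Rightarrow> rexp" where "RSq e \<equiv> RMul e e"

section \<open>Ternary search for one group size\<close>

definition eval_star :: com where
  "eval_star =
     RSet ''g'' N0 (RNat N0) ;;
     NSet ''j'' N0 N0 ;;
     For ''j'' (NV ''k'')
       (RSet ''g'' N0 (RAdd (RV ''g'') (RSqrt (RAdd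
          (RSq (RSub (RGet ''vx'' (NV ''j'')) (RMul (RV ''t'') (RV ''wx''))))
          (RSq (RSub (RGet ''vy'' (NV ''j'')) (RMul (RV ''t'') (RV ''wy'')))))))) ;;
     RSet ''g'' N0 (RAdd (RV ''g'') (RMul (RPowr (NV ''k'') (RV ''alpha''))
       (RSqrt (RAdd (RSq (RMul (RV ''t'') (RV ''wx''))) (RSq (RMul (RV ''t'') (RV ''wy'')))))))"

lemma writes_eval_star [simp]: "nwrites eval_star = {''j''}" "rwrites eval_star = {''g''}"
  by (auto simp: eval_star_def)

lemma wp_eval_star:
  fixes s :: state
  defines "v \<equiv> \<lambda>j. (rmem s ''vx'' j, rmem s ''vy'' j)" and "w \<equiv> (rmem s ''wx'' 0, rmem s ''wy'' 0)"
    and "\<tau> \<equiv> rmem s ''t'' 0" and "k \<equiv> nmem s ''k'' 0"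
  shows "wp eval_star s (\<lambda>t s'. t \<le> 100 * k + 100 \<and> rmem s' ''g'' 0 = star_cost k v (rmem s ''alpha'' 0) (\<tau> *\<^sub>R w))"
  unfolding eval_star_def wp_simps
proof (rule wp_For[where Inv = "\<lambda>j s'. rmem s' ''g'' 0 = (\<Sum>i<j. norm (v i - \<tau> *\<^sub>R w))" and lo = 0 and h = k and B = 60], goal_cases)
  case (4 s')
  then show ?case by (simp add: frame_def k_def)
next
  case (5 j s')
  then show ?case
    by (simp add: wp_simps frame_def nupd_def v_def w_def \<tau>_def norm_Pair power2_eq_square)
next
  case (6 t s')
  then show ?case
    by (simp add: frame_def star_cost_def norm_Pair w_def power2_eq_square \<tau>_def k_def)
qed simp_all

definition search_step :: com where
  "search_step =
     RSet ''t'' N0 (RDiv (RAdd (RMul (RNat (NConst 2)) (RV ''lo'')) (RV ''hi'')) (RNat (NConst 3))) ;;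
     eval_star ;;
     RSet ''t1'' N0 (RV ''t'') ;;
     RSet ''g1'' N0 (RV ''g'') ;;
     RSet ''t'' N0 (RDiv (RAdd (RV ''lo'') (RMul (RNat (NConst 2)) (RV ''hi''))) (RNat (NConst 3))) ;;
     eval_star ;;
     Cond (RLess (RV ''g'') (RV ''g1'')) (RSet ''lo'' N0 (RV ''t1'')) (RSet ''hi'' N0 (RV ''t''))"

lemma writes_search_step [simp]: "nwrites search_step = {''j''}"
  "rwrites search_step = {''t'', ''g'', ''t1'', ''g1'', ''lo'', ''hi''}"
  by (auto simp: search_step_def)

lemma wp_search_step:
  assumes f: "f = (\<lambda>\<tau>. star_cost (nmem s ''k'' 0) (\<lambda>j. (rmem s ''vx'' j, rmem s ''vy'' j)) (rmem s ''alpha'' 0)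
      (\<tau> *\<^sub>R (rmem s ''wx'' 0, rmem s ''wy'' 0)))"
    and ab: "a = rmem s ''lo'' 0" "b = rmem s ''hi'' 0"
  shows "wp search_step s (\<lambda>t s'. t \<le> 200 * nmem s ''k'' 0 + 300 \<and>
     (if f ((a + 2 * b) / 3) < f ((2 * a + b) / 3) then rmem s' ''lo'' 0 = (2 * a + b) / 3 \<and> rmem s' ''hi'' 0 = b
      else rmem s' ''lo'' 0 = a \<and> rmem s' ''hi'' 0 = (a + 2 * b) / 3))"
  unfolding search_step_def wp_Seq wp_RSet
proof (rule wp_mono[OF wp_eval_star], goal_cases)
  case (1 t1 s1)
  note s1 = 1
  show ?case
  proof (rule wp_mono[OF wp_eval_star], goal_cases)
    case (1 t2 s2)
    with s1 show ?case
      by (simp add: wp_simps frame_def f ab)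
  qed
qed

definition search_init :: com where
  "search_init =
     RSet ''wx'' N0 (RDiv (RAdd (RGet ''vx'' (NGet ''half'' (NSub (NV ''k'') N1))) (RGet ''vx'' (NGet ''half'' (NV ''k'')))) (RNat (NConst 2))) ;;
     RSet ''wy'' N0 (RDiv (RAdd (RGet ''vy'' (NGet ''half'' (NSub (NV ''k'') N1))) (RGet ''vy'' (NGet ''half'' (NV ''k'')))) (RNat (NConst 2))) ;;
     RSet ''lo'' N0 (RNat N0) ;;
     RSet ''hi'' N0 (RNat N1)"

definition search_arc :: com where
  "search_arc =
     search_init ;;
     While (RLess (RMul (RV ''eps'') (RNat (NV ''k'')))
         (RMul (RMul (RNat (NConst 8)) (RNat (NV ''n''))) (RSub (RV ''hi'') (RV ''lo'')))) search_step ;;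
     RSet ''t'' N0 (RV ''lo'') ;;
     eval_star ;;
     RSet ''tau'' (NV ''k'') (RV ''lo'') ;;
     RSet ''F'' (NV ''k'') (RV ''g'')"

lemma writes_search_arc [simp]: "nwrites search_arc = {''j''}"
  "rwrites search_arc = {''wx'', ''wy'', ''lo'', ''hi'', ''t'', ''g'', ''t1'', ''g1'', ''tau'', ''F''}"
  by (auto simp: search_arc_def search_init_def)

text \<open>Two steps at least halve the bracket, as 4/9 is below 1/2. The exponent collects 3
  halvings for the factor 8, \<open>n div k + 1\<close> for the ratio of \<open>n\<close> to
  \<open>k\<close>, and \<open>L\<close> for 1 / \<epsilon>.\<close>

lemma ternary_steps_suffice:
  fixes n k L :: nat
  assumes "1 \<le> k" "0 < \<epsilon>" "1 / \<epsilon> \<le> 2 ^ L"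
  shows "8 * real n * (2 / 3) ^ (2 * (4 + n div k + L)) \<le> \<epsilon> * real k"
proof -
  have "n = k * (n div k) + n mod k" "n mod k < k" using assms(1) by simp_all
  then have "n \<le> k * (n div k + 1)" by (metis add_le_mono le_refl less_imp_le_nat mult.right_neutral distrib_left)
  also have "\<dots> \<le> k * 2 ^ (n div k + 1)" by (intro mult_le_mono2 less_imp_le_nat less_exp)
  finally have "real n \<le> real (k * 2 ^ (n div k + 1))" by (simp only: of_nat_le_iff)
  then have n: "real n \<le> real k * 2 ^ (n div k + 1)" by simp
  have p: "(2 / 3 :: real) ^ (2 * q) \<le> (1 / 2) ^ q" for q
    unfolding power_mult by (intro power_mono) (auto simp: power2_eq_square)
  have "8 * real n * (2 / 3) ^ (2 * (4 + n div k + L)) \<le> 8 * real n * (1 / 2) ^ (4 + n div k + L)"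
    by (intro mult_left_mono p) auto
  also have "\<dots> \<le> 8 * (real k * 2 ^ (n div k + 1)) * (1 / 2) ^ (4 + n div k + L)"
    using n by (intro mult_right_mono mult_left_mono) auto
  also have "\<dots> = real k * (1 / 2) ^ L"
    by (simp add: power_add power_one_over field_simps)
  also have "(1 / 2) ^ L \<le> \<epsilon>" using assms by (simp add: field_simps)
  finally show ?thesis using assms by (simp add: mult.commute mult_left_mono)
qed

lemma wp_search_arc:
  fixes s :: state and k n L :: nat
  defines "v \<equiv> \<lambda>j. (rmem s ''vx'' j, rmem s ''vy'' j)" and "\<epsilon> \<equiv> rmem s ''eps'' 0"
  defines "f \<equiv> \<lambda>\<tau>. star_cost k v (rmem s ''alpha'' 0) (\<tau> *\<^sub>R arc_mid v 0 k)"
  assumes k: "nmem s ''k'' 0 = k" "1 \<le> k" "k \<le> n" and n: "nmem s ''n'' 0 = n"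
    and half: "nmem s ''half'' (k - 1) = (k - 1) div 2" "nmem s ''half'' k = k div 2"
    and \<epsilon>: "0 < \<epsilon>" "1 / \<epsilon> \<le> 2 ^ L"
  shows "wp search_arc s (\<lambda>t s'. t \<le> 3000 * n * (L + 5) \<and> (\<exists>a b. brackets_min f a b \<and> 0 \<le> a \<and>
     8 * real n * (b - a) \<le> \<epsilon> * real k \<and>
     rmem s' ''tau'' = (rmem s ''tau'')(k := a) \<and> rmem s' ''F'' = (rmem s ''F'')(k := f a)))"
proof -
  define w where "w = arc_mid v 0 k"
  define M where "M = 2 * (4 + n div k + L)"
  let ?guard = "RLess (RMul (RV ''eps'') (RNat (NV ''k'')))
         (RMul (RMul (RNat (NConst 8)) (RNat (NV ''n''))) (RSub (RV ''hi'') (RV ''lo'')))"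
  define s1 where "s1 = s\<lparr>rmem := (rmem s)(''wx'' := (rmem s ''wx'')(0 := fst w), ''wy'' := (rmem s ''wy'')(0 := snd w),
     ''lo'' := (rmem s ''lo'')(0 := 0), ''hi'' := (rmem s ''hi'')(0 := 1))\<rparr>"
  \<comment> \<open>With \<open>i\<close> rounds done and at most \<open>m\<close> to go, the
    bracket has width exactly \<open>(2 / 3) ^ i\<close>.\<close>
  define Inv where "Inv = (\<lambda>m (s' :: state). \<exists>i. m + i = M \<and> brackets_min f (rmem s' ''lo'' 0) (rmem s' ''hi'' 0) \<and>
     0 \<le> rmem s' ''lo'' 0 \<and> rmem s' ''hi'' 0 - rmem s' ''lo'' 0 = (2 / 3) ^ i)"
  have M: "8 * real n * (2 / 3) ^ M \<le> \<epsilon> * real k"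
    unfolding M_def using k \<epsilon> by (intro ternary_steps_suffice)
  have loop: "wp (While ?guard search_step) s1 (\<lambda>t s'. t \<le> M * ((200 * k + 300) + btime ?guard + 1) + btime ?guard + 1 \<and>
     (\<exists>m. Inv m s') \<and> \<not> bval ?guard s' \<and> frame (nwrites search_step) (rwrites search_step) s1 s')"
  proof (rule wp_While_measure)
    show "Inv M s1" by (auto simp: Inv_def s1_def brackets_min_def)
    show "frame (nwrites search_step) (rwrites search_step) s1 s1" by (rule frame_refl)
  next
    fix m s'
    assume I: "Inv m s'" and fr: "frame (nwrites search_step) (rwrites search_step) s1 s'" and g: "bval ?guard s'"
    let ?a = "rmem s' ''lo'' 0" and ?b = "rmem s' ''hi'' 0"
    obtain i where i: "m + i = M" "brackets_min f ?a ?b" "0 \<le> ?a" "?b - ?a = (2 / 3) ^ i"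
      using I by (auto simp: Inv_def)
    have "rmem s' ''eps'' 0 = \<epsilon>" "nmem s' ''k'' 0 = k" "nmem s' ''n'' 0 = n"
      using fr k n by (auto simp: frame_def s1_def \<epsilon>_def)
    then have "\<epsilon> * real k < 8 * real n * (2 / 3) ^ i" using g i(4) by simp
    then have "8 * real n * (2 / 3) ^ M < 8 * real n * (2 / 3) ^ i" using M by simp
    \<comment> \<open>The test succeeds at width \<open>(2 / 3) ^ i\<close> but would fail at
      \<open>(2 / 3) ^ M\<close>, so fewer than \<open>M\<close> rounds have been made.\<close>
    then have "\<not> i \<ge> M" using power_decreasing[of M i "2 / 3 :: real"] by (auto simp: mult_less_cancel_left)
    then have m: "0 < m" using i by simp
    have f: "f = (\<lambda>\<tau>. star_cost (nmem s' ''k'' 0) (\<lambda>j. (rmem s' ''vx'' j, rmem s' ''vy'' j)) (rmem s' ''alpha'' 0) (\<tau> *\<^sub>R (rmem s' ''wx'' 0, rmem s' ''wy'' 0)))"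
      using fr k by (simp add: frame_def s1_def f_def v_def w_def)
    have conv: "convex_on UNIV f" unfolding f_def by (rule convex_on_star_cost)
    have "wp search_step s' (\<lambda>t s''. t \<le> 200 * k + 300 \<and> (\<exists>m'<m. Inv m' s''))"
    proof (rule wp_mono[OF wp_search_step[OF f refl refl]], goal_cases)
      case (1 t s'')
      have "Inv (m - 1) s''"
      proof (cases "f ((?a + 2 * ?b) / 3) < f ((2 * ?a + ?b) / 3)")
        case True
        then have e: "rmem s'' ''lo'' 0 = (2 * ?a + ?b) / 3" "rmem s'' ''hi'' 0 = ?b" using 1 by simp_all
        have "?b - (2 * ?a + ?b) / 3 = 2 / 3 * (?b - ?a)" by (simp add: field_simps)
        moreover have "0 \<le> (2 * ?a + ?b) / 3" using i(2,3) by (simp add: brackets_min_def)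
        ultimately show ?thesis using brackets_min_ternary(1)[OF conv i(2) True] i(1,4) m
          unfolding Inv_def e by (intro exI[of _ "Suc i"]) simp
      next
        case False
        then have e: "rmem s'' ''lo'' 0 = ?a" "rmem s'' ''hi'' 0 = (?a + 2 * ?b) / 3" using 1 by simp_all
        have "(?a + 2 * ?b) / 3 - ?a = 2 / 3 * (?b - ?a)" by (simp add: field_simps)
        then show ?thesis using brackets_min_ternary(2)[OF conv i(2) False] i(1,3,4) m
          unfolding Inv_def e by (intro exI[of _ "Suc i"]) simp
      qed
      then show ?case using 1 m \<open>nmem s' ''k'' 0 = k\<close> by (auto intro!: exI[of _ "m - 1"])
    qed
    then show "0 < m \<and> wp search_step s' (\<lambda>t s'. t \<le> 200 * k + 300 \<and> (\<exists>k'<m. Inv k' s'))" using m by simp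
  qed
  have kn: "k * (n div k) \<le> n" by simp
  \<comment> \<open>Since \<open>k * (n div k) \<le> n\<close>, replacing \<open>log (n / k)\<close> by \<open>n div k\<close> in the number of steps is harmless.\<close>
  have time: "M * (600 * k) \<le> 1200 * n * (L + 5)"
  proof -
    have "M * (600 * k) = 1200 * (4 * k + k * (n div k) + k * L)" by (simp add: M_def algebra_simps)
    also have "\<dots> \<le> 1200 * (4 * n + n + n * L)" using k kn by (intro mult_le_mono add_mono) auto
    finally show ?thesis by (simp add: algebra_simps)
  qed
  have init: "wp search_init s (\<lambda>t s'. t \<le> 100 \<and> s' = s1)"
    using k half by (simp add: search_init_def wp_simps s1_def w_def arc_mid_def v_def)
  show ?thesis
    unfolding search_arc_def wp_Seq
  proof (rule wp_mono[OF init], goal_cases)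
    case (1 t0 s0)
    then have s0: "t0 \<le> 100" "s0 = s1" by auto
    show ?case unfolding s0(2)
    proof (rule wp_mono[OF loop], goal_cases)
      case (1 t1 s2)
      note s2 = 1
      show ?case unfolding wp_RSet
      proof (rule wp_mono[OF wp_eval_star], goal_cases)
        case (1 t2 s3)
        let ?a = "rmem s2 ''lo'' 0" and ?b = "rmem s2 ''hi'' 0"
        have k2: "nmem s2 ''k'' 0 = k" "nmem s2 ''n'' 0 = n" "rmem s2 ''eps'' 0 = \<epsilon>"
          using s2 k n by (auto simp: frame_def s1_def \<epsilon>_def)
        have "rmem s3 ''g'' 0 = f ?a"
        proof -
          have "(x * fst w, x * snd w) = x *\<^sub>R w" for x by (cases w) simp
          then show ?thesis using 1 s2 k by (simp add: frame_def s1_def f_def v_def w_def[unfolded v_def, symmetric])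
        qed
        moreover have "brackets_min f ?a ?b" "0 \<le> ?a" using s2 by (auto simp: Inv_def)
        moreover have "8 * real n * (?b - ?a) \<le> \<epsilon> * real k" using s2 k2 by simp
        moreover have "nmem s3 ''k'' 0 = k" "rmem s3 ''lo'' 0 = ?a"
          "rmem s3 ''tau'' = rmem s ''tau''" "rmem s3 ''F'' = rmem s ''F''"
          using 1 s2 k2 by (auto simp: frame_def s1_def)
        moreover have "t0 + (t1 + (4 + (t2 + 10))) \<le> 3000 * n * (L + 5)"
        proof -
          have "t2 \<le> 100 * k + 100" using 1 k2 by simp
          moreover have "t1 \<le> M * (600 * k) + 100"
          proof -
            have "(200 * k + 300) + btime ?guard + 1 \<le> 600 * k" using k(2) by simp
            then have "M * ((200 * k + 300) + btime ?guard + 1) \<le> M * (600 * k)" by (rule mult_le_mono2)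
            moreover have "btime ?guard \<le> 50" by simp
            moreover have "t1 \<le> M * ((200 * k + 300) + btime ?guard + 1) + btime ?guard + 1" using s2 by blast
            ultimately show ?thesis by linarith
          qed
          ultimately have "t0 + (t1 + (4 + (t2 + 10))) \<le> 1200 * n * (L + 5) + 500 * n"
            using s0 time k by linarith
          also have "\<dots> \<le> 3000 * n * (L + 5)" by (simp add: algebra_simps)
          finally show ?thesis .
        qed
        ultimately show ?case by simp (rule exI[of _ ?a], rule exI[of _ ?b], simp)
      qed
    qed
  qed
qed

section \<open>Recovering the circular order from coordinates\<close>

definition center_sources :: com where
  "center_sources =
     NSet ''i'' N0 N0 ;;
     For ''i'' (NV ''n'')
       (RSet ''ux'' (NV ''i'') (RSub (RGet ''source_x'' (NV ''i'')) (RV ''sink_x'')) ;;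
        RSet ''uy'' (NV ''i'') (RSub (RGet ''source_y'' (NV ''i'')) (RV ''sink_y'')))"

lemma writes_center_sources [simp]: "nwrites center_sources = {''i''}" "rwrites center_sources = {''ux'', ''uy''}"
  by (auto simp: center_sources_def)

lemma wp_center_sources:
  assumes "nmem s ''n'' 0 = n"
  shows "wp center_sources s (\<lambda>t s'. t \<le> 100 * n + 100 \<and>
    (\<forall>i<n. rmem s' ''ux'' i = rmem s ''source_x'' i - rmem s ''sink_x'' 0 \<and>
           rmem s' ''uy'' i = rmem s ''source_y'' i - rmem s ''sink_y'' 0))"
  unfolding center_sources_def wp_simps
proof (rule wp_For[where Inv = "\<lambda>j s'. \<forall>i<j. rmem s' ''ux'' i = rmem s ''source_x'' i - rmem s ''sink_x'' 0 \<and>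
           rmem s' ''uy'' i = rmem s ''source_y'' i - rmem s ''sink_y'' 0" and lo = 0 and h = n and B = 30], goal_cases)
  case (4 s')
  then show ?case using assms by (simp add: frame_def)
next
  case (5 j s')
  then show ?case by (auto simp: wp_simps frame_def nupd_def less_Suc_eq)
next
  case (6 t s')
  then show ?case by simp
qed simp_all

definition dot_first :: "nexp \<Rightarrow> rexp" where
  "dot_first e = RAdd (RMul (RV ''ux'') (RGet ''ux'' e)) (RMul (RV ''uy'') (RGet ''uy'' e))"

definition find_neighbour :: com where
  "find_neighbour =
     NSet ''b'' N0 N1 ;;
     NSet ''i'' N0 N1 ;;
     For ''i'' (NV ''n'')
       (Cond (RLess (dot_first (NV ''b'')) (dot_first (NV ''i''))) (NSet ''b'' N0 (NV ''i'')) Skip)"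

lemma writes_find_neighbour [simp]: "nwrites find_neighbour = {''b'', ''i''}" "rwrites find_neighbour = {}"
  by (auto simp: find_neighbour_def)

text \<open>For \<open>n = 1\<close> source 0 has no neighbour and \<open>b\<close> keeps its
  initial value 1, which accounts for \<open>max 2 n\<close>.\<close>

lemma wp_find_neighbour:
  fixes s :: state
  defines "dt \<equiv> \<lambda>i. rmem s ''ux'' 0 * rmem s ''ux'' i + rmem s ''uy'' 0 * rmem s ''uy'' i"
  assumes "nmem s ''n'' 0 = n" "1 \<le> n"
  shows "wp find_neighbour s (\<lambda>t s'. t \<le> 100 * n + 100 \<and>
    (\<exists>b. nmem s' ''b'' 0 = b \<and> 1 \<le> b \<and> b < max 2 n \<and> (\<forall>i. 1 \<le> i \<longrightarrow> i < n \<longrightarrow> dt i \<le> dt b)))"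
  unfolding find_neighbour_def wp_simps
proof (rule wp_For[where Inv = "\<lambda>j s'. \<exists>b. nmem s' ''b'' 0 = b \<and> 1 \<le> b \<and> b < max 2 j \<and>
     (\<forall>i. 1 \<le> i \<longrightarrow> i < j \<longrightarrow> dt i \<le> dt b)" and lo = 1 and h = n and B = 50], goal_cases)
  case (4 s')
  then show ?case using assms by (simp add: frame_def)
next
  case (5 j s')
  define b where "b = nmem s' ''b'' 0"
  have b: "1 \<le> b" "b < max 2 j" "\<And>i. 1 \<le> i \<Longrightarrow> i < j \<Longrightarrow> dt i \<le> dt b" using 5(3) by (auto simp: b_def)
  have g: "bval (RLess (dot_first (NV ''b'')) (dot_first (NV ''i''))) s' \<longleftrightarrow> dt b < dt j"
    using 5(4,5) by (simp add: dot_first_def frame_def dt_def b_def)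
  have t: "btime (RLess (dot_first (NV ''b'')) (dot_first (NV ''i''))) \<le> 40" by (simp add: dot_first_def)
  show ?case
  proof (cases "dt b < dt j")
    case True
    have "dt i \<le> dt j" if "1 \<le> i" "i < Suc j" for i
      using True b(3)[of i] that by (cases "i = j") auto
    then show ?thesis using True 5(1,4) t unfolding wp_Cond g by (simp add: wp_simps nupd_def)
  next
    case False
    have "dt i \<le> dt b" if "1 \<le> i" "i < Suc j" for i
      using False b(3)[of i] that by (cases "i = j") auto
    then show ?thesis using False 5(1,4) t b(1,2) unfolding wp_Cond g by (simp add: wp_simps nupd_def b_def)
  qed
next
  case (6 t s')
  then show ?case by simp
qed (use assms in simp_all)

text \<open>The machine has no trigonometric functions. The largest inner product with source 0 is
  \<open>r\<^sup>2 cos (2 \<pi> / n)\<close>, and taking the nonnegative root for the sine fixes the orientation.\<close>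

definition walk_circle :: com where
  "walk_circle =
     RSet ''c'' N0 (RDiv (dot_first (NV ''b'')) (dot_first N0)) ;;
     RSet ''s'' N0 (RSqrt (RSub (RNat N1) (RSq (RV ''c'')))) ;;
     RSet ''vx'' N0 (RV ''ux'') ;;
     RSet ''vy'' N0 (RV ''uy'') ;;
     NSet ''i'' N0 N1 ;;
     For ''i'' (NV ''n'')
       (RSet ''vx'' (NV ''i'') (RSub (RMul (RV ''c'') (RGet ''vx'' (NSub (NV ''i'') N1))) (RMul (RV ''s'') (RGet ''vy'' (NSub (NV ''i'') N1)))) ;;
        RSet ''vy'' (NV ''i'') (RAdd (RMul (RV ''s'') (RGet ''vx'' (NSub (NV ''i'') N1))) (RMul (RV ''c'') (RGet ''vy'' (NSub (NV ''i'') N1)))))"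

lemma writes_walk_circle [simp]: "nwrites walk_circle = {''i''}" "rwrites walk_circle = {''c'', ''s'', ''vx'', ''vy''}"
  by (auto simp: walk_circle_def)

text \<open>Each round rotates the previous vertex by \<delta> through the addition theorems. For
  \<open>n = 1\<close> the loop is empty and the quotient for the cosine is meaningless, so it is
  constrained only from \<open>n = 2\<close> on.\<close>

lemma wp_walk_circle:
  fixes s :: state
  defines "dt \<equiv> \<lambda>i. rmem s ''ux'' 0 * rmem s ''ux'' i + rmem s ''uy'' 0 * rmem s ''uy'' i"
  assumes "nmem s ''n'' 0 = n" "1 \<le> n"
    and "rmem s ''ux'' 0 = r * cos \<theta>" "rmem s ''uy'' 0 = r * sin \<theta>"
    and c: "2 \<le> n \<Longrightarrow> dt (nmem s ''b'' 0) / dt 0 = cos \<delta>" "2 \<le> n \<Longrightarrow> 0 \<le> sin \<delta>"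
  shows "wp walk_circle s (\<lambda>t s'. t \<le> 100 * n + 200 \<and>
    (\<forall>i<n. (rmem s' ''vx'' i, rmem s' ''vy'' i) = r *\<^sub>R (cos (\<theta> + real i * \<delta>), sin (\<theta> + real i * \<delta>))))"
  unfolding walk_circle_def wp_simps
proof (rule wp_For[where Inv = "\<lambda>j s'. \<forall>i<j. rmem s' ''vx'' i = r * cos (\<theta> + real i * \<delta>) \<and> rmem s' ''vy'' i = r * sin (\<theta> + real i * \<delta>)"
   and lo = 1 and h = n and B = 60], goal_cases)
  case (4 s')
  then show ?case using assms by (simp add: frame_def)
next
  case (5 j s')
  then have "2 \<le> n" by simp
  have cs: "rmem s' ''c'' 0 = cos \<delta>" "rmem s' ''s'' 0 = sin \<delta>"
  proof -
    have "sqrt (1 - cos \<delta> * cos \<delta>) = sin \<delta>"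
      using c(2)[OF \<open>2 \<le> n\<close>] by (metis power2_eq_square real_sqrt_abs abs_of_nonneg sin_squared_eq)
    then show "rmem s' ''c'' 0 = cos \<delta>" "rmem s' ''s'' 0 = sin \<delta>"
      using 5(5) c(1)[OF \<open>2 \<le> n\<close>, unfolded dt_def]
      by (simp_all add: frame_def dot_first_def del: times_divide_eq_left times_divide_eq_right times_divide_times_eq)
  qed
  define x where "x = \<theta> + real (j - 1) * \<delta>"
  have x: "rmem s' ''vx'' (j - 1) = r * cos x" "rmem s' ''vy'' (j - 1) = r * sin x"
    using 5 by (auto simp: x_def)
  have j: "\<theta> + real j * \<delta> = x + \<delta>" using 5(1) by (simp add: x_def of_nat_diff algebra_simps)
  have "cos \<delta> * (r * cos x) - sin \<delta> * (r * sin x) = r * cos (\<theta> + real j * \<delta>)"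
    "sin \<delta> * (r * cos x) + cos \<delta> * (r * sin x) = r * sin (\<theta> + real j * \<delta>)"
    unfolding j by (simp_all add: cos_add sin_add algebra_simps)
  then show ?case using 5 cs x by (auto simp: wp_simps nupd_def less_Suc_eq)
next
  case (6 t s')
  then show ?case by (simp add: dot_first_def)
qed (use assms in simp_all)

text \<open>The machine can neither divide nor round naturals; the table supplies the indices of the
  two middle sources of an arc.\<close>

definition make_halves :: com where
  "make_halves =
     NSet ''i'' N0 (NConst 2) ;;
     For ''i'' (NAdd (NV ''n'') N1)
       (NSet ''half'' (NV ''i'') (NAdd (NGet ''half'' (NSub (NV ''i'') (NConst 2))) N1))"

lemma writes_make_halves [simp]: "nwrites make_halves = {''i'', ''half''}" "rwrites make_halves = {}"
  by (auto simp: make_halves_def)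

lemma wp_make_halves:
  assumes "nmem s ''n'' 0 = n" "1 \<le> n" "nmem s ''half'' 0 = 0" "nmem s ''half'' 1 = 0"
  shows "wp make_halves s (\<lambda>t s'. t \<le> 100 * n + 100 \<and> (\<forall>i\<le>n. nmem s' ''half'' i = i div 2))"
  unfolding make_halves_def wp_simps
proof (rule wp_For[where Inv = "\<lambda>j s'. \<forall>i<j. nmem s' ''half'' i = i div 2" and lo = 2 and h = "Suc n" and B = 30], goal_cases)
  case 1
  then show ?case using assms by (auto simp: numeral_2_eq_2 less_Suc_eq)
next
  case (4 s')
  then show ?case using assms by (simp add: frame_def)
next
  case (5 j s')
  then have "nmem s' ''half'' (j - 2) + 1 = j div 2" by (simp add: div_if)
  then show ?case using 5 by (auto simp: wp_simps nupd_def less_Suc_eq)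
next
  case (6 t s')
  then show ?case by (auto simp: less_Suc_eq_le)
qed (use assms in simp_all)

section \<open>Table of arc costs for all group sizes up to n\<close>

definition arc_table :: com where
  "arc_table = NSet ''k'' N0 N1 ;; For ''k'' (NAdd (NV ''n'') N1) search_arc"

lemma writes_arc_table [simp]: "nwrites arc_table = {''j'', ''k''}"
  "rwrites arc_table = {''wx'', ''wy'', ''lo'', ''hi'', ''t'', ''g'', ''t1'', ''g1'', ''tau'', ''F''}"
  by (auto simp: arc_table_def)

lemma wp_arc_table:
  fixes s :: state and n L :: nat
  defines "v \<equiv> \<lambda>j. (rmem s ''vx'' j, rmem s ''vy'' j)" and "\<epsilon> \<equiv> rmem s ''eps'' 0"
  defines "f \<equiv> \<lambda>k \<tau>. star_cost k v (rmem s ''alpha'' 0) (\<tau> *\<^sub>R arc_mid v 0 k)"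
  assumes n: "nmem s ''n'' 0 = n" "1 \<le> n" and half: "\<And>i. i \<le> n \<Longrightarrow> nmem s ''half'' i = i div 2"
    and \<epsilon>: "0 < \<epsilon>" "1 / \<epsilon> \<le> 2 ^ L"
  shows "wp arc_table s (\<lambda>t s'. t \<le> 4000 * (n * n * (L + 5)) \<and> (\<forall>k. 1 \<le> k \<longrightarrow> k \<le> n \<longrightarrow>
    (\<exists>a b. brackets_min (f k) a b \<and> 0 \<le> a \<and> 8 * real n * (b - a) \<le> \<epsilon> * real k \<and>
     rmem s' ''tau'' k = a \<and> rmem s' ''F'' k = f k a)))"
proof -
  define P where "P = (\<lambda>k a F. \<exists>b. brackets_min (f k) a b \<and> 0 \<le> a \<and> 8 * real n * (b - a) \<le> \<epsilon> * real k \<and> F = f k a)"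
  have "wp arc_table s (\<lambda>t s'. t \<le> 4000 * (n * n * (L + 5)) \<and>
     (\<forall>k. 1 \<le> k \<longrightarrow> k \<le> n \<longrightarrow> P k (rmem s' ''tau'' k) (rmem s' ''F'' k)))"
    unfolding arc_table_def wp_Seq wp_NSet
  proof (rule wp_For[where Inv = "\<lambda>j s'. \<forall>k. 1 \<le> k \<longrightarrow> k < j \<longrightarrow> P k (rmem s' ''tau'' k) (rmem s' ''F'' k)"
        and lo = 1 and h = "Suc n" and B = "3000 * n * (L + 5)"], goal_cases)
    case (4 s')
    then show ?case using n by (simp add: frame_def)
  next
    case (5 j s')
    have same: "rmem s' ''vx'' = rmem s ''vx''" "rmem s' ''vy'' = rmem s ''vy''" "rmem s' ''eps'' = rmem s ''eps''"
      "rmem s' ''alpha'' = rmem s ''alpha''" "nmem s' ''n'' = nmem s ''n''" "nmem s' ''half'' = nmem s ''half''"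
      using 5(5) by (simp_all add: frame_def)
    show ?case
    proof (rule wp_mono[OF wp_search_arc[where k = j and n = n and L = L and s = s']], unfold same, goal_cases)
      case (9 t s'')
      have "P j (rmem s'' ''tau'' j) (rmem s'' ''F'' j)" "\<forall>k. k \<noteq> j \<longrightarrow> rmem s'' ''tau'' k = rmem s' ''tau'' k \<and> rmem s'' ''F'' k = rmem s' ''F'' k"
        using 9(1) by (auto simp: P_def f_def v_def \<epsilon>_def)
      then show ?case using 9 5(3,4) by (auto simp: nupd_def less_Suc_eq frame_def)
    qed (use 5 n half \<epsilon> in \<open>auto simp: \<epsilon>_def\<close>)
  next
    case (6 t s')
    define X where "X = n * n * (L + 5)"
    have "n * 1 \<le> n * (n * (L + 5))" using n by (intro mult_le_mono2) simp
    then have "n \<le> X" "1 \<le> X" using n by (auto simp: X_def mult.assoc)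
    moreover have "n * (3000 * n * (L + 5)) = 3000 * X" by (simp add: X_def)
    moreover have "t \<le> n * (3000 * n * (L + 5)) + n * 14 + 9"
      using 6(1) by (simp add: distrib_left)
    ultimately have "t + 10 \<le> 4000 * X" by linarith
    then show ?case using 6(2) by (simp add: X_def less_Suc_eq_le)
  qed simp_all
  then show ?thesis by (rule wp_mono) (auto simp: P_def)
qed

section \<open>Dynamic programming over group sizes\<close>

text \<open>Bellman's equation for splitting \<open>m\<close> into parts of size at most
  \<open>c\<close>: \<open>G m\<close> is the optimal value and \<open>ch m\<close> a part that
  attains it.\<close>

definition dp_step :: "(nat \<Rightarrow> real) \<Rightarrow> nat \<Rightarrow> (nat \<Rightarrow> real) \<Rightarrow> (nat \<Rightarrow> nat) \<Rightarrow> nat \<Rightarrow> bool" where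
  "dp_step F c G ch m \<longleftrightarrow> 1 \<le> ch m \<and> ch m \<le> m \<and> ch m \<le> c \<and> G m = F (ch m) + G (m - ch m) \<and>
     (\<forall>k. 1 \<le> k \<longrightarrow> k \<le> m \<longrightarrow> k \<le> c \<longrightarrow> G m \<le> F k + G (m - k))"

lemma dp_step_cong:
  "(\<And>j. j \<le> m \<Longrightarrow> G' j = G j \<and> ch' j = ch j) \<Longrightarrow> dp_step F c G' ch' m \<longleftrightarrow> dp_step F c G ch m"
  by (simp add: dp_step_def)

text \<open>Groups are peeled off one at a time; each step uses the inequality of
  \<open>dp_step\<close> for the size of the group removed.\<close>

lemma dp_le_partition_cost:
  assumes G: "G 0 = 0" "\<And>m. 1 \<le> m \<Longrightarrow> m \<le> n \<Longrightarrow> dp_step F c G ch m"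
    and "finite A" "\<And>a. a \<in> A \<Longrightarrow> 1 \<le> \<kappa> a \<and> \<kappa> a \<le> c" "sum \<kappa> A \<le> n"
  shows "G (sum \<kappa> A) \<le> (\<Sum>a\<in>A. F (\<kappa> a))"
  using assms(3-)
proof (induction A rule: finite_induct)
  case empty
  then show ?case using G by simp
next
  case (insert a A)
  have k: "1 \<le> \<kappa> a" "\<kappa> a \<le> c" using insert.prems by auto
  then have "dp_step F c G ch (\<kappa> a + sum \<kappa> A)" using G(2)[of "\<kappa> a + sum \<kappa> A"] insert by simp
  then have "G (\<kappa> a + sum \<kappa> A) \<le> F (\<kappa> a) + G (sum \<kappa> A)"
    using k unfolding dp_step_def by (metis add_diff_cancel_left' le_add1)
  also have "G (sum \<kappa> A) \<le> (\<Sum>a\<in>A. F (\<kappa> a))" using insert by simp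
  finally show ?case using insert.hyps by simp
qed

definition dp_inner :: com where
  "dp_inner =
     RSet ''G'' (NV ''m'') (RAdd (RGet ''F'' N1) (RGet ''G'' (NSub (NV ''m'') N1))) ;;
     NSet ''ch'' (NV ''m'') N1 ;;
     NSet ''k'' N0 (NConst 2) ;;
     For ''k'' (NAdd (NV ''m'') N1)
       (Cond (BAnd (NLess (NV ''k'') (NAdd (NGet ''cap'' N1) N1))
           (RLess (RAdd (RGet ''F'' (NV ''k'')) (RGet ''G'' (NSub (NV ''m'') (NV ''k'')))) (RGet ''G'' (NV ''m''))))
         (RSet ''G'' (NV ''m'') (RAdd (RGet ''F'' (NV ''k'')) (RGet ''G'' (NSub (NV ''m'') (NV ''k'')))) ;;
          NSet ''ch'' (NV ''m'') (NV ''k''))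
         Skip)"

lemma writes_dp_inner [simp]: "nwrites dp_inner = {''ch'', ''k''}" "rwrites dp_inner = {''G''}"
  by (auto simp: dp_inner_def)

lemma wp_dp_inner:
  fixes s :: state
  defines "F \<equiv> rmem s ''F''" and "c \<equiv> nmem s ''cap'' 1"
  assumes m: "nmem s ''m'' 0 = m" "1 \<le> m" and c: "1 \<le> c"
  shows "wp dp_inner s (\<lambda>t s'. t \<le> 100 * m + 100 \<and> dp_step F c (rmem s' ''G'') (nmem s' ''ch'') m \<and>
    (\<forall>j. j \<noteq> m \<longrightarrow> rmem s' ''G'' j = rmem s ''G'' j \<and> nmem s' ''ch'' j = nmem s ''ch'' j))"
proof -
  \<comment> \<open>\<open>G m\<close> is the minimum over part sizes below \<open>k\<close>.
    Smaller totals refer to the initial table because only entry \<open>m\<close> changes. Size 1 is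
    admissible as \<open>1 \<le> c\<close>, so it provides the starting value.\<close>
  define J where "J = (\<lambda>k G ch. 1 \<le> ch m \<and> ch m \<le> m \<and> ch m \<le> c \<and> G m = F (ch m) + rmem s ''G'' (m - ch m) \<and>
     (\<forall>i. 1 \<le> i \<longrightarrow> i < k \<longrightarrow> i \<le> c \<longrightarrow> G m \<le> F i + rmem s ''G'' (m - i)) \<and>
     (\<forall>j. j \<noteq> m \<longrightarrow> G j = rmem s ''G'' j \<and> ch j = nmem s ''ch'' j))"
  show ?thesis
    unfolding dp_inner_def wp_Seq wp_NSet wp_RSet
  proof (rule wp_For[where Inv = "\<lambda>k s'. J k (rmem s' ''G'') (nmem s' ''ch'')" and lo = 2 and h = "Suc m" and B = 60], goal_cases)
    case 1
    then show ?case using m c by (auto simp: J_def F_def numeral_2_eq_2 less_Suc_eq)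
  next
    case (4 s')
    then show ?case using m by (simp add: frame_def)
  next
    case (5 k s')
    have same: "rmem s' ''F'' = F" "nmem s' ''cap'' 1 = c" "nmem s' ''m'' 0 = m"
      using 5(5) m by (simp_all add: frame_def F_def c_def)
    have mk: "rmem s' ''G'' (m - k) = rmem s ''G'' (m - k)" using 5(1-3) m by (auto simp: J_def)
    show ?case
    proof (cases "k \<le> c \<and> F k + rmem s ''G'' (m - k) < rmem s' ''G'' m")
      case True
      have "F k + rmem s ''G'' (m - k) \<le> F i + rmem s ''G'' (m - i)" if "1 \<le> i" "i < Suc k" "i \<le> c" for i
        using True 5(3) that by (cases "i = k") (auto simp: J_def intro: order_trans[OF less_imp_le])
      then show ?thesis using True same mk 5(1-4) by (simp add: wp_simps nupd_def J_def)
    next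
      case False
      have "rmem s' ''G'' m \<le> F i + rmem s ''G'' (m - i)" if "1 \<le> i" "i < Suc k" "i \<le> c" for i
        using False 5(3) that by (cases "i = k") (auto simp: J_def)
      then show ?thesis using False same mk 5(1-4) by (auto simp: wp_simps nupd_def J_def less_Suc_eq_le)
    qed
  next
    case (6 t s')
    have J: "J (Suc m) (rmem s' ''G'') (nmem s' ''ch'')" by (rule 6(2))
    have eq: "rmem s' ''G'' (m - i) = rmem s ''G'' (m - i)" if "1 \<le> i" for i
      using J that m by (auto simp: J_def)
    have "rmem s' ''G'' m \<le> F i + rmem s ''G'' (m - i)" if "1 \<le> i" "i \<le> m" "i \<le> c" for i
      using J that le_imp_less_Suc unfolding J_def by blast
    then have "\<forall>i. 1 \<le> i \<longrightarrow> i \<le> m \<longrightarrow> i \<le> c \<longrightarrow> rmem s' ''G'' m \<le> F i + rmem s' ''G'' (m - i)"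
      by (simp add: eq)
    moreover have "1 \<le> nmem s' ''ch'' m \<and> nmem s' ''ch'' m \<le> m \<and> nmem s' ''ch'' m \<le> c \<and>
        rmem s' ''G'' m = F (nmem s' ''ch'' m) + rmem s' ''G'' (m - nmem s' ''ch'' m)"
      using J eq[of "nmem s' ''ch'' m"] by (simp add: J_def)
    ultimately have "dp_step F c (rmem s' ''G'') (nmem s' ''ch'') m"
      unfolding dp_step_def by blast
    moreover have "t + 50 \<le> 100 * m + 100" using 6(1) m by simp
    ultimately show ?case using J by (simp add: J_def)
  qed (use m in simp_all)
qed

definition dp_table :: com where
  "dp_table = RSet ''G'' N0 (RNat N0) ;; NSet ''m'' N0 N1 ;; For ''m'' (NAdd (NV ''n'') N1) dp_inner"

lemma writes_dp_table [simp]: "nwrites dp_table = {''ch'', ''k'', ''m''}" "rwrites dp_table = {''G''}"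
  by (auto simp: dp_table_def)

lemma wp_dp_table:
  fixes s :: state
  defines "F \<equiv> rmem s ''F''" and "c \<equiv> nmem s ''cap'' 1"
  assumes n: "nmem s ''n'' 0 = n" "1 \<le> n" and c: "1 \<le> c"
  shows "wp dp_table s (\<lambda>t s'. t \<le> 1000 * (n * n) \<and> rmem s' ''G'' 0 = 0 \<and>
    (\<forall>m. 1 \<le> m \<longrightarrow> m \<le> n \<longrightarrow> dp_step F c (rmem s' ''G'') (nmem s' ''ch'') m))"
  unfolding dp_table_def wp_Seq wp_NSet wp_RSet
proof (rule wp_For[where Inv = "\<lambda>j s'. rmem s' ''G'' 0 = 0 \<and> (\<forall>m. 1 \<le> m \<longrightarrow> m < j \<longrightarrow>
     dp_step F c (rmem s' ''G'') (nmem s' ''ch'') m)" and lo = 1 and h = "Suc n" and B = "100 * n + 100"], goal_cases)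
  case (4 s')
  then show ?case using n by (simp add: frame_def)
next
  case (5 j s')
  have same: "rmem s' ''F'' = F" "nmem s' ''cap'' = nmem s ''cap''"
    using 5(5) by (simp_all add: frame_def F_def)
  show ?case
  proof (rule wp_mono[OF wp_dp_inner[where m = j and s = s']], unfold same c_def[symmetric], goal_cases)
    case (4 t s'')
    have "dp_step F c (rmem s'' ''G'') (nmem s'' ''ch'') i" if "1 \<le> i" "i < Suc j" for i
    proof (cases "i = j")
      case True
      then show ?thesis using 4 by simp
    next
      case False
      then have "dp_step F c (rmem s'' ''G'') (nmem s'' ''ch'') i \<longleftrightarrow> dp_step F c (rmem s' ''G'') (nmem s' ''ch'') i"
        using 4 that by (intro dp_step_cong) auto
      then show ?thesis using False that 5(3) by simp
    qed
    moreover have "rmem s'' ''G'' 0 = 0" using 4(1) 5(1,3) by auto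
    ultimately show ?case using 4 5(2,4) by (simp add: nupd_def frame_def)
  qed (use 5 c in auto)
next
  case (6 t s')
  have "n * 1 \<le> n * n" using n by (intro mult_le_mono2) simp
  moreover have "t \<le> 100 * (n * n) + n * 200 + 100" using 6(1) by (simp add: algebra_simps)
  ultimately have "t + 10 \<le> 1000 * (n * n)" using n by linarith
  then show ?case using 6(2) by (simp add: less_Suc_eq_le)
qed simp_all

section \<open>Reading the groups off the table\<close>

definition mark_group :: com where
  "mark_group =
     NSet ''j'' N0 (NV ''b'') ;;
     For ''j'' (NV ''m'') (NSet ''grp'' (NV ''j'') (NAdd (NV ''steiner'') N1))"

lemma writes_mark_group [simp]: "nwrites mark_group = {''j'', ''grp''}" "rwrites mark_group = {}"
  by (auto simp: mark_group_def)

lemma wp_mark_group: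
  assumes "nmem s ''b'' 0 = b" "nmem s ''m'' 0 = m" "b \<le> m" "nmem s ''steiner'' 0 = p"
  shows "wp mark_group s (\<lambda>t s'. t \<le> 100 * m + 100 \<and>
    (\<forall>j. nmem s' ''grp'' j = (if b \<le> j \<and> j < m then Suc p else nmem s ''grp'' j)))"
  unfolding mark_group_def wp_Seq wp_NSet
proof (rule wp_For[where Inv = "\<lambda>i s'. \<forall>j. nmem s' ''grp'' j = (if b \<le> j \<and> j < i then Suc p else nmem s ''grp'' j)"
    and lo = b and h = m and B = 30], goal_cases)
  case (4 s')
  then show ?case using assms by (simp add: frame_def)
next
  case (5 j s')
  then show ?case using assms by (auto simp: wp_simps nupd_def frame_def less_Suc_eq)
next
  case (6 t s')
  have "(m - b) * (30 + 2 + 10) \<le> m * (30 + 2 + 10)" by (intro mult_le_mono1) simp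
  then show ?case using 6 by simp
qed (use assms in simp_all)

definition steiner_coord :: "string \<Rightarrow> string \<Rightarrow> rexp" where
  "steiner_coord z v = RAdd (RV z) (RMul (RGet ''tau'' (NV ''k'')) (RDiv
     (RAdd (RGet v (NAdd (NV ''b'') (NGet ''half'' (NSub (NV ''k'') N1)))) (RGet v (NAdd (NV ''b'') (NGet ''half'' (NV ''k'')))))
     (RNat (NConst 2))))"

definition place_group :: com where
  "place_group =
     NSet ''k'' N0 (NGet ''ch'' (NV ''m'')) ;;
     NSet ''b'' N0 (NSub (NV ''m'') (NV ''k'')) ;;
     mark_group ;;
     RSet ''steiner_x'' (NV ''steiner'') (steiner_coord ''sink_x'' ''vx'') ;;
     RSet ''steiner_y'' (NV ''steiner'') (steiner_coord ''sink_y'' ''vy'') ;;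
     NSet ''steiner'' N0 (NAdd (NV ''steiner'') N1) ;;
     NSet ''m'' N0 (NV ''b'')"

lemma writes_place_group [simp]: "nwrites place_group = {''k'', ''b'', ''j'', ''grp'', ''steiner'', ''m''}"
  "rwrites place_group = {''steiner_x'', ''steiner_y''}"
  by (auto simp: place_group_def)

lemma wp_place_group:
  fixes s :: state
  defines "v \<equiv> \<lambda>j. (rmem s ''vx'' j, rmem s ''vy'' j)"
  assumes m: "nmem s ''m'' 0 = m" and k: "nmem s ''ch'' m = k" "1 \<le> k" "k \<le> m" and p: "nmem s ''steiner'' 0 = p"
    and half: "nmem s ''half'' (k - 1) = (k - 1) div 2" "nmem s ''half'' k = k div 2"
  shows "wp place_group s (\<lambda>t s'. t \<le> 100 * m + 300 \<and> nmem s' ''m'' 0 = m - k \<and> nmem s' ''steiner'' 0 = Suc p \<and>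
    (\<forall>j. nmem s' ''grp'' j = (if m - k \<le> j \<and> j < m then Suc p else nmem s ''grp'' j)) \<and>
    (\<forall>c. output_steiner_pos s' c = (if c = p then (rmem s ''sink_x'' 0, rmem s ''sink_y'' 0) + rmem s ''tau'' k *\<^sub>R arc_mid v (m - k) k
       else output_steiner_pos s c)))"
  unfolding place_group_def wp_Seq wp_NSet wp_RSet
proof (rule wp_mono[OF wp_mark_group[where b = "m - k" and m = m and p = p]], goal_cases)
  case (5 t s')
  have same: "nmem s' ''k'' 0 = k" "nmem s' ''b'' 0 = m - k" "nmem s' ''steiner'' 0 = p"
    "nmem s' ''half'' = nmem s ''half''" "rmem s' = rmem s"
    using 5(2) m k p by (auto simp: frame_def)
  have val: "rval (steiner_coord z w) s'
      = rmem s z 0 + rmem s ''tau'' k * ((rmem s w (m - k + (k - 1) div 2) + rmem s w (m - k + k div 2)) / 2)" for z w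
    using same half by (simp add: steiner_coord_def)
  have val': "rval (steiner_coord z w) (s'\<lparr>rmem := (rmem s)(''steiner_x'' := X)\<rparr>) = rval (steiner_coord z w) s'"
    if "z \<noteq> ''steiner_x''" "w \<noteq> ''steiner_x''" for z w X
    using that by (simp add: steiner_coord_def same)
  have time: "rtime (steiner_coord z w) = 27" for z w by (simp add: steiner_coord_def)
  define X where "X = rval (steiner_coord ''sink_x'' ''vx'') s'"
  define Y where "Y = rval (steiner_coord ''sink_y'' ''vy'') s'"
  have XY: "(X, Y) = (rmem s ''sink_x'' 0, rmem s ''sink_y'' 0) + rmem s ''tau'' k *\<^sub>R arc_mid v (m - k) k"
    by (simp add: X_def Y_def val arc_mid_def v_def)
  have t: "t \<le> 100 * m + 100" and grp: "\<And>j. nmem s' ''grp'' j = (if m - k \<le> j \<and> j < m then Suc p else nmem s ''grp'' j)"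
    using 5(1) by simp_all
  show ?case using t by (simp add: output_steiner_pos_def same grp val' time XY flip: X_def Y_def)
qed (use m k p in simp_all)

definition rebuild :: com where
  "rebuild = (NSet ''steiner'' N0 N0 ;; NSet ''m'' N0 (NV ''n'')) ;; While (NLess N0 (NV ''m'')) place_group"

lemma writes_rebuild [simp]: "nwrites rebuild = {''k'', ''b'', ''j'', ''grp'', ''steiner'', ''m''}"
  "rwrites rebuild = {''steiner_x'', ''steiner_y''}"
  by (auto simp: rebuild_def)

text \<open>The circle positions \<open>m, \<dots>, n - 1\<close> are split into \<open>p\<close> intervals of at most \<open>c\<close> elements;
  \<open>grp\<close> counts them from 1, as 0 denotes the sink in the output.\<close>

definition grouping :: "nat \<Rightarrow> nat \<Rightarrow> nat \<Rightarrow> nat \<Rightarrow> (nat \<Rightarrow> nat) \<Rightarrow> (nat \<Rightarrow> nat) \<Rightarrow> (nat \<Rightarrow> nat) \<Rightarrow> bool" where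
  "grouping c n m p grp base len \<longleftrightarrow> (\<forall>j. m \<le> j \<longrightarrow> j < n \<longrightarrow> 1 \<le> grp j \<and> grp j \<le> p) \<and>
     (\<forall>i<p. m \<le> base i \<and> 1 \<le> len i \<and> len i \<le> c \<and> base i + len i \<le> n \<and>
        (\<forall>j. m \<le> j \<longrightarrow> j < n \<longrightarrow> grp j = Suc i \<longleftrightarrow> base i \<le> j \<and> j < base i + len i))"

lemma wp_rebuild:
  fixes s :: state
  defines "v \<equiv> \<lambda>j. (rmem s ''vx'' j, rmem s ''vy'' j)" and "G \<equiv> rmem s ''G''" and "F \<equiv> rmem s ''F''"
  assumes n: "nmem s ''n'' 0 = n" "1 \<le> n" and half: "\<And>i. i \<le> n \<Longrightarrow> nmem s ''half'' i = i div 2"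
    and G: "G 0 = 0" "\<And>m. 1 \<le> m \<Longrightarrow> m \<le> n \<Longrightarrow> dp_step F c G (nmem s ''ch'') m"
  shows "wp rebuild s (\<lambda>t s'. t \<le> 1000 * (n * n) \<and> (\<exists>base len. grouping c n 0 (nmem s' ''steiner'' 0) (nmem s' ''grp'') base len \<and>
    G n = (\<Sum>i<nmem s' ''steiner'' 0. F (len i)) \<and>
    (\<forall>i<nmem s' ''steiner'' 0. output_steiner_pos s' i = (rmem s ''sink_x'' 0, rmem s ''sink_y'' 0) + rmem s ''tau'' (len i) *\<^sub>R arc_mid v (base i) (len i))))"
proof -
  let ?z = "(rmem s ''sink_x'' 0, rmem s ''sink_y'' 0)"
  define s1 where "s1 = s\<lparr>nmem := (nmem s)(''steiner'' := (nmem s ''steiner'')(0 := 0), ''m'' := (nmem s ''m'')(0 := n))\<rparr>"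
  \<comment> \<open>The choices are traced back from \<open>n\<close>: positions from
    \<open>m\<close> on are already grouped, at total cost \<open>G n - G m\<close>. The number
    \<open>m\<close> of remaining positions serves as the measure.\<close>
  define J where "J = (\<lambda>m (s' :: state). m \<le> n \<and> nmem s' ''m'' 0 = m \<and> (\<exists>base len. grouping c n m (nmem s' ''steiner'' 0) (nmem s' ''grp'') base len \<and>
    G n = G m + (\<Sum>i<nmem s' ''steiner'' 0. F (len i)) \<and>
    (\<forall>i<nmem s' ''steiner'' 0. output_steiner_pos s' i = ?z + rmem s ''tau'' (len i) *\<^sub>R arc_mid v (base i) (len i))))"
  have loop: "wp (While (NLess N0 (NV ''m'')) place_group) s1 (\<lambda>t s'. t \<le> n * ((100 * n + 300) + btime (NLess N0 (NV ''m'')) + 1) + btime (NLess N0 (NV ''m'')) + 1 \<and>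
     (\<exists>m. J m s') \<and> \<not> bval (NLess N0 (NV ''m'')) s' \<and> frame (nwrites place_group) (rwrites place_group) s1 s')"
  proof (rule wp_While_measure)
    show "J n s1" by (simp add: J_def s1_def grouping_def)
    show "frame (nwrites place_group) (rwrites place_group) s1 s1" by (rule frame_refl)
  next
    fix m s' assume J: "J m s'" and fr: "frame (nwrites place_group) (rwrites place_group) s1 s'" and g: "bval (NLess N0 (NV ''m'')) s'"
    define p where "p = nmem s' ''steiner'' 0"
    from J obtain base len where mn: "m \<le> n" "nmem s' ''m'' 0 = m" and gr: "grouping c n m p (nmem s' ''grp'') base len"
      and Gn: "G n = G m + (\<Sum>i<p. F (len i))"
      and pos: "\<And>i. i < p \<Longrightarrow> output_steiner_pos s' i = ?z + rmem s ''tau'' (len i) *\<^sub>R arc_mid v (base i) (len i)"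
      unfolding J_def p_def by blast
    have m0: "0 < m" using g mn by simp
    define k where "k = nmem s ''ch'' m"
    have k: "1 \<le> k" "k \<le> m" "k \<le> c" "G m = F k + G (m - k)" using G(2)[of m] m0 mn by (auto simp: dp_step_def k_def)
    have same: "nmem s' ''ch'' = nmem s ''ch''" "nmem s' ''half'' = nmem s ''half''" "rmem s' ''vx'' = rmem s ''vx''" "rmem s' ''vy'' = rmem s ''vy''"
      "rmem s' ''tau'' = rmem s ''tau''" "rmem s' ''sink_x'' = rmem s ''sink_x''" "rmem s' ''sink_y'' = rmem s ''sink_y''"
      using fr by (simp_all add: frame_def s1_def)
    have "wp place_group s' (\<lambda>t s''. t \<le> 100 * n + 300 \<and> (\<exists>k'<m. J k' s''))"
    proof (rule wp_mono[OF wp_place_group[where m = m and k = k and p = p and s = s']], unfold same, goal_cases)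
      case (8 t s'')
      define base' where "base' = base(p := m - k)"
      define len' where "len' = len(p := k)"
      have grp: "nmem s'' ''grp'' j = (if m - k \<le> j \<and> j < m then Suc p else nmem s' ''grp'' j)" for j
        using 8 by simp
      have "grouping c n (m - k) (Suc p) (nmem s'' ''grp'') base' len'"
        unfolding grouping_def
      proof (intro conjI allI impI)
        fix j assume j: "m - k \<le> j" "j < n"
        show "1 \<le> nmem s'' ''grp'' j"
          using gr j unfolding grp by (cases "j < m") (auto simp: grouping_def)
        show "nmem s'' ''grp'' j \<le> Suc p"
          using gr j unfolding grp by (cases "j < m") (auto simp: grouping_def le_SucI)
      next
        fix i assume i: "i < Suc p"
        show "m - k \<le> base' i" "1 \<le> len' i" "len' i \<le> c" "base' i + len' i \<le> n"
          using i gr k mn by (auto simp: base'_def len'_def grouping_def less_Suc_eq intro: le_trans[of "m - k" m])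
        fix j assume j: "m - k \<le> j" "j < n"
        show "(nmem s'' ''grp'' j = Suc i) = (base' i \<le> j \<and> j < base' i + len' i)"
        proof (cases "i = p")
          case True
          \<comment> \<open>Numbers given out so far are at most \<open>p\<close>, so
            \<open>Suc p\<close> is fresh.\<close>
          have "nmem s' ''grp'' j \<noteq> Suc p" if "m \<le> j" using gr j that by (fastforce simp: grouping_def)
          then show ?thesis using True j k unfolding grp by (auto simp: base'_def len'_def)
        next
          case False
          then have "i < p" using i by simp
          then have b: "m \<le> base i" "m \<le> j \<Longrightarrow> nmem s' ''grp'' j = Suc i \<longleftrightarrow> base i \<le> j \<and> j < base i + len i"
            using gr j by (auto simp: grouping_def)
          show ?thesis
          proof (cases "m \<le> j")
            case True
            then show ?thesis using b False unfolding grp by (simp add: base'_def len'_def)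
          next
            case f: False
            then have "nmem s'' ''grp'' j = Suc p" using j unfolding grp by simp
            then show ?thesis using b(1) False f by (simp add: base'_def len'_def)
          qed
        qed
      qed
      moreover have "G n = G (m - k) + (\<Sum>i<Suc p. F (len' i))"
        using Gn k(4) by (simp add: len'_def)
      moreover have "output_steiner_pos s'' i = ?z + rmem s ''tau'' (len' i) *\<^sub>R arc_mid v (base' i) (len' i)" if "i < Suc p" for i
        using 8 pos[of i] that by (cases "i = p") (simp_all add: base'_def len'_def v_def)
      ultimately have "J (m - k) s''" using 8 mn unfolding J_def by auto
      then show ?case using 8 mn k by (auto intro!: exI[of _ "m - k"])
    qed (use mn k same half k_def p_def in auto)
    then show "0 < m \<and> wp place_group s' (\<lambda>t s''. t \<le> 100 * n + 300 \<and> (\<exists>k'<m. J k' s''))" using m0 by simp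
  qed
  have init: "wp (NSet ''steiner'' N0 N0 ;; NSet ''m'' N0 (NV ''n'')) s (\<lambda>t s'. t \<le> 10 \<and> s' = s1)"
    using n by (simp add: wp_simps s1_def)
  show ?thesis
    unfolding rebuild_def
  proof (subst wp_Seq, rule wp_mono[OF init], goal_cases)
    case (1 t0 s0)
    then have s0: "t0 \<le> 10" "s0 = s1" by auto
    show ?case unfolding s0(2)
    proof (rule wp_mono[OF loop], goal_cases)
      case (1 t s')
      have "n * 1 \<le> n * n" using n by (intro mult_le_mono2) simp
      moreover have "t \<le> 100 * (n * n) + n * 400 + 10" using 1(1) by (simp add: algebra_simps)
      ultimately have "t0 + t \<le> 1000 * (n * n)" using n s0 by linarith
      moreover have "J 0 s'"
      proof -
        obtain m where m: "J m s'" using 1(1) by blast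
        then have "nmem s' ''m'' 0 = m" by (simp add: J_def)
        then have "m = 0" using 1(1) by simp
        then show ?thesis using m by simp
      qed
      ultimately show ?case using G(1) unfolding J_def by auto
    qed
  qed
qed

section \<open>Matching input sources with circle positions\<close>

text \<open>Equality of reals is tested as neither being less than the other. It is reliable because
  arithmetic is exact and the regenerated vertices coincide with the sources.\<close>

definition assign_parents :: com where
  "assign_parents =
     NSet ''i'' N0 N0 ;;
     For ''i'' (NV ''n'')
       (NSet ''j'' N0 N0 ;;
        For ''j'' (NV ''n'')
          (Cond (BAnd
              (BAnd (BNot (RLess (RGet ''vx'' (NV ''j'')) (RGet ''ux'' (NV ''i'')))) (BNot (RLess (RGet ''ux'' (NV ''i'')) (RGet ''vx'' (NV ''j'')))))
              (BAnd (BNot (RLess (RGet ''vy'' (NV ''j'')) (RGet ''uy'' (NV ''i'')))) (BNot (RLess (RGet ''uy'' (NV ''i'')) (RGet ''vy'' (NV ''j''))))))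
            (NSet ''source_parent'' (NV ''i'') (NGet ''grp'' (NV ''j'')))
            Skip))"

lemma writes_assign_parents [simp]: "nwrites assign_parents = {''i'', ''j'', ''source_parent''}" "rwrites assign_parents = {}"
  by (auto simp: assign_parents_def)

lemma wp_assign_parents:
  assumes n: "nmem s ''n'' 0 = n" "1 \<le> n"
    and \<kappa>: "\<And>i j. i < n \<Longrightarrow> j < n \<Longrightarrow> rmem s ''vx'' j = rmem s ''ux'' i \<and> rmem s ''vy'' j = rmem s ''uy'' i \<longleftrightarrow> j = \<kappa> i"
      "\<And>i. i < n \<Longrightarrow> \<kappa> i < n"
  shows "wp assign_parents s (\<lambda>t s'. t \<le> 1000 * (n * n) \<and> (\<forall>i<n. nmem s' ''source_parent'' i = nmem s ''grp'' (\<kappa> i)))"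
  unfolding assign_parents_def wp_Seq wp_NSet
proof (rule wp_For[where Inv = "\<lambda>j s'. \<forall>i<j. nmem s' ''source_parent'' i = nmem s ''grp'' (\<kappa> i)" and lo = 0 and h = n and B = "100 * n + 50"], goal_cases)
  case (4 s')
  then show ?case using n by (simp add: frame_def)
next
  case (5 i s')
  note outer = 5
  show ?case unfolding wp_Seq wp_NSet
  proof (rule wp_For[where Inv = "\<lambda>j s''. (\<forall>i'<i. nmem s'' ''source_parent'' i' = nmem s ''grp'' (\<kappa> i')) \<and>
       (\<kappa> i < j \<longrightarrow> nmem s'' ''source_parent'' i = nmem s ''grp'' (\<kappa> i))" and lo = 0 and h = n and B = 70], goal_cases)
    case 1
    then show ?case using outer by simp
  next
    case (4 s'')
    then show ?case using n outer by (simp add: frame_def)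
  next
    case (5 j s'')
    have same: "rmem s'' ''vx'' = rmem s ''vx''" "rmem s'' ''vy'' = rmem s ''vy''" "rmem s'' ''ux'' = rmem s ''ux''" "rmem s'' ''uy'' = rmem s ''uy''"
      "nmem s'' ''grp'' = nmem s ''grp''" "nmem s'' ''i'' 0 = i"
      using 5(5) outer by (simp_all add: frame_def)
    have eq: "(\<not> rmem s ''vx'' j < rmem s ''ux'' i \<and> \<not> rmem s ''ux'' i < rmem s ''vx'' j) \<and>
        (\<not> rmem s ''vy'' j < rmem s ''uy'' i \<and> \<not> rmem s ''uy'' i < rmem s ''vy'' j) \<longleftrightarrow> j = \<kappa> i"
      using \<kappa>(1)[OF outer(2) 5(2)] by linarith
    show ?case
    proof (cases "j = \<kappa> i")
      case True
      then show ?thesis using 5(1-4) same eq by (auto simp: wp_simps nupd_def)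
    next
      case False
      then show ?thesis using 5(1-4) same eq by (auto simp: wp_simps nupd_def less_Suc_eq)
    qed
  next
    case (6 t s'')
    then show ?case using outer \<kappa>(2)[OF outer(2)] by (auto simp: nupd_def less_Suc_eq frame_def)
  qed simp_all
next
  case (6 t s')
  have "n * 1 \<le> n * n" using n by (intro mult_le_mono2) simp
  moreover have "t \<le> 100 * (n * n) + n * 100 + 10" using 6(1) by (simp add: algebra_simps)
  ultimately have "t + 20 \<le> 1000 * (n * n)" using n by linarith
  then show ?case using 6(2) by simp
qed simp_all

section \<open>Correctness\<close>

text \<open>The numbering \<open>f\<close> and the angle \<theta> merely exist; the program sees the
  sources only in the order \<open>xs\<close>, relative to which its output is decoded.\<close>

locale equally_spaced_instance =
  fixes I :: flamecast and t :: nat and xs :: "nat list" and \<epsilon> :: real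
    and z :: point and r \<theta> :: real and f :: "nat \<Rightarrow> nat" and n :: nat
  assumes inst: "is_instance I" "intermediate_layers I = 1" "sinks I = {t}"
    and ne: "sources I \<noteq> {}" and xs: "distinct xs" "set xs = sources I" and eps: "0 < \<epsilon>"
    and n_def: "n = card (sources I)" and r: "0 < r" and sink: "sink_pos I t = z"
    and f: "bij_betw f {..<n} (sources I)"
    and pos: "\<And>k. k < n \<Longrightarrow> source_pos I (f k) = z + circle_point n r \<theta> k"
begin

lemma length_xs: "length xs = n"
  using xs n_def distinct_card by metis

lemma n_pos: "1 \<le> n"
  using ne inst(1) by (simp add: n_def is_instance_def Suc_le_eq card_gt_0_iff)

lemma xs_ne: "xs \<noteq> []"
  using length_xs n_pos by auto

lemma alpha_bounds: "0 \<le> alpha I" "alpha I \<le> 1"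
  using inst by (auto simp: is_instance_def)

lemma caps1: "1 \<le> caps I ! 1" "length (caps I) = 3"
proof -
  show "length (caps I) = 3" using inst by (auto simp: is_instance_def intermediate_layers_def)
  then show "1 \<le> caps I ! 1" using inst(1) by (auto simp: is_instance_def)
qed

definition idx :: "nat \<Rightarrow> nat" where
  "idx i = inv_into {..<n} f (xs ! i)"

lemma idx: "i < n \<Longrightarrow> idx i < n" "i < n \<Longrightarrow> f (idx i) = xs ! i"
proof -
  assume "i < n"
  then have "xs ! i \<in> f ` {..<n}"
    using f xs length_xs nth_mem[of i xs] by (simp add: bij_betw_def)
  then show "idx i < n" "f (idx i) = xs ! i"
    unfolding idx_def using inv_into_into[of "xs ! i" f "{..<n}"] f_inv_into_f[of "xs ! i" f "{..<n}"] by auto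
qed

lemma idx_inj: "i < n \<Longrightarrow> j < n \<Longrightarrow> idx i = idx j \<Longrightarrow> i = j"
  by (metis idx(2) nth_eq_iff_index_eq length_xs xs(1))

lemma idx_surj: "k < n \<Longrightarrow> \<exists>i<n. idx i = k"
proof -
  have "idx ` {..<n} = {..<n}"
    using idx idx_inj by (intro endo_inj_surj) (auto simp: inj_on_def)
  then show "k < n \<Longrightarrow> \<exists>i<n. idx i = k" by (metis imageE lessThan_iff)
qed

lemma source_pos_idx: "i < n \<Longrightarrow> source_pos I (xs ! i) = z + circle_point n r \<theta> (idx i)"
  using pos[of "idx i"] idx[of i] by simp

definition \<theta>\<^sub>0 :: real where
  "\<theta>\<^sub>0 = \<theta> + 2 * pi * real (idx 0) / real n"

text \<open>\<open>idx i\<close> is the position of source \<open>xs ! i\<close> on the circle counted from angle \<open>\<theta>\<close>, and \<open>slot i\<close>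
  the position counted from source \<open>xs ! 0\<close>, as the program does.\<close>

definition slot :: "nat \<Rightarrow> nat" where
  "slot i = (idx i + (n - idx 0)) mod n"

lemma slot_less: "slot i < n"
  using n_pos by (simp add: slot_def)

text \<open>Adding \<open>n - idx 0\<close> avoids natural subtraction of \<open>idx 0\<close>; the
  surplus of one full turn is removed by periodicity.\<close>

lemma source_pos_slot:
  assumes "i < n"
  shows "source_pos I (xs ! i) = z + circle_point n r \<theta>\<^sub>0 (slot i)"
proof -
  have "circle_point n r \<theta>\<^sub>0 (slot i) = circle_point n r \<theta>\<^sub>0 (idx i + (n - idx 0))"
    unfolding slot_def by (rule circle_point_mod[OF n_pos])
  also have "\<dots> = circle_point n r \<theta> (idx i + n)"
    unfolding \<theta>\<^sub>0_def circle_point_shift using idx(1)[of 0] n_pos by simp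
  also have "\<dots> = circle_point n r \<theta> (idx i)" by (rule circle_point_add_period[OF n_pos])
  finally show ?thesis using source_pos_idx[OF assms] by simp
qed

text \<open>Sources sharing a slot would share a position, whereas distinct vertices of the polygon
  are distinct points.\<close>

lemma bij_slot: "bij_betw slot {..<n} {..<n}"
proof -
  have "inj_on slot {..<n}"
  proof (rule inj_onI)
    fix i j assume ij: "i \<in> {..<n}" "j \<in> {..<n}" "slot i = slot j"
    then have "circle_point n r \<theta> (idx i) = circle_point n r \<theta> (idx j)"
      using source_pos_slot[of i] source_pos_slot[of j] source_pos_idx[of i] source_pos_idx[of j] by simp
    then have "idx i = idx j" using circle_point_inj[OF r] idx(1) ij by blast
    then show "i = j" using idx_inj ij by simp
  qed
  moreover have "slot ` {..<n} \<subseteq> {..<n}" using slot_less by auto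
  ultimately show ?thesis by (simp add: bij_betw_def endo_inj_surj)
qed

text \<open>No other source has a larger inner product with source 0 than an adjacent one, and some
  input index does belong to an adjacent position, so the maximum is attained there.\<close>

lemma neighbour_cos:
  assumes "2 \<le> n" "1 \<le> b" "b < n"
    and dt: "\<And>i. i < n \<Longrightarrow> dt i = r\<^sup>2 * cos (2 * pi * real (idx 0) / real n - 2 * pi * real (idx i) / real n)"
    and max: "\<And>i. 1 \<le> i \<Longrightarrow> i < n \<Longrightarrow> dt i \<le> dt b"
  shows "dt b / dt 0 = cos (2 * pi / real n)"
proof -
  have i0: "idx 0 < n" using idx n_pos by simp
  \<comment> \<open>A position next to \<open>idx 0\<close> chosen without wrapping around: the
    predecessor if \<open>idx 0\<close> is the last one.\<close>
  define k where "k = (if idx 0 + 1 < n then idx 0 + 1 else idx 0 - 1)"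
  have k: "k < n" "k \<noteq> idx 0" using i0 assms(1) by (auto simp: k_def)
  obtain i where i: "i < n" "idx i = k" using idx_surj k by blast
  then have "1 \<le> i" using k by (cases i) auto
  have "cos (2 * pi * real (idx 0) / real n - 2 * pi * real k / real n) = cos (2 * pi / real n)"
  proof (cases "idx 0 + 1 < n")
    case True
    then have "2 * pi * real (idx 0) / real n - 2 * pi * real k / real n = - (2 * pi / real n)"
      by (simp add: k_def distrib_left add_divide_distrib)
    then show ?thesis by simp
  next
    case False
    then have "2 * pi * real (idx 0) / real n - 2 * pi * real k / real n = 2 * pi / real n"
      using i0 assms(1) by (simp add: k_def of_nat_diff right_diff_distrib diff_divide_distrib)
    then show ?thesis by simp
  qed
  then have "dt i = r\<^sup>2 * cos (2 * pi / real n)" using dt i by simp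
  moreover have "dt i \<le> dt b" using max \<open>1 \<le> i\<close> i by simp
  moreover have "dt b \<le> r\<^sup>2 * cos (2 * pi / real n)"
  proof -
    have "idx 0 \<noteq> idx b" using idx_inj[of 0 b] assms by auto
    then show ?thesis using dt[of b] assms idx i0 by (auto intro!: mult_left_mono cos_step_max)
  qed
  ultimately have "dt b = r\<^sup>2 * cos (2 * pi / real n)" by simp
  moreover have "dt 0 = r\<^sup>2" using dt[of 0] n_pos by simp
  ultimately show ?thesis using r by simp
qed

section \<open>The table value against arbitrary layouts and against the output\<close>

text \<open>The group sizes of a valid layout partition \<open>n\<close> into parts of size at most
  \<open>caps I ! 1\<close>, so the table value is at most the sum of their \<open>F\<close> values,
  each within the factor \<open>1 + \<epsilon>\<close> of the cost of its group.\<close>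

lemma layout_cost_ge_dp:
  assumes valid: "valid_topology I T"
    and Fk: "\<And>k d. 1 \<le> k \<Longrightarrow> k \<le> n \<Longrightarrow> d \<in> {0..arc_mid_radius n r k} \<Longrightarrow>
        F k \<le> (1 + \<epsilon>) * arc_cost n r (alpha I) k d"
    and G: "G 0 = 0" "\<And>m. 1 \<le> m \<Longrightarrow> m \<le> n \<Longrightarrow> dp_step F (caps I ! 1) G ch m"
  shows "G n \<le> (1 + \<epsilon>) * layout_cost I T q"
proof -
  obtain h :: "nat \<Rightarrow> vertex" and P where
    small: "\<And>v. v \<in> h ` sources I \<Longrightarrow> card {s\<in>sources I. h s = v} \<le> caps I ! 1" and
    cost: "(\<Sum>v\<in>h ` sources I. (\<Sum>s | s \<in> sources I \<and> h s = v. norm (source_pos I s - P v))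
        + real (card {s\<in>sources I. h s = v}) powr alpha I * norm (P v - sink_pos I t)) \<le> layout_cost I T q"
    using valid_layout_groups[OF inst valid, of q] by blast
  have fin: "finite (sources I)" using inst by (simp add: is_instance_def)
  let ?A = "h ` sources I" and ?S = "\<lambda>v. {s\<in>sources I. h s = v}"
  let ?c = "\<lambda>v. (\<Sum>s\<in>?S v. norm (source_pos I s - P v)) + real (card (?S v)) powr alpha I * norm (P v - sink_pos I t)"
  have k1: "1 \<le> card (?S v)" if "v \<in> ?A" for v
    using that fin by (auto simp: Suc_le_eq card_gt_0_iff)
  have group: "F (card (?S v)) \<le> (1 + \<epsilon>) * ?c v" if v: "v \<in> ?A" for v
  proof -
    define J where "J = {j\<in>{..<n}. f j \<in> ?S v}"
    have img: "f ` J = ?S v"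
    proof -
      have e: "f ` {..<n} = sources I" using f by (simp add: bij_betw_def)
      have "s \<in> f ` J" if s: "s \<in> ?S v" for s
      proof -
        have "s \<in> f ` {..<n}" using s e by simp
        then obtain j where "j < n" "s = f j" by auto
        then show ?thesis using s by (auto simp: J_def)
      qed
      moreover have "f ` J \<subseteq> ?S v" by (auto simp: J_def)
      ultimately show ?thesis by blast
    qed
    have inj: "inj_on f J" using f inj_on_subset[of f "{..<n}" J] by (auto simp: bij_betw_def J_def)
    have card: "card J = card (?S v)" using card_image[OF inj] img by simp
    have "card (?S v) \<le> n" unfolding n_def using fin by (intro card_mono) auto
    obtain d where d: "d \<in> {0..arc_mid_radius n r (card (?S v))}" and
      le: "arc_cost n r (alpha I) (card (?S v)) d \<le>
        (\<Sum>j\<in>J. norm (circle_point n r \<theta> j - (P v - z))) + real (card (?S v)) powr alpha I * norm (P v - z)"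
      using group_cost_ge_arc_cost[OF r, of J n "card (?S v)" "alpha I" \<theta> "P v - z"] card k1[OF v]
      unfolding circle_point_def J_def by blast
    have "(\<Sum>s\<in>?S v. norm (source_pos I s - P v)) = (\<Sum>j\<in>J. norm (source_pos I (f j) - P v))"
      unfolding img[symmetric] using inj by (simp add: sum.reindex)
    also have "\<dots> = (\<Sum>j\<in>J. norm (circle_point n r \<theta> j - (P v - z)))"
      by (intro sum.cong refl) (simp add: J_def pos algebra_simps)
    finally have "arc_cost n r (alpha I) (card (?S v)) d \<le> ?c v" using le sink by simp
    then have "(1 + \<epsilon>) * arc_cost n r (alpha I) (card (?S v)) d \<le> (1 + \<epsilon>) * ?c v"
      using eps by (intro mult_left_mono) auto
    then show ?thesis using Fk[OF k1[OF v] \<open>card (?S v) \<le> n\<close> d] by linarith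
  qed
  have total: "(\<Sum>v\<in>?A. card (?S v)) = n"
    unfolding n_def card_eq_sum using fin by (intro sum.group) auto
  have "G (\<Sum>v\<in>?A. card (?S v)) \<le> (\<Sum>v\<in>?A. F (card (?S v)))"
    using fin small k1 total by (intro dp_le_partition_cost[OF G]) auto
  also have "\<dots> \<le> (\<Sum>v\<in>?A. (1 + \<epsilon>) * ?c v)" using group by (intro sum_mono)
  also have "\<dots> = (1 + \<epsilon>) * (\<Sum>v\<in>?A. ?c v)" by (simp only: sum_distrib_left)
  also have "\<dots> \<le> (1 + \<epsilon>) * layout_cost I T q" using cost eps by (intro mult_left_mono) auto
  finally show ?thesis using total by simp
qed

text \<open>The bijection \<open>slot\<close> carries every group onto an interval of positions, so
  each group costs exactly what an arc of its length costs, wherever it starts.\<close>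

lemma output_layout:
  assumes grouping: "grouping (caps I ! 1) n 0 (nmem s ''steiner'' 0) grp base len"
    and parents: "\<And>i. i < n \<Longrightarrow> nmem s ''source_parent'' i = grp (slot i)" "\<And>j. nmem s ''steiner_parent'' j = 0"
    and at: "\<And>i. i < nmem s ''steiner'' 0 \<Longrightarrow>
        output_steiner_pos s i = z + \<tau> (len i) *\<^sub>R arc_mid (circle_point n r \<theta>\<^sub>0) (base i) (len i)"
    and \<tau>: "\<And>k. 1 \<le> k \<Longrightarrow> k \<le> n \<Longrightarrow> 0 \<le> \<tau> k"
    and cap: "n \<le> caps I ! 0"
  shows "valid_topology I (output_topology xs t s)"
    and "layout_cost I (output_topology xs t s) (output_steiner_pos s)
      = (\<Sum>i<nmem s ''steiner'' 0. arc_cost n r (alpha I) (len i) (\<tau> (len i) * arc_mid_radius n r (len i)))"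
proof -
  define p where "p = nmem s ''steiner'' 0"
  define g where "g = (\<lambda>i. grp (slot i) - 1)"
  let ?v = "circle_point n r \<theta>\<^sub>0" and ?q = "output_steiner_pos s"
  have grp: "1 \<le> grp (slot i)" "grp (slot i) \<le> p" for i
    using grouping slot_less[of i] by (auto simp: grouping_def p_def)
  have b: "1 \<le> len c" "len c \<le> caps I ! 1" "base c + len c \<le> n"
    "\<And>j. j < n \<Longrightarrow> grp j = Suc c \<longleftrightarrow> base c \<le> j \<and> j < base c + len c" if "c < p" for c
    using grouping that by (auto simp: grouping_def p_def)
  have g_iff: "g i = c \<longleftrightarrow> base c \<le> slot i \<and> slot i < base c + len c" if "c < p" for i c
    using b(4)[OF that slot_less[of i]] grp[of i] by (auto simp: g_def)
  have topo: "output_topology xs t s = \<lparr>verts = Source ` set xs \<union> {Sink t} \<union> Steiner ` {..<p},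
    edges = {(Source (xs ! i), Steiner (g i)) | i. i < length xs} \<union> {(Steiner j, Sink t) | j. j < p}\<rparr>"
  proof -
    have "output_node t (nmem s ''source_parent'' i) = Steiner (g i)" if "i < n" for i
      using parents(1)[OF that] grp[of i] by (simp add: output_node_def g_def)
    then have "{(Source (xs ! i), output_node t (nmem s ''source_parent'' i)) | i. i < length xs}
        = {(Source (xs ! i), Steiner (g i)) | i. i < length xs}" using length_xs by (auto; metis)
    then show ?thesis by (simp add: output_topology_def parents(2) output_node_def p_def)
  qed
  have members: "bij_betw slot {i. i < n \<and> g i = c} {base c..<base c + len c}" if "c < p" for c
  proof -
    have "slot ` {i. i < n \<and> g i = c} = {base c..<base c + len c}"
    proof
      show "slot ` {i. i < n \<and> g i = c} \<subseteq> {base c..<base c + len c}" using g_iff[OF that] by auto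
      show "{base c..<base c + len c} \<subseteq> slot ` {i. i < n \<and> g i = c}"
      proof
        fix j assume j: "j \<in> {base c..<base c + len c}"
        then have "j \<in> slot ` {..<n}" using b(3)[OF that] bij_slot by (auto simp: bij_betw_def)
        then show "j \<in> slot ` {i. i < n \<and> g i = c}" using j g_iff[OF that] by auto
      qed
    qed
    moreover have "inj_on slot {i. i < n \<and> g i = c}"
      using bij_slot by (auto simp: bij_betw_def intro: inj_on_subset)
    ultimately show ?thesis by (simp add: bij_betw_def)
  qed
  have card: "card {i. i < n \<and> g i = c} = len c" if "c < p" for c
    using bij_betw_same_card[OF members[OF that]] by simp
  have gim: "g ` {..<length xs} = {..<p}"
  proof
    have "g i < p" for i using grp[of i] by (auto simp: g_def)
    then show "g ` {..<length xs} \<subseteq> {..<p}" by auto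
    show "{..<p} \<subseteq> g ` {..<length xs}"
    proof
      fix c assume c: "c \<in> {..<p}"
      then have "card {i. i < n \<and> g i = c} \<noteq> 0" using card[of c] b(1)[of c] by simp
      then have "{i. i < n \<and> g i = c} \<noteq> {}" by (metis card.empty)
      then show "c \<in> g ` {..<length xs}" using length_xs by auto
    qed
  qed
  have caps: "length xs \<le> caps I ! 0" "\<And>j. j < p \<Longrightarrow> card {i. i < length xs \<and> g i = j} \<le> caps I ! 1"
    using cap card b(2) length_xs by auto
  note two = two_level_topology[OF inst xs xs_ne gim caps]
  show "valid_topology I (output_topology xs t s)" unfolding topo by (rule two(1))
  have group: "(\<Sum>i | i < n \<and> g i = c. norm (source_pos I (xs ! i) - ?q c)) + real (card {i. i < n \<and> g i = c}) powr alpha I * norm (?q c - z)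
      = arc_cost n r (alpha I) (len c) (\<tau> (len c) * arc_mid_radius n r (len c))" if c: "c < p" for c
  proof -
    let ?w = "\<tau> (len c) *\<^sub>R arc_mid ?v (base c) (len c)"
    have q: "?q c = z + ?w" using at c by (simp add: p_def)
    have "(\<Sum>i | i < n \<and> g i = c. norm (source_pos I (xs ! i) - ?q c)) = (\<Sum>i | i < n \<and> g i = c. norm (?v (slot i) - ?w))"
      by (intro sum.cong refl) (simp add: source_pos_slot q)
    also have "\<dots> = (\<Sum>j\<in>{base c..<base c + len c}. norm (?v j - ?w))"
      by (rule sum.reindex_bij_betw[OF members[OF c]])
    also have "\<dots> = (\<Sum>j<len c. norm (?v (base c + j) - ?w))"
      using sum.shift_bounds_nat_ivl[of "\<lambda>j. norm (?v j - ?w)" 0 "base c" "len c"]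
      by (simp add: lessThan_atLeast0 add.commute)
    finally have "(\<Sum>i | i < n \<and> g i = c. norm (source_pos I (xs ! i) - ?q c)) + real (card {i. i < n \<and> g i = c}) powr alpha I * norm (?q c - z)
      = star_cost (len c) (\<lambda>j. ?v (base c + j)) (alpha I) ?w"
      unfolding star_cost_def card[OF c] by (simp add: q)
    also have "\<dots> = arc_cost n r (alpha I) (len c) (\<tau> (len c) * arc_mid_radius n r (len c))"
      using b(1,3)[OF c] n_pos \<tau>[of "len c"] by (intro star_cost_arc) auto
    finally show ?thesis .
  qed
  have "layout_cost I (output_topology xs t s) ?q = (\<Sum>c<p. (\<Sum>i | i < n \<and> g i = c. norm (source_pos I (xs ! i) - ?q c))
      + real (card {i. i < n \<and> g i = c}) powr alpha I * norm (?q c - z))"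
    using two(2)[of ?q] unfolding topo length_xs sink .
  also have "\<dots> = (\<Sum>i<p. arc_cost n r (alpha I) (len i) (\<tau> (len i) * arc_mid_radius n r (len i)))"
    using group by (intro sum.cong) auto
  finally show "layout_cost I (output_topology xs t s) ?q
      = (\<Sum>i<nmem s ''steiner'' 0. arc_cost n r (alpha I) (len i) (\<tau> (len i) * arc_mid_radius n r (len i)))"
    by (simp only: p_def)
qed

end

section \<open>Assembly of the phases\<close>

definition flamecast_program :: com where
  "flamecast_program =
     center_sources ;; find_neighbour ;; walk_circle ;; make_halves ;; arc_table ;; dp_table ;; rebuild ;; assign_parents"

context equally_spaced_instance
begin

lemma wp_flamecast_program:
  assumes L: "1 / \<epsilon> \<le> 2 ^ L"
  shows "wp flamecast_program (input_state I xs t \<epsilon>) (\<lambda>time s. time \<le> 4000 * (n * n * (L + 6)) \<and>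
    (feasible I \<longrightarrow> valid_topology I (output_topology xs t s) \<and>
       layout_cost I (output_topology xs t s) (output_steiner_pos s) \<le> (1 + \<epsilon>) * opt_cost I))"
proof -
  define s0 where "s0 = input_state I xs t \<epsilon>"
  define \<alpha> where "\<alpha> = alpha I"
  let ?v = "circle_point n r \<theta>\<^sub>0"
  have in_n: "nmem s0 ''n'' 0 = n" "nmem s0 ''cap'' 1 = caps I ! 1" "\<And>j. nmem s0 ''half'' j = 0" "\<And>j. nmem s0 ''steiner_parent'' j = 0"
    using length_xs caps1 by (simp_all add: s0_def input_state_def)
  have in_r: "\<And>i. i < n \<Longrightarrow> (rmem s0 ''source_x'' i, rmem s0 ''source_y'' i) = source_pos I (xs ! i)"
    "(rmem s0 ''sink_x'' 0, rmem s0 ''sink_y'' 0) = z" "rmem s0 ''alpha'' 0 = \<alpha>" "rmem s0 ''eps'' 0 = \<epsilon>"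
    using length_xs sink by (simp_all add: s0_def input_state_def \<alpha>_def)
  show ?thesis
    unfolding flamecast_program_def wp_Seq s0_def[symmetric]
  proof (rule wp_mono[OF wp_center_sources[OF in_n(1)]], goal_cases)
    case (1 t1 s1)
    have n1: "nmem s1 ''n'' 0 = n" using 1(2) in_n by (simp add: frame_def)
    have u1: "(rmem s1 ''ux'' i, rmem s1 ''uy'' i) = circle_point n r \<theta> (idx i)" if "i < n" for i
      using 1(1) that in_r(1)[OF that] in_r(2) source_pos_idx[OF that] by (simp add: prod_eq_iff)
    have u0: "circle_point n r \<theta> (idx 0) = r *\<^sub>R (cos \<theta>\<^sub>0, sin \<theta>\<^sub>0)"
      by (simp add: circle_point_def \<theta>\<^sub>0_def)
    note f1 = 1
    show ?case
    proof (rule wp_mono[OF wp_find_neighbour[OF n1 n_pos]], goal_cases)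
      case (1 t2 s2)
      define dt where "dt = (\<lambda>i. rmem s2 ''ux'' 0 * rmem s2 ''ux'' i + rmem s2 ''uy'' 0 * rmem s2 ''uy'' i)"
      have u: "rmem s2 ''ux'' = rmem s1 ''ux''" "rmem s2 ''uy'' = rmem s1 ''uy''" using 1(2) by (simp_all add: frame_def)
      have n2: "nmem s2 ''n'' 0 = n" using 1(2) n1 by (simp add: frame_def)
      have dt: "dt i = r\<^sup>2 * cos (2 * pi * real (idx 0) / real n - 2 * pi * real (idx i) / real n)" if "i < n" for i
        unfolding circle_point_dot[of n r \<theta> "idx 0" "idx i", symmetric]
        using u1[OF that] u1[of 0] n_pos by (simp add: dt_def u prod_eq_iff)
      have c: "dt (nmem s2 ''b'' 0) / dt 0 = cos (2 * pi / real n)" if "2 \<le> n"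
        using that 1(1) dt by (intro neighbour_cos) (auto simp: dt_def u max_def split: if_splits)
      have sn: "0 \<le> sin (2 * pi / real n)" if "2 \<le> n"
        using that by (intro sin_ge_zero) (auto simp: field_simps)
      have ux: "rmem s2 ''ux'' 0 = r * cos \<theta>\<^sub>0" "rmem s2 ''uy'' 0 = r * sin \<theta>\<^sub>0"
        using u1[of 0] u0 u n_pos by (auto simp: prod_eq_iff)
      note f2 = 1
      show ?case
      proof (rule wp_mono[OF wp_walk_circle[OF n2 n_pos ux c[unfolded dt_def] sn]], goal_cases)
        case (3 t3 s3)
        have v3: "(rmem s3 ''vx'' i, rmem s3 ''vy'' i) = ?v i" if "i < n" for i
        proof -
          have "(rmem s3 ''vx'' i, rmem s3 ''vy'' i) = r *\<^sub>R (cos (\<theta>\<^sub>0 + real i * (2 * pi / real n)), sin (\<theta>\<^sub>0 + real i * (2 * pi / real n)))"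
            using 3(1) that by blast
          then show ?thesis by (simp add: circle_point_def mult_ac)
        qed
        have n3: "nmem s3 ''n'' 0 = n" "nmem s3 ''half'' 0 = 0" "nmem s3 ''half'' 1 = 0"
          using 3(2) f2(2) f1(2) in_n by (simp_all add: frame_def)
        note f3 = 3
        show ?case
        proof (rule wp_mono[OF wp_make_halves[OF n3(1) n_pos n3(2,3)]], goal_cases)
          case (1 t4 s4)
          have n4: "nmem s4 ''n'' 0 = n" and e4: "rmem s4 ''eps'' 0 = \<epsilon>" and a4: "rmem s4 ''alpha'' 0 = \<alpha>"
            using 1(2) n3 f3(2) f2(2) f1(2) in_r by (simp_all add: frame_def)
          have v4: "(rmem s4 ''vx'' i, rmem s4 ''vy'' i) = ?v i" if "i < n" for i
            using v3[OF that] 1(2) by (simp add: frame_def)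
          have h4: "nmem s4 ''half'' i = i div 2" if "i \<le> n" for i using 1(1) that by simp
          note f4 = 1
          show ?case
          proof (rule wp_mono[OF wp_arc_table[where n = n and L = L and s = s4]], goal_cases)
            case (6 t5 s5)
            define f where "f = (\<lambda>k \<tau>. star_cost k ?v \<alpha> (\<tau> *\<^sub>R arc_mid ?v 0 k))"
            define F where "F = rmem s5 ''F''"
            define \<tau> where "\<tau> = rmem s5 ''tau''"
            have arc: "\<exists>b. brackets_min (f k) (\<tau> k) b \<and> 0 \<le> \<tau> k \<and> 8 * real n * (b - \<tau> k) \<le> \<epsilon> * real k \<and> F k = f k (\<tau> k)"
              if k: "1 \<le> k" "k \<le> n" for k
            proof -
              let ?V = "\<lambda>j. (rmem s4 ''vx'' j, rmem s4 ''vy'' j)"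
              have eq1: "arc_mid ?V 0 k = arc_mid ?v 0 k"
                using v4 k by (intro arc_mid_cong) auto
              have eq2: "star_cost k ?V \<alpha> p = star_cost k ?v \<alpha> p" for p
                unfolding star_cost_def using v4 k by simp
              have "\<exists>b. brackets_min (\<lambda>\<tau>. star_cost k ?V \<alpha> (\<tau> *\<^sub>R arc_mid ?V 0 k)) (\<tau> k) b \<and> 0 \<le> \<tau> k \<and>
                  8 * real n * (b - \<tau> k) \<le> \<epsilon> * real k \<and> F k = star_cost k ?V \<alpha> (\<tau> k *\<^sub>R arc_mid ?V 0 k)"
                using 6(1) k by (simp add: a4 e4 F_def \<tau>_def)
              then show ?thesis unfolding f_def eq1 eq2 .
            qed
            have Fk: "F k \<le> (1 + \<epsilon>) * arc_cost n r \<alpha> k d" if k: "1 \<le> k" "k \<le> n" "d \<in> {0..arc_mid_radius n r k}" for k d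
            proof -
              obtain b where b: "brackets_min (f k) (\<tau> k) b" "0 \<le> \<tau> k" "8 * real n * (b - \<tau> k) \<le> \<epsilon> * real k" "F k = f k (\<tau> k)"
                using arc[OF k(1,2)] by blast
              have "f k (\<tau> k) \<le> (1 + \<epsilon>) * arc_cost n r \<alpha> k d"
                by (rule bracket_approximates_arc_cost[OF r k(1,2) _ eps _ b(1-3) k(3)])
                   (use alpha_bounds in \<open>auto simp: \<alpha>_def f_def\<close>)
              then show ?thesis using b by simp
            qed
            \<comment> \<open>\<open>F k\<close> is not just an estimate but the cost realised by
              the stored \<open>\<tau> k\<close>; hence the cost of the output equals
              \<open>G n\<close>.\<close>
            have Feq: "F k = arc_cost n r \<alpha> k (\<tau> k * arc_mid_radius n r k)" "0 \<le> \<tau> k" if "1 \<le> k" "k \<le> n" for k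
              using arc[OF that] star_cost_arc[OF that(1) n_pos, of "\<tau> k" r \<theta>\<^sub>0 0 \<alpha>] by (auto simp: f_def)
            have n5: "nmem s5 ''n'' 0 = n" "nmem s5 ''cap'' 1 = caps I ! 1"
              using 6(2) n4 f4(2) f3(2) f2(2) f1(2) in_n by (simp_all add: frame_def)
            have c5: "1 \<le> nmem s5 ''cap'' 1" using n5 caps1 by simp
            note f5 = 6
            show ?case
            proof (rule wp_mono[OF wp_dp_table[OF n5(1) n_pos c5]], goal_cases)
              case (1 t6 s6)
              define G where "G = rmem s6 ''G''"
              have Fs: "rmem s6 ''F'' = F" "rmem s6 ''tau'' = \<tau>" using 1(2) by (simp_all add: frame_def F_def \<tau>_def)
              have G: "G 0 = 0" "\<And>m. 1 \<le> m \<Longrightarrow> m \<le> n \<Longrightarrow> dp_step F (caps I ! 1) G (nmem s6 ''ch'') m"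
                using 1(1) n5 by (simp_all add: G_def F_def)
              have n6: "nmem s6 ''n'' 0 = n" using 1(2) n5 by (simp add: frame_def)
              have h6: "nmem s6 ''half'' i = i div 2" if "i \<le> n" for i
                using h4[OF that] 1(2) f5(2) by (simp add: frame_def)
              have v6: "(rmem s6 ''vx'' i, rmem s6 ''vy'' i) = ?v i" if "i < n" for i
                using v4[OF that] 1(2) f5(2) by (simp add: frame_def)
              note f6 = 1
              show ?case
              proof (rule wp_mono[OF wp_rebuild[where s = s6 and c = "caps I ! 1", OF n6 n_pos h6]], goal_cases)
                case (4 t7 s7)
                have z6: "(rmem s6 ''sink_x'' 0, rmem s6 ''sink_y'' 0) = z"
                  using in_r(2) f6(2) f5(2) f4(2) f3(2) f2(2) f1(2) by (simp add: frame_def)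
                have n7: "nmem s7 ''n'' 0 = n" using 4(2) n6 by (simp add: frame_def)
                have uv: "rmem s7 ''vx'' j = rmem s7 ''ux'' i \<and> rmem s7 ''vy'' j = rmem s7 ''uy'' i \<longleftrightarrow> j = slot i" if "i < n" "j < n" for i j
                proof -
                  have "(rmem s7 ''vx'' j, rmem s7 ''vy'' j) = ?v j"
                    using v6[OF that(2)] 4(2) by (simp add: frame_def)
                  moreover have "(rmem s7 ''ux'' i, rmem s7 ''uy'' i) = ?v (slot i)"
                  proof -
                    have "?v (slot i) = circle_point n r \<theta> (idx i)"
                      using source_pos_slot[OF that(1)] source_pos_idx[OF that(1)] by simp
                    then show ?thesis using u1[OF that(1)] 4(2) f6(2) f5(2) f4(2) f3(2) f2(2) by (simp add: frame_def)
                  qed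
                  moreover have "?v j = ?v (slot i) \<longleftrightarrow> j = slot i"
                    using circle_point_inj[OF r that(2) slot_less] by blast
                  ultimately show ?thesis by (metis prod.inject)
                qed
                note f7 = 4
                show ?case
                proof (rule wp_mono[OF wp_assign_parents[OF n7 n_pos uv slot_less]], goal_cases)
                  case (3 t8 s8)
                  have st: "nmem s8 ''steiner'' = nmem s7 ''steiner''" "output_steiner_pos s8 = output_steiner_pos s7"
                    using 3(2) by (simp_all add: frame_def output_steiner_pos_def fun_eq_iff)
                  let ?V = "\<lambda>j. (rmem s6 ''vx'' j, rmem s6 ''vy'' j)"
                  have "\<exists>base len. grouping (caps I ! 1) n 0 (nmem s8 ''steiner'' 0) (nmem s7 ''grp'') base len \<and>
                      G n = (\<Sum>i<nmem s8 ''steiner'' 0. F (len i)) \<and>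
                      (\<forall>i<nmem s8 ''steiner'' 0. output_steiner_pos s8 i = z + \<tau> (len i) *\<^sub>R arc_mid ?V (base i) (len i))"
                    using conjunct2[OF f7(1)] unfolding z6 Fs G_def[symmetric] st .
                  then obtain base len where gr: "grouping (caps I ! 1) n 0 (nmem s8 ''steiner'' 0) (nmem s7 ''grp'') base len"
                    and Gn: "G n = (\<Sum>i<nmem s8 ''steiner'' 0. F (len i))"
                    and at: "\<And>i. i < nmem s8 ''steiner'' 0 \<Longrightarrow> output_steiner_pos s8 i = z + \<tau> (len i) *\<^sub>R arc_mid ?V (base i) (len i)"
                    by blast
                  have len: "1 \<le> len i" "base i + len i \<le> n" "len i \<le> n" if "i < nmem s8 ''steiner'' 0" for i
                    using gr that by (auto simp: grouping_def)
                  have at': "output_steiner_pos s8 i = z + \<tau> (len i) *\<^sub>R arc_mid ?v (base i) (len i)" if "i < nmem s8 ''steiner'' 0" for i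
                    using at[OF that] arc_mid_cong[OF v6 len(2)[OF that] len(1)[OF that]] by simp
                  have par: "nmem s8 ''source_parent'' i = nmem s7 ''grp'' (slot i)" if "i < n" for i
                    using 3(1) that by simp
                  \<comment> \<open>This bank is never written, and its initial zeros denote the
                    sink.\<close>
                  have spar: "nmem s8 ''steiner_parent'' j = 0" for j
                    using 3(2) f7(2) f6(2) f5(2) f4(2) f3(2) f2(2) f1(2) in_n(4) by (simp add: frame_def)
                  have "valid_topology I (output_topology xs t s8) \<and>
                     layout_cost I (output_topology xs t s8) (output_steiner_pos s8) \<le> (1 + \<epsilon>) * opt_cost I" if feas: "feasible I"
                  proof -
                    have cap: "n \<le> caps I ! 0" using feasible_imp_card_le[OF inst(3) ne feas] by (simp add: n_def)
                    have valid: "valid_topology I (output_topology xs t s8)"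
                      by (rule output_layout(1)[OF gr par spar at' Feq(2) cap])
                    have "layout_cost I (output_topology xs t s8) (output_steiner_pos s8)
                      = (\<Sum>i<nmem s8 ''steiner'' 0. arc_cost n r (alpha I) (len i) (\<tau> (len i) * arc_mid_radius n r (len i)))"
                      by (rule output_layout(2)[OF gr par spar at' Feq(2) cap])
                    also have "\<dots> = G n"
                      unfolding Gn using Feq(1) len by (intro sum.cong) (auto simp: \<alpha>_def)
                    also have "\<dots> \<le> (1 + \<epsilon>) * opt_cost I"
                    proof -
                      \<comment> \<open>The optimum is an infimum, so the bound is divided by
                        \<open>1 + \<epsilon>\<close> and proved for each valid layout; the output
                        itself shows that there is one.\<close>
                      have "G n / (1 + \<epsilon>) \<le> opt_cost I"
                        unfolding opt_cost_def
                      proof (rule cInf_greatest)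
                        show "{layout_cost I T q | T q. valid_topology I T} \<noteq> {}" using valid by blast
                        fix x assume "x \<in> {layout_cost I T q | T q. valid_topology I T}"
                        then obtain T q where x: "x = layout_cost I T q" "valid_topology I T" by blast
                        have "G n \<le> (1 + \<epsilon>) * x"
                          unfolding x(1) using x(2) Fk G by (intro layout_cost_ge_dp) (auto simp: \<alpha>_def)
                        then show "G n / (1 + \<epsilon>) \<le> x" using eps by (simp add: field_simps)
                      qed
                      then show ?thesis using eps by (simp add: field_simps)
                    qed
                    finally show ?thesis using valid by simp
                  qed
                  moreover have "t1 + (t2 + (t3 + (t4 + (t5 + (t6 + (t7 + t8)))))) \<le> 4000 * (n * n * (L + 6))"
                  proof -
                    have "n * 1 \<le> n * n" using n_pos by (intro mult_le_mono2) simp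
                    moreover have "4000 * (n * n * (L + 6)) = 4000 * (n * n * (L + 5)) + 4000 * (n * n)" by (simp add: algebra_simps)
                    moreover have "t1 \<le> 100 * n + 100" "t2 \<le> 100 * n + 100" "t3 \<le> 100 * n + 200" "t4 \<le> 100 * n + 100"
                      "t5 \<le> 4000 * (n * n * (L + 5))" "t6 \<le> 1000 * (n * n)" "t7 \<le> 1000 * (n * n)" "t8 \<le> 1000 * (n * n)"
                      using f1(1) f2(1) f3(1) f4(1) f5(1) f6(1) f7(1) 3(1) by blast+
                    ultimately show ?thesis using n_pos by linarith
                  qed
                  ultimately show ?case by blast
                qed
              qed (use G in \<open>auto simp: G_def Fs\<close>)
            qed
          qed (use n4 n_pos h4 e4 eps L in auto)
        qed
      qed
    qed
  qed
qed

end

theorem corollary27: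
  shows "\<exists>prog C. \<forall>I t xs \<epsilon>.
    is_instance I \<and> source_equally_spaced_circular I \<and> intermediate_layers I = 1 \<and>
    sinks I = {t} \<and> sources I \<noteq> {} \<and> distinct xs \<and> set xs = sources I \<and> 0 < \<epsilon> \<longrightarrow>
    (\<exists>time s.
       exec prog (input_state I xs t \<epsilon>) time s \<and>
       real time \<le> C * real (card (sources I)) ^ 2 * (max 1 (log 2 (1 / \<epsilon>))) ^ 3 \<and>
       (feasible I \<longrightarrow>
          valid_topology I (output_topology xs t s) \<and>
          layout_cost I (output_topology xs t s) (output_steiner_pos s) \<le> (1 + \<epsilon>) * opt_cost I))"
proof (intro exI[of _ flamecast_program] exI[of _ "32000 :: real"] allI impI)
  fix I t xs \<epsilon>
  assume a: "is_instance I \<and> source_equally_spaced_circular I \<and> intermediate_layers I = 1 \<and>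
    sinks I = {t} \<and> sources I \<noteq> {} \<and> distinct xs \<and> set xs = sources I \<and> 0 < (\<epsilon> :: real)"
  define n where "n = card (sources I)"
  obtain z r \<theta> f where c: "circular I z r" and f: "bij_betw f {..<n} (sources I)"
    and pos: "\<And>k. k < n \<Longrightarrow> source_pos I (f k) = z + circle_point n r \<theta> k"
    using a unfolding source_equally_spaced_circular_def Let_def n_def circle_point_def by blast
  interpret equally_spaced_instance I t xs \<epsilon> z r \<theta> f n
    using a c f pos by unfold_locales (auto simp: n_def circular_def)
  define M where "M = max 1 (log 2 (1 / \<epsilon>))"
  \<comment> \<open>Rounding up ensures \<open>1 / \<epsilon> \<le> 2 ^ L\<close>. The maximum with
    1 in \<open>M\<close> covers large \<epsilon>, whose logarithm would be small or
    negative.\<close>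
  define L where "L = nat \<lceil>M\<rceil>"
  have M1: "1 \<le> M" by (simp add: M_def)
  have L: "M \<le> real L" "real L \<le> 2 * M" using M1 by (auto simp: L_def) linarith
  have "1 / \<epsilon> = 2 powr log 2 (1 / \<epsilon>)" using a by simp
  also have "\<dots> \<le> 2 powr real L" using L by (intro powr_mono) (auto simp: M_def)
  also have "\<dots> = 2 ^ L" by (simp add: powr_realpow)
  finally obtain time s where e: "exec flamecast_program (input_state I xs t \<epsilon>) time s"
    and time: "time \<le> 4000 * (n * n * (L + 6))"
    and good: "feasible I \<longrightarrow> valid_topology I (output_topology xs t s) \<and>
       layout_cost I (output_topology xs t s) (output_steiner_pos s) \<le> (1 + \<epsilon>) * opt_cost I"
    using wp_flamecast_program[of L] unfolding wp_def by blast
  have "real time \<le> real (4000 * (n * n * (L + 6)))" using time by (simp only: of_nat_le_iff)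
  also have "\<dots> = 4000 * (real n)\<^sup>2 * (real L + 6)" by (simp add: power2_eq_square)
  \<comment> \<open>From \<open>L \<le> 2 * M\<close> and \<open>1 \<le> M\<close>,
    \<open>L + 6\<close> is at most \<open>8 * M\<close>, and 4000 times 8 is the constant
    32000.\<close>
  also have "\<dots> \<le> 4000 * (real n)\<^sup>2 * (8 * M)" using L M1 by (intro mult_left_mono) auto
  also have "\<dots> \<le> 4000 * (real n)\<^sup>2 * (8 * M ^ 3)"
    using M1 self_le_power[of M 3] by (intro mult_left_mono) auto
  finally have "real time \<le> 32000 * real n ^ 2 * M ^ 3" by simp
  then show "\<exists>time s. exec flamecast_program (input_state I xs t \<epsilon>) time s \<and>
       real time \<le> 32000 * real (card (sources I)) ^ 2 * (max 1 (log 2 (1 / \<epsilon>))) ^ 3 \<and>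
       (feasible I \<longrightarrow>
          valid_topology I (output_topology xs t s) \<and>
          layout_cost I (output_topology xs t s) (output_steiner_pos s) \<le> (1 + \<epsilon>) * opt_cost I)"
    using e good unfolding n_def M_def by blast
qed

end
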